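(* Let $m\in\mathbb Z_{\ge0}$ and let $t\in\mathbb N$ with $t>mg$ be such that both $t$ and $t-mg$ are relatively prime to every coefficient $c_i$ of $\theta=\sum_ic_i\alpha_i$. Then \[\chi(\mathrm{Cat}^m_s(\Delta),t)=\frac{\#W}{f}\,\#\big((t-mg)\mathcal A\cap P^\vee\big).\]
   Context: $\Delta$ is an irreducible reduced crystallographic root system with two root lengths in a real Euclidean space $V$ with $W$-invariant inner product $(\cdot,\cdot)$; $W$ its Weyl group, $\Delta^+$ positive roots, $\Pi=\{\alpha_1,\dots,\alpha_p\}$ simple roots, $\Pi_s$ short simple roots, $\Delta^+_s,\Delta^+_l$ short/long positive roots, $\theta=\sum_ic_i\alpha_i$ the highest root, $g=\sum_{i:\alpha_i\in\Pi_s}c_i$. $Q^\vee$ is the coroot lattice spanned by $\alpha_i^\vee=2\alpha_i/(\alpha_i,\alpha_i)$, $P^\vee=\{x\in V:(x,\alpha_i)\in\mathbb Z\ \forall i\}$ the coweight lattice, $f=[P^\vee:Q^\vee]$. $\mathcal A=\{x\in V:(x,\alpha)>0\ \forall\alpha\in\Pi,\ (x,\theta)<1\}$ and $c\mathcal A$ is its dilation by $c$. With $\mathcal H_{\mu,k}=\{x:(x,\mu)=k\}$, the $m$-semi-Catalan arrangement $\mathrm{Cat}^m_s(\Delta)$ consists of the hyperplanes $\mathcal H_{\mu,k}$ ($\mu\in\Delta^+_s$, $k=-m,\dots,m$) and $\mathcal H_{\nu,0}$ ($\nu\in\Delta^+_l$). $\chi(\mathcal A',t)$ denotes the characteristic polynomial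 of an arrangement $\mathcal A'$: $\chi(\mathcal A',t)=\sum_{X}\mu(V,X)t^{\dim X}$ over the poset of nonempty intersections of hyperplanes of $\mathcal A'$ (including $V$), ordered by reverse inclusion, $\mu$ its Möbius function. *)

theory Defs
  imports "HOL-Analysis.Analysis" "HOL-Computational_Algebra.Polynomial"
begin

section \<open>Root systems\<close>

definition reflection :: "'a::euclidean_space \<Rightarrow> 'a \<Rightarrow> 'a" where
  "reflection \<alpha> x = x - (2 * (x \<bullet> \<alpha>) / (\<alpha> \<bullet> \<alpha>)) *\<^sub>R \<alpha>"

text \<open>The ambient space is the whole type; its inner product is invariant under all reflections,
  hence under the Weyl group.\<close>

definition crystallographic_root_system :: "'a::euclidean_space set \<Rightarrow> bool" where
  "crystallographic_root_system \<Delta> \<longleftrightarrow>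
     finite \<Delta> \<and> 0 \<notin> \<Delta> \<and> span \<Delta> = UNIV \<and>
     (\<forall>\<alpha>\<in>\<Delta>. reflection \<alpha> ` \<Delta> = \<Delta>) \<and>
     (\<forall>\<alpha>\<in>\<Delta>. \<forall>\<beta>\<in>\<Delta>. 2 * (\<beta> \<bullet> \<alpha>) / (\<alpha> \<bullet> \<alpha>) \<in> \<int>)"

definition reduced_roots :: "'a::euclidean_space set \<Rightarrow> bool" where
  "reduced_roots \<Delta> \<longleftrightarrow> (\<forall>\<alpha>\<in>\<Delta>. \<forall>c::real. c *\<^sub>R \<alpha> \<in> \<Delta> \<longrightarrow> c = 1 \<or> c = -1)"

definition irreducible_roots :: "'a::euclidean_space set \<Rightarrow> bool" where
  "irreducible_roots \<Delta> \<longleftrightarrow>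
     \<Delta> \<noteq> {} \<and>
     \<not> (\<exists>A B. A \<noteq> {} \<and> B \<noteq> {} \<and> A \<union> B = \<Delta> \<and> A \<inter> B = {} \<and>
              (\<forall>\<alpha>\<in>A. \<forall>\<beta>\<in>B. \<alpha> \<bullet> \<beta> = 0))"

definition two_root_lengths :: "'a::euclidean_space set \<Rightarrow> bool" where
  "two_root_lengths \<Delta> \<longleftrightarrow> card (norm ` \<Delta>) = 2"

definition short_roots :: "'a::euclidean_space set \<Rightarrow> 'a set" where
  "short_roots \<Delta> = {\<alpha>\<in>\<Delta>. norm \<alpha> = Min (norm ` \<Delta>)}"

definition long_roots :: "'a::euclidean_space set \<Rightarrow> 'a set" where
  "long_roots \<Delta> = {\<alpha>\<in>\<Delta>. norm \<alpha> = Max (norm ` \<Delta>)}"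

definition nonneg_combinations :: "'a::euclidean_space set \<Rightarrow> 'a set" where
  "nonneg_combinations S = {(\<Sum>\<alpha>\<in>S. real (n \<alpha>) *\<^sub>R \<alpha>) | n. True}"

definition simple_roots :: "'a::euclidean_space set \<Rightarrow> 'a set \<Rightarrow> bool" where
  "simple_roots \<Delta> S \<longleftrightarrow>
     S \<subseteq> \<Delta> \<and> independent S \<and>
     (\<forall>\<beta>\<in>\<Delta>. \<beta> \<in> nonneg_combinations S \<or> - \<beta> \<in> nonneg_combinations S)"

definition positive_roots :: "'a::euclidean_space set \<Rightarrow> 'a set \<Rightarrow> 'a set" where
  "positive_roots \<Delta> S = \<Delta> \<inter> nonneg_combinations S"

definition highest_root :: "'a::euclidean_space set \<Rightarrow> 'a set \<Rightarrow> 'a \<Rightarrow> bool" where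
  "highest_root \<Delta> S \<theta> \<longleftrightarrow> \<theta> \<in> \<Delta> \<and> (\<forall>\<beta>\<in>\<Delta>. \<theta> - \<beta> \<in> nonneg_combinations S)"

text \<open>Reflections are involutions, so closure under left multiplication by reflections already
  gives the group they generate.\<close>

inductive_set weyl_group :: "'a::euclidean_space set \<Rightarrow> ('a \<Rightarrow> 'a) set"
  for \<Delta> :: "'a set" where
  id: "id \<in> weyl_group \<Delta>"
| reflect: "\<lbrakk>\<alpha> \<in> \<Delta>; w \<in> weyl_group \<Delta>\<rbrakk> \<Longrightarrow> reflection \<alpha> \<circ> w \<in> weyl_group \<Delta>"

definition coroot :: "'a::euclidean_space \<Rightarrow> 'a" where
  "coroot \<alpha> = (2 / (\<alpha> \<bullet> \<alpha>)) *\<^sub>R \<alpha>"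

definition coroot_lattice :: "'a::euclidean_space set \<Rightarrow> 'a set" where
  "coroot_lattice S = {(\<Sum>\<alpha>\<in>S. real_of_int (n \<alpha>) *\<^sub>R coroot \<alpha>) | n. True}"

definition coweight_lattice :: "'a::euclidean_space set \<Rightarrow> 'a set" where
  "coweight_lattice S = {x. \<forall>\<alpha>\<in>S. x \<bullet> \<alpha> \<in> \<int>}"

definition subgroup_index :: "'a::ab_group_add set \<Rightarrow> 'a set \<Rightarrow> nat" where
  "subgroup_index P Q = card (P // {(x, y). x \<in> P \<and> y \<in> P \<and> x - y \<in> Q})"

definition fundamental_alcove :: "'a::euclidean_space set \<Rightarrow> 'a \<Rightarrow> 'a set" where
  "fundamental_alcove S \<theta> = {x. (\<forall>\<alpha>\<in>S. x \<bullet> \<alpha> > 0) \<and> x \<bullet> \<theta> < 1}"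

section \<open>Affine hyperplane arrangements\<close>

definition hyperplane :: "'a::euclidean_space \<Rightarrow> real \<Rightarrow> 'a set" where
  "hyperplane \<mu> k = {x. x \<bullet> \<mu> = k}"

text \<open>The empty intersection is the whole space.\<close>

definition intersection_poset :: "'a set set \<Rightarrow> 'a set set" where
  "intersection_poset \<A> = {\<Inter>\<B> | \<B>. \<B> \<subseteq> \<A> \<and> \<Inter>\<B> \<noteq> {}}"

text \<open>The Moebius function \<open>\<mu>(X, Y)\<close> of a finite family \<open>L\<close> of sets ordered by
  \<^emph>\<open>reverse\<close> inclusion, so that \<open>X\<close> precedes \<open>Y\<close> iff \<open>Y \<subseteq> X\<close>: it satisfies \<open>\<mu>(X, X) = 1\<close> and, for
  \<open>X\<close> strictly preceding \<open>Y\<close>, \<open>\<mu>(X, Y)\<close> is minus the sum of \<open>\<mu>(X, Z)\<close> over all \<open>Z\<close> in \<open>L\<close> with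
  \<open>X\<close> preceding or equal to \<open>Z\<close> and \<open>Z\<close> strictly preceding \<open>Y\<close>. The value is 0 outside of \<open>L\<close>, for
  infinite \<open>L\<close>, and if \<open>X\<close> does not precede \<open>Y\<close>.\<close>

function moebius :: "'a set set \<Rightarrow> 'a set \<Rightarrow> 'a set \<Rightarrow> int" where
  "moebius L X Y =
     (if finite L \<and> X \<in> L \<and> Y \<in> L \<and> Y \<subseteq> X then
        if X = Y then 1 else - (\<Sum>Z\<in>{Z\<in>L. Y \<subset> Z \<and> Z \<subseteq> X}. moebius L X Z)
      else 0)"
  by pat_completeness auto
termination
proof (relation "Wellfounded.measure (\<lambda>(L, X, Y). card {Z\<in>L. Y \<subset> Z})")
  fix L :: "'a set set" and X Y Z
  assume "finite L \<and> X \<in> L \<and> Y \<in> L \<and> Y \<subseteq> X" and "Z \<in> {Z\<in>L. Y \<subset> Z \<and> Z \<subseteq> X}"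
  then have "finite {Z\<in>L. Y \<subset> Z}" and "{Z'\<in>L. Z \<subset> Z'} \<subset> {Z\<in>L. Y \<subset> Z}"
    by auto
  then show "((L, X, Z), (L, X, Y)) \<in> Wellfounded.measure (\<lambda>(L, X, Y). card {Z\<in>L. Y \<subset> Z})"
    by (simp add: psubset_card_mono)
qed simp

declare moebius.simps [simp del]

definition characteristic_polynomial :: "'a::euclidean_space set set \<Rightarrow> int poly" where
  "characteristic_polynomial \<A> =
     (\<Sum>X\<in>intersection_poset \<A>.
        monom (moebius (intersection_poset \<A>) UNIV X) (nat (aff_dim X)))"

definition semi_catalan_arrangement ::
    "nat \<Rightarrow> 'a::euclidean_space set \<Rightarrow> 'a set \<Rightarrow> 'a set set" where
  "semi_catalan_arrangement m \<Delta> S =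
     {hyperplane \<mu> (real_of_int k) | \<mu> k.
        \<mu> \<in> positive_roots \<Delta> S \<inter> short_roots \<Delta> \<and> k \<in> {- int m..int m}} \<union>
     {hyperplane \<nu> 0 | \<nu>. \<nu> \<in> positive_roots \<Delta> S \<inter> long_roots \<Delta>}"

end

(* Both sides are polynomial in t along an arithmetic progression whose step is the product M of the
   coefficients of theta: the left side by definition, the right side because the lattice points of a
   dilated open simplex are counted by a quasi-polynomial at all positive dilations. It thus
   suffices to treat the infinitely many q = t + M u that are coprime to a constant controlling the
   elimination of integral linear systems. For these, chi(q) counts the points of P^v / q P^v off the
   arrangement modulo q. The affine Weyl group with translations in q Q^v acts freely on the good
   points of P^v with fundamental domain the open alcove q A, so f * chi(q) equals #W times the
   number of good points in q A; translation by m times the sum of the short fundamental coweights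
   identifies these with the points of P^v in (q - m g) A. *)

theory Submission
  imports Defs "HOL-Computational_Algebra.Primes"
begin

section \<open>Whitney's theorem and lattice points of a simplex\<close>

text \<open>Whitney's theorem writes chi(q) as a signed sum of powers q^dim over subfamilies of
  hyperplanes. Replacing q^dim by a number of solutions modulo q is justified only for q coprime to
  a constant N, which depends on the arrangement and may share prime factors with t; so the identity
  at t cannot be read off directly and is reached by interpolation. The step M serves two ends: as a
  multiple of every c_i it makes the lattice count polynomial along t + M u, and as a number coprime
  to t it lets t + M u be coprime to N infinitely often. The two root lengths enter through one
  fact: an integral combination of long roots has as squared length an integral multiple of that of
  a long root, so it is never a short root. Hence a short root mu has a short simple root in its
  support, and so has theta - mu because theta is long. This gives m < (x, mu) < q - m for the
  translated points x of the alcove and short positive mu. The constant g is the pairing of theta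
  with the sum of the short fundamental coweights.\<close>

lemma sum_neg_one_power_card_Pow:
  assumes "finite I"
  shows "(\<Sum>J\<in>Pow I. (-1) ^ card J :: int) = (if I = {} then 1 else 0)"
proof -
  have "(\<Prod>i\<in>I. 1 - 1 :: int) = (\<Sum>J\<in>Pow I. (-1) ^ card J)"
    using prod_diff_conv_sum [OF assms, where ?f1.0 = "\<lambda>_. 1 :: int" and ?f2.0 = "\<lambda>_. 1"] by simp
  moreover have "(\<Prod>i\<in>I. 1 - 1 :: int) = (if I = {} then 1 else 0)"
    using assms by (auto simp: card_gt_0_iff)
  ultimately show ?thesis by simp
qed

text \<open>The signed count of subfamilies with intersection X obeys the recursion that defines the
  Moebius function: summed over all Z containing X it becomes the alternating sum over the subsets
  of \<open>IX\<close>, the indices of hyperplanes through X, which vanishes unless X is the whole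
  space. Properness of the h i makes \<open>IX\<close> empty there.\<close>

lemma moebius_eq_sum_subfamilies:
  fixes h :: "'i \<Rightarrow> 'a set" and I :: "'i set"
  defines "L \<equiv> intersection_poset (h ` I)"
  assumes fin: "finite I" and proper: "\<And>i. i \<in> I \<Longrightarrow> h i \<noteq> UNIV" and "X \<in> L"
  shows "moebius (L) UNIV X = (\<Sum>J\<in>{J\<in>Pow I. \<Inter>(h ` J) = X}. (-1) ^ card J)"
  using \<open>X \<in> L\<close>
proof (induction "card {Z\<in>L. X \<subset> Z}" arbitrary: X rule: less_induct)
  case less
  define \<nu> where "\<nu> = (\<lambda>X. \<Sum>J\<in>{J\<in>Pow I. \<Inter>(h ` J) = X}. (-1) ^ card J :: int)"
  have L_iff: "Z \<in> L \<longleftrightarrow> Z \<noteq> {} \<and> (\<exists>J\<subseteq>I. Z = \<Inter>(h ` J))" for Z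
    unfolding L_def intersection_poset_def by (auto simp: subset_image_iff)
  have "L \<subseteq> (\<lambda>J. \<Inter>(h ` J)) ` Pow I"
    by (auto simp: L_iff)
  then have finL: "finite (L)"
    using fin by (auto intro: finite_subset)
  have UNIV_L: "UNIV \<in> L"
    unfolding L_iff by (auto intro!: exI [of _ "{}"])
  have ne: "X \<noteq> {}" using less.prems by (simp add: L_iff)
  have IH: "moebius (L) UNIV Z = \<nu> Z" if "Z \<in> L" "X \<subset> Z" for Z
    unfolding \<nu>_def
  proof (rule less.hyps [OF _ that(1)])
    show "card {Z'\<in>L. Z \<subset> Z'} < card {Z\<in>L. X \<subset> Z}"
      using finL that by (intro psubset_card_mono) auto
  qed
  define IX where "IX = {i\<in>I. X \<subseteq> h i}"
  have "(\<Sum>Z\<in>{Z\<in>L. X \<subseteq> Z}. \<nu> Z) = (\<Sum>J\<in>{J\<in>Pow I. X \<subseteq> \<Inter>(h ` J)}. (-1) ^ card J)"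
  proof -
    have "(\<Sum>Z\<in>{Z\<in>L. X \<subseteq> Z}. \<nu> Z) = (\<Sum>Z\<in>{Z\<in>L. X \<subseteq> Z}.
        \<Sum>J\<in>{J\<in>{J\<in>Pow I. X \<subseteq> \<Inter>(h ` J)}. \<Inter>(h ` J) = Z}. (-1) ^ card J)"
      unfolding \<nu>_def by (intro sum.cong refl) auto
    also have "\<dots> = (\<Sum>J\<in>{J\<in>Pow I. X \<subseteq> \<Inter>(h ` J)}. (-1) ^ card J)"
    proof (rule sum.group)
      show "(\<lambda>J. \<Inter>(h ` J)) ` {J\<in>Pow I. X \<subseteq> \<Inter>(h ` J)} \<subseteq> {Z\<in>L. X \<subseteq> Z}"
        using ne by (auto simp: L_iff)
    qed (use finL fin in simp_all)
    finally show ?thesis .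
  qed
  also have "{J\<in>Pow I. X \<subseteq> \<Inter>(h ` J)} = Pow IX"
    by (auto simp: IX_def)
  also have "(\<Sum>J\<in>Pow IX. (-1) ^ card J :: int) = (if IX = {} then 1 else 0)"
    using fin by (intro sum_neg_one_power_card_Pow) (auto simp: IX_def)
  finally have total: "(\<Sum>Z\<in>{Z\<in>L. X \<subseteq> Z}. \<nu> Z) = (if IX = {} then 1 else 0)" .
  show ?case
  proof (cases "X = UNIV")
    case True
    then have "IX = {}" and "{Z\<in>L. X \<subseteq> Z} = {UNIV}"
      using proper UNIV_L by (auto simp: IX_def)
    then have "\<nu> X = 1" using total True by simp
    then show ?thesis
      using True finL UNIV_L by (subst moebius.simps) (simp add: \<nu>_def)
  next
    case False
    obtain J where J: "J \<subseteq> I" "X = \<Inter>(h ` J)"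
      using less.prems by (auto simp: L_iff)
    then have "IX \<noteq> {}" using False by (auto simp: IX_def)
    moreover have "{Z\<in>L. X \<subseteq> Z} = insert X {Z\<in>L. X \<subset> Z}"
      using less.prems by auto
    ultimately have "\<nu> X = - (\<Sum>Z\<in>{Z\<in>L. X \<subset> Z}. \<nu> Z)"
      using total finL by simp
    also have "\<dots> = - (\<Sum>Z\<in>{Z\<in>L. X \<subset> Z}. moebius (L) UNIV Z)"
      using IH by simp
    also have "\<dots> = moebius (L) UNIV X"
      using False finL UNIV_L less.prems by (subst (2) moebius.simps) simp
    finally show ?thesis by (simp add: \<nu>_def)
  qed
qed

text \<open>Whitney's theorem. The family may list a hyperplane repeatedly, so that no injectivity of the
  map from indices to hyperplanes is required.\<close>

lemma poly_characteristic_polynomial_image: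
  fixes h :: "'i \<Rightarrow> 'a::euclidean_space set"
  assumes fin: "finite I" and proper: "\<And>i. i \<in> I \<Longrightarrow> h i \<noteq> UNIV"
  shows "poly (characteristic_polynomial (h ` I)) t =
    (\<Sum>J\<in>Pow I. (-1) ^ card J *
       (if \<Inter>(h ` J) = {} then 0 else t ^ nat (aff_dim (\<Inter>(h ` J)))))"
proof -
  let ?L = "intersection_poset (h ` I)"
  have L_iff: "Z \<in> ?L \<longleftrightarrow> Z \<noteq> {} \<and> (\<exists>J\<subseteq>I. Z = \<Inter>(h ` J))" for Z
    unfolding intersection_poset_def by (auto simp: subset_image_iff)
  have "?L \<subseteq> (\<lambda>J. \<Inter>(h ` J)) ` Pow I"
    by (auto simp: L_iff)
  then have finL: "finite ?L"
    using fin by (auto intro: finite_subset)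
  let ?F = "\<lambda>J. (-1) ^ card J * t ^ nat (aff_dim (\<Inter>(h ` J)))"
  have "poly (characteristic_polynomial (h ` I)) t =
      (\<Sum>X\<in>?L. moebius ?L UNIV X * t ^ nat (aff_dim X))"
    by (simp add: characteristic_polynomial_def poly_sum poly_monom)
  also have "\<dots> = (\<Sum>X\<in>?L. \<Sum>J\<in>{J\<in>{J\<in>Pow I. \<Inter>(h ` J) \<noteq> {}}. \<Inter>(h ` J) = X}. ?F J)"
  proof (rule sum.cong [OF refl])
    fix X assume X: "X \<in> ?L"
    then have "X \<noteq> {}"
      by (simp add: L_iff)
    then have eq: "{J\<in>{J\<in>Pow I. \<Inter>(h ` J) \<noteq> {}}. \<Inter>(h ` J) = X} = {J\<in>Pow I. \<Inter>(h ` J) = X}"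
      by auto
    show "moebius ?L UNIV X * t ^ nat (aff_dim X) =
        (\<Sum>J\<in>{J\<in>{J\<in>Pow I. \<Inter>(h ` J) \<noteq> {}}. \<Inter>(h ` J) = X}. ?F J)"
    proof -
      have "moebius ?L UNIV X = (\<Sum>J\<in>{J\<in>Pow I. \<Inter>(h ` J) = X}. (-1) ^ card J)"
        using moebius_eq_sum_subfamilies [OF fin proper X] by simp
      then show ?thesis
        unfolding eq by (simp add: sum_distrib_right)
    qed
  qed
  also have "\<dots> = (\<Sum>J\<in>{J\<in>Pow I. \<Inter>(h ` J) \<noteq> {}}. ?F J)"
  proof (rule sum.group)
    show "(\<lambda>J. \<Inter>(h ` J)) ` {J\<in>Pow I. \<Inter>(h ` J) \<noteq> {}} \<subseteq> ?L"
    proof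
      fix Z assume "Z \<in> (\<lambda>J. \<Inter>(h ` J)) ` {J\<in>Pow I. \<Inter>(h ` J) \<noteq> {}}"
      then obtain J where "J \<subseteq> I" "\<Inter>(h ` J) \<noteq> {}" "Z = \<Inter>(h ` J)"
        by blast
      then show "Z \<in> ?L"
        unfolding L_iff by metis
    qed
  qed (use finL fin in simp_all)
  also have "\<dots> = (\<Sum>J\<in>Pow I. (-1) ^ card J *
       (if \<Inter>(h ` J) = {} then 0 else t ^ nat (aff_dim (\<Inter>(h ` J)))))"
    using fin by (intro sum.mono_neutral_cong_left) auto
  finally show ?thesis .
qed

section \<open>Quasi-polynomial counting of positive solutions of a linear inequality\<close>

text \<open>Telescoping (j + 1)^(k + 1) - j^(k + 1) and expanding leaves k + 1 times the k-th power
  sum plus lower power sums, which are polynomial by induction.\<close>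

lemma ex_poly_sum_power:
  "\<exists>Q :: real poly. \<forall>n :: nat. (\<Sum>j<n. real j ^ k) = poly Q (real n)"
proof (induction k rule: less_induct)
  case (less k)
  then obtain Q :: "nat \<Rightarrow> real poly"
    where Q: "\<And>i n. i < k \<Longrightarrow> (\<Sum>j<n. real j ^ i) = poly (Q i) (real n)"
    by metis
  have "(\<Sum>j<n. real j ^ k) =
      poly (smult (1 / real (k + 1)) (monom 1 (k + 1) - (\<Sum>i<k. smult (real ((k + 1) choose i)) (Q i)))) (real n)"
    for n
  proof -
    have "real n ^ (k + 1) = (\<Sum>j<n. real (Suc j) ^ (k + 1) - real j ^ (k + 1))"
      by (subst sum_lessThan_telescope) simp
    also have "\<dots> = (\<Sum>j<n. \<Sum>i\<le>k. real ((k + 1) choose i) * real j ^ i)"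
    proof (rule sum.cong [OF refl])
      fix j
      have "real (Suc j) ^ (k + 1) = (real j + 1) ^ (k + 1)"
        by (simp add: add.commute)
      also have "\<dots> = (\<Sum>i\<le>k + 1. real ((k + 1) choose i) * real j ^ i)"
        by (subst binomial_ring) simp
      finally show "real (Suc j) ^ (k + 1) - real j ^ (k + 1) =
          (\<Sum>i\<le>k. real ((k + 1) choose i) * real j ^ i)"
        by simp
    qed
    also have "\<dots> = (\<Sum>i\<le>k. real ((k + 1) choose i) * (\<Sum>j<n. real j ^ i))"
      unfolding sum_distrib_left by (rule sum.swap)
    also have "{..k} = insert k {..<k}"
      by auto
    also have "(\<Sum>i\<in>insert k {..<k}. real ((k + 1) choose i) * (\<Sum>j<n. real j ^ i)) =
       real (k + 1) * (\<Sum>j<n. real j ^ k) + (\<Sum>i<k. real ((k + 1) choose i) * poly (Q i) (real n))"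
      using Q by simp
    finally show ?thesis
      by (simp add: poly_sum poly_monom field_simps)
  qed
  then show ?case by blast
qed

lemma ex_poly_sum_lessThan:
  fixes P :: "real poly"
  shows "\<exists>Q. \<forall>n :: nat. (\<Sum>j<n. poly P (real j)) = poly Q (real n)"
proof -
  obtain Q :: "nat \<Rightarrow> real poly" where Q: "\<And>i n. (\<Sum>j<n. real j ^ i) = poly (Q i) (real n)"
    using ex_poly_sum_power by metis
  have "(\<Sum>j<n. poly P (real j)) = poly (\<Sum>i\<le>degree P. smult (coeff P i) (Q i)) (real n)" for n
  proof -
    have "(\<Sum>j<n. poly P (real j)) = (\<Sum>i\<le>degree P. coeff P i * (\<Sum>j<n. real j ^ i))"
      unfolding poly_altdef sum_distrib_left by (rule sum.swap)
    then show ?thesis by (simp add: Q poly_sum)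
  qed
  then show ?thesis by blast
qed

text \<open>For I = S and the coefficients of \<theta>, z i is the pairing with the simple root i,
  so this is P^v inside the open simplex s A in coordinates.\<close>

definition positive_solutions :: "'i set \<Rightarrow> ('i \<Rightarrow> nat) \<Rightarrow> int \<Rightarrow> ('i \<Rightarrow> int) set" where
  "positive_solutions I c s = {z \<in> I \<rightarrow>\<^sub>E {1..}. (\<Sum>i\<in>I. int (c i) * z i) < s}"

lemma finite_positive_solutions:
  assumes "finite I" and pos: "\<And>i. i \<in> I \<Longrightarrow> c i > 0"
  shows "finite (positive_solutions I c s)"
proof (rule finite_subset)
  show "positive_solutions I c s \<subseteq> I \<rightarrow>\<^sub>E {1..s}"
  proof
    fix z assume z: "z \<in> positive_solutions I c s"
    have "z i \<le> s" if "i \<in> I" for i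
    proof -
      have "1 * z i \<le> int (c i) * z i"
        using pos [OF that] z that by (intro mult_right_mono) (force simp: positive_solutions_def)+
      also have "int (c i) * z i \<le> (\<Sum>i\<in>I. int (c i) * z i)"
        using assms z that by (intro member_le_sum) (force simp: positive_solutions_def)+
      also have "\<dots> < s" using z by (simp add: positive_solutions_def)
      finally show ?thesis by simp
    qed
    then show "z \<in> I \<rightarrow>\<^sub>E {1..s}"
      using z by (auto simp: positive_solutions_def PiE_iff)
  qed
  show "finite (I \<rightarrow>\<^sub>E {1..s})"
    using assms by (intro finite_PiE) auto
qed

text \<open>Split by z i > K, where lowering z i by K is a bijection, and z i \<le> K, where z i = v
  is fixed. With c i * K = M this is a first difference of step M whose increment has one variable
  fewer.\<close>

lemma card_positive_solutions_diff:
  assumes fin: "finite I" and i: "i \<notin> I" and pos: "\<And>j. j \<in> insert i I \<Longrightarrow> c j > 0"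
  shows "card (positive_solutions (insert i I) c s) =
    card (positive_solutions (insert i I) c (s - int (c i) * int K)) +
    (\<Sum>v\<in>{1..int K}. card (positive_solutions I c (s - int (c i) * v)))"
proof -
  let ?A = "positive_solutions (insert i I) c"
  have finA: "finite (?A s)" for s
    using finite_positive_solutions [of "insert i I" c] fin pos by blast
  have sum_upd: "(\<Sum>j\<in>I. int (c j) * (if j = i then v else z j)) = (\<Sum>j\<in>I. int (c j) * z j)" for v z
    using i by (intro sum.cong) auto
  have "?A s = {z\<in>?A s. z i > int K} \<union> {z\<in>?A s. z i \<le> int K}"
    by auto
  then have "card (?A s) = card ({z\<in>?A s. z i > int K} \<union> {z\<in>?A s. z i \<le> int K})"
    by simp
  also have "\<dots> = card {z\<in>?A s. z i > int K} + card {z\<in>?A s. z i \<le> int K}"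
    using finA [of s] by (intro card_Un_disjoint) auto
  finally have "card (?A s) = card {z\<in>?A s. z i > int K} + card {z\<in>?A s. z i \<le> int K}" .
  moreover have "bij_betw (\<lambda>z. z(i := z i + int K)) (?A (s - int (c i) * int K)) {z\<in>?A s. z i > int K}"
    by (rule bij_betwI [where g = "\<lambda>z. z(i := z i - int K)"])
      (use fin i in \<open>auto simp: positive_solutions_def PiE_iff extensional_def sum_upd algebra_simps\<close>)
  then have "card {z\<in>?A s. z i > int K} = card (?A (s - int (c i) * int K))"
    by (simp add: bij_betw_same_card)
  moreover have "bij_betw (\<lambda>(v, z). z(i := v)) (SIGMA v:{1..int K}. positive_solutions I c (s - int (c i) * v))
      {z\<in>?A s. z i \<le> int K}"
    by (rule bij_betwI [where g = "\<lambda>z. (z i, restrict z I)"])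
      (use fin i in \<open>auto simp: positive_solutions_def PiE_iff extensional_def sum_upd algebra_simps fun_eq_iff restrict_def\<close>)
  then have "card {z\<in>?A s. z i \<le> int K} =
      card (SIGMA v:{1..int K}. positive_solutions I c (s - int (c i) * v))"
    by (simp add: bij_betw_same_card)
  moreover have "\<dots> = (\<Sum>v\<in>{1..int K}. card (positive_solutions I c (s - int (c i) * v)))"
    using finite_positive_solutions [of I c] fin pos by (intro card_SigmaI) auto
  ultimately show ?thesis by simp
qed

text \<open>The hypothesis \<open>s \<ge> 1\<close> is needed: the polynomial of the residue class of \<open>0\<close> does not vanish at \<open>0\<close>.\<close>

lemma positive_solutions_quasipolynomial:
  assumes "finite I" and "\<And>i. i \<in> I \<Longrightarrow> c i > 0" and "\<And>i. i \<in> I \<Longrightarrow> c i dvd M" and "s \<ge> 1"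
  shows "\<exists>P :: real poly. \<forall>n :: nat.
    real (card (positive_solutions I c (s + int M * int n))) = poly P (real n)"
  using assms
proof (induction I arbitrary: s rule: finite_induct)
  case empty
  have "positive_solutions {} c (s + int M * int n) = {\<lambda>_. undefined}" for n
    using empty.prems(3) by (auto simp: positive_solutions_def intro: add_pos_nonneg)
  then have "\<forall>n :: nat. real (card (positive_solutions {} c (s + int M * int n))) = poly [:1:] (real n)"
    by simp
  then show ?case by blast
next
  case (insert i I)
  let ?f = "\<lambda>n :: nat. card (positive_solutions (insert i I) c (s + int M * int n))"
  obtain K where K: "M = c i * K"
    using insert.prems(2) by auto
  \<comment> \<open>As v \<le> K and c i * K = M, the base s + M - c i * v is at least s, so the
    induction hypothesis covers each summand of the first difference.\<close>
  have "\<exists>P :: real poly. \<forall>n :: nat. real (card (positive_solutions I c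
      (s + int M - int (c i) * v + int M * int n))) = poly P (real n)" if "v \<in> {1..int K}" for v
  proof (rule insert.IH)
    have "int (c i) * v \<le> int (c i) * int K"
      using that by (intro mult_left_mono) auto
    then show "s + int M - int (c i) * v \<ge> 1"
      using K \<open>s \<ge> 1\<close> by simp
  qed (use insert.prems in auto)
  then obtain P :: "int \<Rightarrow> real poly" where P: "\<And>v n. v \<in> {1..int K} \<Longrightarrow>
    real (card (positive_solutions I c (s + int M - int (c i) * v + int M * int n))) = poly (P v) (real n)"
    by metis
  have step: "real (?f (Suc n)) = real (?f n) + poly (\<Sum>v\<in>{1..int K}. P v) (real n)" for n
    using card_positive_solutions_diff [OF insert.hyps insert.prems(1), where s = "s + int M * int (Suc n)" and K = K]
      P [of _ n, symmetric] K
    by (simp add: poly_sum algebra_simps)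
  obtain Q where Q: "\<And>n :: nat. (\<Sum>j<n. poly (\<Sum>v\<in>{1..int K}. P v) (real j)) = poly Q (real n)"
    using ex_poly_sum_lessThan by meson
  have "real (?f n) = poly ([:real (?f 0):] + Q) (real n)" for n
  proof -
    have "real (?f n) = real (?f 0) + (\<Sum>j<n. poly (\<Sum>v\<in>{1..int K}. P v) (real j))"
      by (induction n) (use step in auto)
    then show ?thesis using Q by simp
  qed
  then show ?case by blast
qed

section \<open>Linear systems modulo an integer\<close>

lemma coweight_lattice_add:
  "x \<in> coweight_lattice S \<Longrightarrow> y \<in> coweight_lattice S \<Longrightarrow> x + y \<in> coweight_lattice S"
  by (simp add: coweight_lattice_def inner_left_distrib)

lemma coweight_lattice_diff:
  "x \<in> coweight_lattice S \<Longrightarrow> y \<in> coweight_lattice S \<Longrightarrow> x - y \<in> coweight_lattice S"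
  by (simp add: coweight_lattice_def inner_diff_left)

lemma coweight_lattice_scale_Ints:
  "x \<in> coweight_lattice S \<Longrightarrow> a \<in> \<int> \<Longrightarrow> a *\<^sub>R x \<in> coweight_lattice S"
  by (simp add: coweight_lattice_def)

locale lattice_basis =
  fixes S :: "'a::euclidean_space set"
  assumes indep: "independent S" and span: "span S = UNIV"
begin

lemma finite_S [simp]: "finite S"
  using indep by (rule independent_imp_finite)

lemma ex_dual_basis: "\<exists>\<omega>. \<forall>\<alpha>\<in>S. \<forall>\<beta>\<in>S. \<omega> \<alpha> \<bullet> \<beta> = (if \<alpha> = \<beta> then 1 else 0)"
proof -
  have "\<exists>y. \<forall>\<beta>\<in>S. y \<bullet> \<beta> = (if \<alpha> = \<beta> then 1 else 0)" for \<alpha>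
  proof -
    obtain f :: "'a \<Rightarrow> real" where f: "linear f" "\<forall>\<beta>\<in>S. f \<beta> = (if \<alpha> = \<beta> then 1 else 0)"
      using linear_independent_extend [OF indep, of "\<lambda>\<beta>. if \<alpha> = \<beta> then 1 else 0 :: real"] by auto
    have "(\<Sum>b\<in>Basis. f b *\<^sub>R b) \<bullet> x = f x" for x
    proof -
      have "f x = f (\<Sum>b\<in>Basis. (x \<bullet> b) *\<^sub>R b)"
        by (simp add: euclidean_representation)
      also have "\<dots> = (\<Sum>b\<in>Basis. (x \<bullet> b) * f b)"
        using f(1) by (simp add: linear_sum linear_scale)
      also have "\<dots> = (\<Sum>b\<in>Basis. f b *\<^sub>R b) \<bullet> x"
        by (simp add: inner_sum_left inner_commute [of x] mult.commute)
      finally show ?thesis by simp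
    qed
    then show ?thesis
      using f(2) by (intro exI [of _ "\<Sum>b\<in>Basis. f b *\<^sub>R b"]) simp
  qed
  then have "\<forall>\<alpha>. \<exists>y. \<forall>\<beta>\<in>S. y \<bullet> \<beta> = (if \<alpha> = \<beta> then 1 else 0)"
    by blast
  from choice [OF this] show ?thesis by blast
qed

text \<open>The fundamental coweights, a Z-basis of P^v. Pairing with \<open>cowt \<alpha>\<close>
  reads off the coefficient of the basis vector \<alpha>.\<close>

definition cowt :: "'a \<Rightarrow> 'a" where
  "cowt = (SOME \<omega>. \<forall>\<alpha>\<in>S. \<forall>\<beta>\<in>S. \<omega> \<alpha> \<bullet> \<beta> = (if \<alpha> = \<beta> then 1 else 0))"

lemma cowt_inner: "\<alpha> \<in> S \<Longrightarrow> \<beta> \<in> S \<Longrightarrow> cowt \<alpha> \<bullet> \<beta> = (if \<alpha> = \<beta> then 1 else 0)"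
  using someI_ex [OF ex_dual_basis] unfolding cowt_def by blast

lemma sum_cowt_inner:
  assumes "\<beta> \<in> S" shows "(\<Sum>\<alpha>\<in>S. a \<alpha> *\<^sub>R cowt \<alpha>) \<bullet> \<beta> = a \<beta>"
proof -
  have "(\<Sum>\<alpha>\<in>S. a \<alpha> *\<^sub>R cowt \<alpha>) \<bullet> \<beta> = (\<Sum>\<alpha>\<in>S. if \<alpha> = \<beta> then a \<alpha> else 0)"
    unfolding inner_sum_left using assms by (intro sum.cong) (auto simp: cowt_inner)
  then show ?thesis using assms by simp
qed

lemma sum_inner_cowt:
  assumes "\<beta> \<in> S" shows "(\<Sum>\<alpha>\<in>S. a \<alpha> *\<^sub>R \<alpha>) \<bullet> cowt \<beta> = a \<beta>"
proof -
  have "(\<Sum>\<alpha>\<in>S. a \<alpha> *\<^sub>R \<alpha>) \<bullet> cowt \<beta> = (\<Sum>\<alpha>\<in>S. if \<alpha> = \<beta> then a \<alpha> else 0)"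
    unfolding inner_sum_left using assms
    by (intro sum.cong) (auto simp: cowt_inner inner_commute [of _ "cowt \<beta>"])
  then show ?thesis using assms by simp
qed

lemma eqI_inner: "(\<And>\<alpha>. \<alpha> \<in> S \<Longrightarrow> x \<bullet> \<alpha> = y \<bullet> \<alpha>) \<Longrightarrow> x = y"
proof -
  assume *: "\<And>\<alpha>. \<alpha> \<in> S \<Longrightarrow> x \<bullet> \<alpha> = y \<bullet> \<alpha>"
  have "orthogonal (x - y) (x - y)"
  proof (rule orthogonal_to_span)
    show "x - y \<in> span S" using span by simp
  qed (use * in \<open>simp add: orthogonal_def inner_diff_left\<close>)
  then show "x = y" by (simp add: orthogonal_self)
qed

lemma basis_expansion: "(\<Sum>\<alpha>\<in>S. (x \<bullet> cowt \<alpha>) *\<^sub>R \<alpha>) = x"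
proof -
  obtain u where u: "x = (\<Sum>\<alpha>\<in>S. u \<alpha> *\<^sub>R \<alpha>)"
  proof -
    have "x \<in> span S" using span by simp
    then show ?thesis using that by (auto simp: span_finite)
  qed
  then have "(\<Sum>\<alpha>\<in>S. (x \<bullet> cowt \<alpha>) *\<^sub>R \<alpha>) = (\<Sum>\<alpha>\<in>S. u \<alpha> *\<^sub>R \<alpha>)"
    by (intro sum.cong) (simp_all add: sum_inner_cowt)
  with u show ?thesis by simp
qed

lemma inner_expansion: "x \<bullet> y = (\<Sum>\<alpha>\<in>S. (x \<bullet> \<alpha>) * (y \<bullet> cowt \<alpha>))"
  by (subst basis_expansion [of y, symmetric]) (simp add: inner_sum_right mult.commute)

lemma eqI_cowt: "(\<And>\<alpha>. \<alpha> \<in> S \<Longrightarrow> x \<bullet> cowt \<alpha> = y \<bullet> cowt \<alpha>) \<Longrightarrow> x = y"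
proof -
  assume *: "\<And>\<alpha>. \<alpha> \<in> S \<Longrightarrow> x \<bullet> cowt \<alpha> = y \<bullet> cowt \<alpha>"
  have "(\<Sum>\<alpha>\<in>S. (x \<bullet> cowt \<alpha>) *\<^sub>R \<alpha>) = (\<Sum>\<alpha>\<in>S. (y \<bullet> cowt \<alpha>) *\<^sub>R \<alpha>)"
    by (rule sum.cong) (simp_all add: *)
  then show "x = y" by (simp add: basis_expansion)
qed

lemma cowt_in_coweight_lattice: "\<alpha> \<in> S \<Longrightarrow> cowt \<alpha> \<in> coweight_lattice S"
  by (simp add: coweight_lattice_def cowt_inner)

text \<open>The integral span of S, described through coordinates. The normal vectors of the
  equations counted below lie in it, so they take integer values on P^v.\<close>

definition root_lattice :: "'a set" where
  "root_lattice = {x. \<forall>\<alpha>\<in>S. x \<bullet> cowt \<alpha> \<in> \<int>}"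

lemma coweight_root_inner_Ints:
  "z \<in> coweight_lattice S \<Longrightarrow> r \<in> root_lattice \<Longrightarrow> z \<bullet> r \<in> \<int>"
  unfolding inner_expansion [of z r] coweight_lattice_def root_lattice_def by auto

lemma of_int_floor_inner: "z \<in> coweight_lattice S \<Longrightarrow> \<alpha> \<in> S \<Longrightarrow> of_int \<lfloor>z \<bullet> \<alpha>\<rfloor> = z \<bullet> \<alpha>"
  by (auto simp: coweight_lattice_def elim!: Ints_cases)

text \<open>Identifies P^v with integer vectors; \<open>floor\<close> merely converts pairings that
  are already integral to type \<open>int\<close>.\<close>

lemma bij_betw_coordinates:
  "bij_betw (\<lambda>z. \<lambda>\<alpha>\<in>S. \<lfloor>z \<bullet> \<alpha>\<rfloor>) (coweight_lattice S) (S \<rightarrow>\<^sub>E UNIV)"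
proof (rule bij_betwI [where g = "\<lambda>f. \<Sum>\<alpha>\<in>S. of_int (f \<alpha>) *\<^sub>R cowt \<alpha>"])
  fix z assume z: "z \<in> coweight_lattice S"
  show "(\<Sum>\<alpha>\<in>S. of_int ((\<lambda>\<alpha>\<in>S. \<lfloor>z \<bullet> \<alpha>\<rfloor>) \<alpha>) *\<^sub>R cowt \<alpha>) = z"
    by (rule eqI_inner) (simp add: sum_cowt_inner of_int_floor_inner [OF z])
next
  fix f :: "'a \<Rightarrow> int" assume "f \<in> S \<rightarrow>\<^sub>E UNIV"
  then show "(\<lambda>\<alpha>\<in>S. \<lfloor>(\<Sum>\<alpha>\<in>S. of_int (f \<alpha>) *\<^sub>R cowt \<alpha>) \<bullet> \<alpha>\<rfloor>) = f"
    by (intro PiE_ext [of _ S "\<lambda>_. UNIV"]) (auto simp: sum_cowt_inner)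
next
  show "(\<lambda>f. \<Sum>\<alpha>\<in>S. of_int (f \<alpha>) *\<^sub>R cowt \<alpha>) \<in> (S \<rightarrow>\<^sub>E UNIV) \<rightarrow> coweight_lattice S"
    by (simp add: coweight_lattice_def sum_cowt_inner)
qed auto

lemma bij_betw_coordinates_subset:
  assumes "A \<subseteq> coweight_lattice S" and "B \<subseteq> S \<rightarrow>\<^sub>E UNIV"
    and "\<And>z. z \<in> coweight_lattice S \<Longrightarrow> (\<lambda>\<alpha>\<in>S. \<lfloor>z \<bullet> \<alpha>\<rfloor>) \<in> B \<longleftrightarrow> z \<in> A"
  shows "bij_betw (\<lambda>z. \<lambda>\<alpha>\<in>S. \<lfloor>z \<bullet> \<alpha>\<rfloor>) A B"
proof (rule bij_betw_subset [OF bij_betw_coordinates assms(1)])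
  show "(\<lambda>z. \<lambda>\<alpha>\<in>S. \<lfloor>z \<bullet> \<alpha>\<rfloor>) ` A = B"
  proof
    show "(\<lambda>z. \<lambda>\<alpha>\<in>S. \<lfloor>z \<bullet> \<alpha>\<rfloor>) ` A \<subseteq> B"
      using assms(1,3) by blast
    show "B \<subseteq> (\<lambda>z. \<lambda>\<alpha>\<in>S. \<lfloor>z \<bullet> \<alpha>\<rfloor>) ` A"
    proof
      fix f assume "f \<in> B"
      then have "f \<in> (\<lambda>z. \<lambda>\<alpha>\<in>S. \<lfloor>z \<bullet> \<alpha>\<rfloor>) ` coweight_lattice S"
        using assms(2) bij_betw_imp_surj_on [OF bij_betw_coordinates] by auto
      then show "f \<in> (\<lambda>z. \<lambda>\<alpha>\<in>S. \<lfloor>z \<bullet> \<alpha>\<rfloor>) ` A"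
        using assms(3) \<open>f \<in> B\<close> by force
    qed
  qed
qed

text \<open>For q > 0, one representative of each class of P^v / q P^v.\<close>

definition fbox :: "nat \<Rightarrow> 'a set" where
  "fbox q = {z \<in> coweight_lattice S. \<forall>\<alpha>\<in>S. 0 \<le> z \<bullet> \<alpha> \<and> z \<bullet> \<alpha> < real q}"

lemma bij_betw_fbox: "bij_betw (\<lambda>z. \<lambda>\<alpha>\<in>S. \<lfloor>z \<bullet> \<alpha>\<rfloor>) (fbox q) (S \<rightarrow>\<^sub>E {0..<int q})"
proof (rule bij_betw_coordinates_subset)
  fix z assume z: "z \<in> coweight_lattice S"
  have "\<lfloor>z \<bullet> \<alpha>\<rfloor> \<in> {0..<int q} \<longleftrightarrow> 0 \<le> z \<bullet> \<alpha> \<and> z \<bullet> \<alpha> < real q" if "\<alpha> \<in> S" for \<alpha>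
    using that by (auto simp: floor_less_iff)
  then show "(\<lambda>\<alpha>\<in>S. \<lfloor>z \<bullet> \<alpha>\<rfloor>) \<in> S \<rightarrow>\<^sub>E {0..<int q} \<longleftrightarrow> z \<in> fbox q"
    using z by (auto simp: fbox_def PiE_iff)
qed (auto simp: fbox_def)

lemma finite_fbox: "finite (fbox q)"
  using bij_betw_finite [OF bij_betw_fbox] by (simp add: finite_PiE)

lemma card_S: "card S = DIM('a)"
  using basis_card_eq_dim [of S UNIV] indep span by simp

lemma card_fbox: "card (fbox q) = q ^ DIM('a)"
  using bij_betw_same_card [OF bij_betw_fbox, of q] card_PiE [OF finite_S, of "\<lambda>_. {0..<int q}"] card_S
  by simp

lemma ex_box_representative:
  assumes z: "z \<in> coweight_lattice S" and "q > 0"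
  shows "\<exists>y\<in>fbox q. \<exists>p\<in>coweight_lattice S. z = y + real q *\<^sub>R p"
proof -
  define p where "p = (\<Sum>\<alpha>\<in>S. of_int (\<lfloor>z \<bullet> \<alpha>\<rfloor> div int q) *\<^sub>R cowt \<alpha>)"
  have p: "p \<in> coweight_lattice S"
    by (auto simp: p_def coweight_lattice_def sum_cowt_inner)
  have "(z - real q *\<^sub>R p) \<bullet> \<alpha> = of_int (\<lfloor>z \<bullet> \<alpha>\<rfloor> mod int q)" if "\<alpha> \<in> S" for \<alpha>
  proof -
    have "(z - real q *\<^sub>R p) \<bullet> \<alpha> = of_int (\<lfloor>z \<bullet> \<alpha>\<rfloor> - int q * (\<lfloor>z \<bullet> \<alpha>\<rfloor> div int q))"
      using that by (simp add: p_def sum_cowt_inner inner_diff_left of_int_floor_inner [OF z])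
    then show ?thesis by (simp add: minus_mult_div_eq_mod)
  qed
  moreover have "z - real q *\<^sub>R p \<in> coweight_lattice S"
    using z p by (intro coweight_lattice_diff coweight_lattice_scale_Ints) auto
  moreover have "real_of_int (\<lfloor>z \<bullet> \<alpha>\<rfloor> mod int q) < real q" for \<alpha>
    using \<open>q > 0\<close> by (metis of_int_less_iff of_int_of_nat_eq of_nat_0_less_iff pos_mod_bound)
  ultimately have "z - real q *\<^sub>R p \<in> fbox q"
    using \<open>q > 0\<close> by (auto simp: fbox_def)
  then show ?thesis using p by (intro bexI [of _ "z - real q *\<^sub>R p"] bexI [of _ p]) auto
qed

lemma box_representative_unique:
  assumes "y \<in> fbox q" "y' \<in> fbox q" and "p \<in> coweight_lattice S" and "y = y' + real q *\<^sub>R p"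
  shows "y = y'"
proof (rule eqI_inner)
  fix \<alpha> assume \<alpha>: "\<alpha> \<in> S"
  obtain j :: int where j: "p \<bullet> \<alpha> = of_int j"
    using assms(3) \<alpha> by (auto simp: coweight_lattice_def elim: Ints_cases)
  have eq: "y \<bullet> \<alpha> = y' \<bullet> \<alpha> + real q * of_int j"
    using assms(4) j by (simp add: inner_left_distrib)
  moreover have "0 \<le> y \<bullet> \<alpha>" "y \<bullet> \<alpha> < real q" "0 \<le> y' \<bullet> \<alpha>" "y' \<bullet> \<alpha> < real q"
    using assms(1,2) \<alpha> by (auto simp: fbox_def)
  ultimately have "real q * of_int j < real q * 1" "real q * (-1) < real q * of_int j"
    by linarith+
  then have "real_of_int j < 1" "-1 < real_of_int j"
    unfolding mult_less_cancel_left by auto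
  then have "j = 0" by linarith
  with eq show "y \<bullet> \<alpha> = y' \<bullet> \<alpha>" by simp
qed

text \<open>Integral linear algebra by one step of Gaussian elimination per equation: \<open>\<mu>\<close> is either
  rationally dependent on the given vectors or detected by an integral vector orthogonal to them.\<close>

lemma dependent_or_detected:
  assumes "finite B" and "fst ` B \<subseteq> root_lattice" and "\<mu> \<in> root_lattice"
  shows "(\<exists>d :: int. \<exists>n :: 'a \<times> 'k \<Rightarrow> int. d \<noteq> 0 \<and> of_int d *\<^sub>R \<mu> = (\<Sum>b\<in>B. of_int (n b) *\<^sub>R fst b)) \<or>
    (\<exists>v\<in>coweight_lattice S. (\<forall>b\<in>B. v \<bullet> fst b = 0) \<and> v \<bullet> \<mu> \<noteq> 0)"
  using assms
proof (induction B arbitrary: \<mu> rule: finite_induct)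
  case empty
  show ?case
  proof (cases "\<mu> = 0")
    case True
    then show ?thesis by (intro disjI1 exI [of _ 1]) simp
  next
    case False
    then obtain \<alpha> where "\<alpha> \<in> S" "\<mu> \<bullet> cowt \<alpha> \<noteq> 0"
      using eqI_cowt [of \<mu> 0] by auto
    then show ?thesis
      by (intro disjI2 bexI [of _ "cowt \<alpha>"]) (auto simp: inner_commute cowt_in_coweight_lattice)
  qed
next
  case (insert b B)
  have sum_upd: "(\<Sum>b'\<in>insert b B. of_int ((n(b := i)) b') *\<^sub>R fst b') =
      of_int i *\<^sub>R fst b + (\<Sum>b\<in>B. of_int (n b) *\<^sub>R fst b)" for i and n :: "'a \<times> 'k \<Rightarrow> int"
    using insert.hyps by (auto intro!: arg_cong2 [where f = plus] sum.cong)
  consider (dep) d n where "d \<noteq> 0" "of_int d *\<^sub>R fst b = (\<Sum>b\<in>B. of_int (n b :: int) *\<^sub>R fst b)"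
    | (det) v where "v \<in> coweight_lattice S" "\<forall>b\<in>B. v \<bullet> fst b = 0" "v \<bullet> fst b \<noteq> 0"
    using insert.IH [of "fst b"] insert.prems by auto
  then show ?case
  proof cases
    case dep
    \<comment> \<open>A dependent b adds no condition: whatever kills B kills b, so the alternative
      for \<mu> over B carries over.\<close>
    then have *: "v \<bullet> fst b = 0" if "\<forall>b\<in>B. v \<bullet> fst b = 0" for v
    proof -
      have "of_int d * (v \<bullet> fst b) = v \<bullet> (\<Sum>b\<in>B. of_int (n b) *\<^sub>R fst b)"
        using dep by (metis inner_scaleR_right)
      also have "\<dots> = 0" using that by (simp add: inner_sum_right)
      finally show ?thesis using dep(1) by simp
    qed
    consider (dep') d' n' where "d' \<noteq> 0" "of_int d' *\<^sub>R \<mu> = (\<Sum>b\<in>B. of_int (n' b :: int) *\<^sub>R fst b)"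
      | (det') v where "v \<in> coweight_lattice S" "\<forall>b\<in>B. v \<bullet> fst b = 0" "v \<bullet> \<mu> \<noteq> 0"
      using insert.IH [of \<mu>] insert.prems by auto
    then show ?thesis
    proof cases
      case dep'
      then show ?thesis
        using sum_upd [of n' 0] by (intro disjI1 exI [of _ d'] exI [of _ "n'(b := 0)"]) simp
    next
      case det'
      then show ?thesis using * by blast
    qed
  next
    case det
    obtain e where e: "v \<bullet> fst b = of_int e"
      using coweight_root_inner_Ints [OF det(1), of "fst b"] insert.prems by (auto elim: Ints_cases)
    obtain l where l: "v \<bullet> \<mu> = of_int l"
      using coweight_root_inner_Ints [OF det(1), of \<mu>] insert.prems by (auto elim: Ints_cases)
    \<comment> \<open>Elimination of b: the coefficients are chosen so that v \<bullet> \<mu>' =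
      0.\<close>
    define \<mu>' where "\<mu>' = of_int e *\<^sub>R \<mu> - of_int l *\<^sub>R fst b"
    have "\<mu>' \<in> root_lattice"
      using insert.prems by (auto simp: \<mu>'_def root_lattice_def inner_diff_left)
    then consider (dep') d' n' where "d' \<noteq> 0" "of_int d' *\<^sub>R \<mu>' = (\<Sum>b\<in>B. of_int (n' b :: int) *\<^sub>R fst b)"
      | (det') u where "u \<in> coweight_lattice S" "\<forall>b\<in>B. u \<bullet> fst b = 0" "u \<bullet> \<mu>' \<noteq> 0"
      using insert.IH [of \<mu>'] insert.prems by auto
    then show ?thesis
    proof cases
      case dep'
      have "of_int (d' * e) *\<^sub>R \<mu> = of_int d' *\<^sub>R \<mu>' + of_int (d' * l) *\<^sub>R fst b"
        by (simp add: \<mu>'_def scaleR_diff_right)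
      also have "\<dots> = (\<Sum>b'\<in>insert b B. of_int ((n'(b := d' * l)) b') *\<^sub>R fst b')"
        unfolding sum_upd dep'(2) by simp
      finally show ?thesis
        using dep'(1) e det(3) by (intro disjI1 exI [of _ "d' * e"] exI) auto
    next
      case det'
      obtain k where k: "u \<bullet> fst b = of_int k"
        using coweight_root_inner_Ints [OF det'(1), of "fst b"] insert.prems by (auto elim: Ints_cases)
      \<comment> \<open>Correcting u by v makes the vector kill b as well; its value on \<mu> is u
        \<bullet> \<mu>', which is nonzero.\<close>
      let ?w = "of_int e *\<^sub>R u - of_int k *\<^sub>R v"
      have "?w \<bullet> \<mu> = u \<bullet> \<mu>'"
        using e l k by (simp add: \<mu>'_def inner_diff_left inner_diff_right)
      moreover have "?w \<in> coweight_lattice S"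
        using det(1) det'(1) by (intro coweight_lattice_diff coweight_lattice_scale_Ints) auto
      moreover have "\<forall>b'\<in>insert b B. ?w \<bullet> fst b' = 0"
        using e k det(2) det'(2) by (simp add: inner_diff_left)
      ultimately show ?thesis using det'(3) by (intro disjI2 bexI [of _ ?w]) auto
    qed
  qed
qed

section \<open>Real solutions versus solutions modulo q\<close>

definition solutions :: "('a \<times> int) set \<Rightarrow> 'a set" where
  "solutions B = \<Inter>((\<lambda>(r, k). hyperplane r (of_int k)) ` B)"

text \<open>The existential j expresses congruence modulo q for a real-valued inner product.\<close>

definition solutions_mod :: "nat \<Rightarrow> ('a \<times> int) set \<Rightarrow> 'a set" where
  "solutions_mod q B = {z \<in> fbox q. \<forall>(r, k)\<in>B. \<exists>j :: int. z \<bullet> r = of_int k + real q * of_int j}"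

lemma affine_solutions: "affine (solutions B)"
  unfolding solutions_def hyperplane_def
  by (intro affine_Inter) (auto simp: affine_hyperplane inner_commute)

lemma finite_solutions_mod: "finite (solutions_mod q B)"
  using finite_fbox [of q] by (simp add: solutions_mod_def)

text \<open>Adding multiples of v keeps the equations of B and moves the value at \<mu> by multiples
  of e, a unit modulo q. Hence the q translates of the solutions with value k partition the
  solutions of B.\<close>

lemma card_solutions_mod_detected:
  assumes B: "fst ` B \<subseteq> root_lattice" and \<mu>: "\<mu> \<in> root_lattice"
    and v: "v \<in> coweight_lattice S" "\<forall>b\<in>B. v \<bullet> fst b = 0"
    and e: "v \<bullet> \<mu> = of_int e" "coprime (int q) e" and "q > 0"
  shows "q * card (solutions_mod q (insert (\<mu>, k) B)) = card (solutions_mod q B)"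
proof -
  let ?C = "solutions_mod q"
  have "\<forall>z\<in>coweight_lattice S. \<exists>y. y \<in> fbox q \<and> (\<exists>p\<in>coweight_lattice S. z = y + real q *\<^sub>R p)"
    using ex_box_representative [OF _ \<open>q > 0\<close>] by blast
  \<comment> \<open>\<open>red\<close> reduces modulo q P^v, as z + i v may leave the box.\<close>
  then obtain red where "\<forall>z\<in>coweight_lattice S. red z \<in> fbox q \<and>
      (\<exists>p\<in>coweight_lattice S. z = red z + real q *\<^sub>R p)"
    by (rule bchoice [THEN exE])
  then have red: "red z \<in> fbox q \<and> (\<exists>p\<in>coweight_lattice S. z = red z + real q *\<^sub>R p)"
    if "z \<in> coweight_lattice S" for z
    using that by (rule bspec)
  have P: "z \<in> coweight_lattice S" if "z \<in> fbox q" for z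
    using that by (simp add: fbox_def)
  have shift: "y + of_int i *\<^sub>R v \<in> coweight_lattice S" if "y \<in> fbox q" for y i
    using P [OF that] v(1) by (intro coweight_lattice_add coweight_lattice_scale_Ints) auto
  have red_unique: "y = y'" if yy': "y \<in> fbox q" "y' \<in> fbox q" and eq: "red (y + u) = red (y' + u)"
    and yu: "y + u \<in> coweight_lattice S" "y' + u \<in> coweight_lattice S" for y y' u
  proof -
    obtain p where p: "p \<in> coweight_lattice S" "y + u = red (y + u) + real q *\<^sub>R p"
      using red [OF yu(1)] by blast
    obtain p' where p': "p' \<in> coweight_lattice S" "y' + u = red (y' + u) + real q *\<^sub>R p'"
      using red [OF yu(2)] by blast
    have "y - y' = (y + u) - (y' + u)" by simp
    also have "\<dots> = (red (y + u) + real q *\<^sub>R p) - (red (y' + u) + real q *\<^sub>R p')"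
      by (rule arg_cong2 [where f = minus, OF p(2) p'(2)])
    also have "\<dots> = real q *\<^sub>R (p - p')"
      by (simp add: eq scaleR_diff_right)
    finally have "y = y' + real q *\<^sub>R (p - p')"
      by (simp add: algebra_simps)
    then show "y = y'"
      using box_representative_unique [OF yy' coweight_lattice_diff [OF p(1) p'(1)]] by blast
  qed
  have red_C: "red (y + of_int i *\<^sub>R v) \<in> ?C B" if "y \<in> ?C B" for y i
  proof -
    have y: "y \<in> fbox q" using that by (simp add: solutions_mod_def)
    obtain p where p: "p \<in> coweight_lattice S"
      "y + of_int i *\<^sub>R v = red (y + of_int i *\<^sub>R v) + real q *\<^sub>R p"
      using red [OF shift [OF y]] by blast
    have "\<exists>j :: int. red (y + of_int i *\<^sub>R v) \<bullet> r = of_int k + real q * of_int j" if rk: "(r, k) \<in> B" for r k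
    proof -
      obtain j where j: "y \<bullet> r = of_int k + real q * of_int j"
        using \<open>y \<in> ?C B\<close> rk by (fastforce simp: solutions_mod_def)
      obtain l where l: "p \<bullet> r = of_int l"
        using coweight_root_inner_Ints [OF p(1)] B rk by (force elim: Ints_cases)
      have eq: "red (y + of_int i *\<^sub>R v) = y + of_int i *\<^sub>R v - real q *\<^sub>R p"
        using p(2) [symmetric] by (simp only: eq_diff_eq)
      have "v \<bullet> r = 0" using v(2) rk by force
      then have "red (y + of_int i *\<^sub>R v) \<bullet> r = of_int k + real q * of_int (j - l)"
        unfolding eq using j l by (simp add: inner_diff_left inner_left_distrib algebra_simps)
      then show ?thesis by blast
    qed
    then show ?thesis using conjunct1 [OF red [OF shift [OF y]]] by (auto simp: solutions_mod_def)
  qed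
  have red_\<mu>: "\<exists>l :: int. red (y + of_int i *\<^sub>R v) \<bullet> \<mu> = y \<bullet> \<mu> + of_int (i * e) + real q * of_int l"
    if y: "y \<in> fbox q" for y i
  proof -
    obtain p where p: "p \<in> coweight_lattice S"
      "y + of_int i *\<^sub>R v = red (y + of_int i *\<^sub>R v) + real q *\<^sub>R p"
      using red [OF shift [OF y]] by blast
    obtain l where l: "p \<bullet> \<mu> = of_int l"
      using coweight_root_inner_Ints [OF p(1) \<mu>] by (auto elim: Ints_cases)
    have "red (y + of_int i *\<^sub>R v) = y + of_int i *\<^sub>R v - real q *\<^sub>R p"
      using p(2) [symmetric] by (simp only: eq_diff_eq)
    then have "red (y + of_int i *\<^sub>R v) \<bullet> \<mu> = y \<bullet> \<mu> + of_int (i * e) + real q * of_int (- l)"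
      using l e by (simp add: inner_diff_left inner_left_distrib)
    then show ?thesis by blast
  qed
  have "bij_betw (\<lambda>(z, i). red (z + of_int i *\<^sub>R v)) (?C (insert (\<mu>, k) B) \<times> {0..<int q}) (?C B)"
    unfolding bij_betw_def
  proof
    show "inj_on (\<lambda>(z, i). red (z + of_int i *\<^sub>R v)) (?C (insert (\<mu>, k) B) \<times> {0..<int q})"
    proof (rule inj_onI, clarify)
      fix z i z' i'
      assume zi: "z \<in> ?C (insert (\<mu>, k) B)" "z' \<in> ?C (insert (\<mu>, k) B)" "i \<in> {0..<int q}" "i' \<in> {0..<int q}"
        and eq: "red (z + of_int i *\<^sub>R v) = red (z' + of_int i' *\<^sub>R v)"
      have box: "z \<in> fbox q" "z' \<in> fbox q"
        using zi by (auto simp: solutions_mod_def)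
      obtain j j' where j: "z \<bullet> \<mu> = of_int k + real q * of_int j" "z' \<bullet> \<mu> = of_int k + real q * of_int j'"
        using zi by (auto simp: solutions_mod_def)
      obtain l l' where l: "red (z + of_int i *\<^sub>R v) \<bullet> \<mu> = z \<bullet> \<mu> + of_int (i * e) + real q * of_int l"
        "red (z' + of_int i' *\<^sub>R v) \<bullet> \<mu> = z' \<bullet> \<mu> + of_int (i' * e) + real q * of_int l'"
        using red_\<mu> [OF box(1)] red_\<mu> [OF box(2)] by blast
      have "real_of_int (int q * j + i * e + int q * l) = of_int (int q * j' + i' * e + int q * l')"
        using eq l j by simp
      then have "int q * j + i * e + int q * l = int q * j' + i' * e + int q * l'"
        by (simp only: of_int_eq_iff)
      then have "(i - i') * e = int q * (j' + l' - j - l)"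
        by (simp add: algebra_simps)
      then have "int q dvd (i - i') * e" by simp
      then have "int q dvd i - i'"
        using e(2) by (simp add: coprime_dvd_mult_left_iff)
      then have "i = i'"
        using zi(3,4) dvd_imp_le_int [of "i - i'" "int q"] by (cases "i = i'") (auto simp: abs_if split: if_splits)
      then show "z = z' \<and> i = i'"
        using red_unique [OF box _ shift [OF box(1)] shift [OF box(2)]] eq by simp
    qed
    show "(\<lambda>(z, i). red (z + of_int i *\<^sub>R v)) ` (?C (insert (\<mu>, k) B) \<times> {0..<int q}) = ?C B"
    proof
      show "(\<lambda>(z, i). red (z + of_int i *\<^sub>R v)) ` (?C (insert (\<mu>, k) B) \<times> {0..<int q}) \<subseteq> ?C B"
      proof -
        have "?C (insert (\<mu>, k) B) \<subseteq> ?C B"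
          by (auto simp: solutions_mod_def)
        then have "red (z + of_int i *\<^sub>R v) \<in> ?C B" if "z \<in> ?C (insert (\<mu>, k) B)" for z i
          using that by (intro red_C) (rule subsetD)
        then show ?thesis by (intro image_subsetI) (simp add: mem_Times_iff split_beta)
      qed
      show "?C B \<subseteq> (\<lambda>(z, i). red (z + of_int i *\<^sub>R v)) ` (?C (insert (\<mu>, k) B) \<times> {0..<int q})"
      proof
        fix y assume y: "y \<in> ?C B"
        then have yb: "y \<in> fbox q" by (simp add: solutions_mod_def)
        obtain l where l: "y \<bullet> \<mu> = of_int l"
          using coweight_root_inner_Ints [OF P [OF yb] \<mu>] by (auto elim: Ints_cases)
        obtain a b where ab: "a * int q + b * e = 1"
          using bezout_int [of "int q" e] e(2) by auto
        \<comment> \<open>b inverts e modulo q, so i * e is congruent to l - k, and moving y back by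
          i v produces the value k at \<mu>.\<close>
        define i where "i = ((l - k) * b) mod int q"
        have i: "i \<in> {0..<int q}" using \<open>q > 0\<close> by (simp add: i_def)
        have "int q dvd l - k - i * e"
        proof -
          have "l - k = (l - k) * (a * int q + b * e)"
            using ab by simp
          moreover have "(l - k) * b = int q * ((l - k) * b div int q) + i"
            by (simp add: i_def)
          ultimately have "l - k - i * e = int q * ((l - k) * a + (l - k) * b div int q * e)"
            by algebra
          then show ?thesis by simp
        qed
        then obtain j where j: "l - k - i * e = int q * j" by blast
        let ?z = "red (y + of_int (- i) *\<^sub>R v)"
        have z: "?z \<in> ?C B" using red_C [OF y] by blast
        obtain l' where l': "?z \<bullet> \<mu> = y \<bullet> \<mu> + of_int (- i * e) + real q * of_int l'"
          using red_\<mu> [OF yb] by blast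
        have "real_of_int (l - k - i * e) = of_int (int q * j)"
          using j by (simp only:)
        then have "?z \<bullet> \<mu> = of_int k + real q * of_int (j + l')"
          using l l' by (simp add: algebra_simps)
        then have "\<exists>j :: int. ?z \<bullet> \<mu> = of_int k + real q * of_int j"
          by blast
        then have zC: "?z \<in> ?C (insert (\<mu>, k) B)"
          using z unfolding solutions_mod_def by blast
        have zb: "?z \<in> fbox q" using z by (simp add: solutions_mod_def)
        obtain p where p: "p \<in> coweight_lattice S" "y + of_int (- i) *\<^sub>R v = ?z + real q *\<^sub>R p"
          using red [OF shift [OF yb]] by blast
        obtain p' where p': "p' \<in> coweight_lattice S"
          "?z + of_int i *\<^sub>R v = red (?z + of_int i *\<^sub>R v) + real q *\<^sub>R p'"
          using red [OF shift [OF zb]] by blast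
        have "red (?z + of_int i *\<^sub>R v) = ?z + of_int i *\<^sub>R v - real q *\<^sub>R p'"
          using p'(2) [symmetric] by (simp only: eq_diff_eq)
        moreover have "?z = y + of_int (- i) *\<^sub>R v - real q *\<^sub>R p"
          using p(2) [symmetric] by (simp only: eq_diff_eq)
        ultimately have "red (?z + of_int i *\<^sub>R v) = y + of_int (- i) *\<^sub>R v - real q *\<^sub>R p + of_int i *\<^sub>R v - real q *\<^sub>R p'"
          by (rule trans [OF _ arg_cong [where f = "\<lambda>x. x + of_int i *\<^sub>R v - real q *\<^sub>R p'"]])
        then have "red (?z + of_int i *\<^sub>R v) = y + real q *\<^sub>R (- (p + p'))"
          by (rule trans) (simp add: algebra_simps)
        moreover have "- (p + p') \<in> coweight_lattice S"
          using coweight_lattice_scale_Ints [OF coweight_lattice_add [OF p(1) p'(1)], of "-1"] by simp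
        ultimately have "red (?z + of_int i *\<^sub>R v) = y"
          using box_representative_unique red [OF shift [OF zb]] yb by blast
        then show "y \<in> (\<lambda>(z, i). red (z + of_int i *\<^sub>R v)) ` (?C (insert (\<mu>, k) B) \<times> {0..<int q})"
          using zC i by (intro image_eqI [of _ _ "(?z, i)"]) auto
      qed
    qed
  qed
  then have "card (?C (insert (\<mu>, k) B) \<times> {0..<int q}) = card (?C B)"
    by (rule bij_betw_same_card)
  then show ?thesis by (simp add: card_cartesian_product mult.commute)
qed

text \<open>Induction on the equations. A new equation dependent on a consistent B is redundant or
  contradictory, a detected one lowers the dimension by one; each case persists modulo q once q is
  coprime to a nonzero integer, which N collects as a factor. A contradiction is invisible modulo 1,
  whence q > 1.\<close>

theorem card_solutions_mod:
  assumes "finite B" and "fst ` B \<subseteq> root_lattice"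
  shows "\<exists>N>0. \<forall>q>1. coprime q N \<longrightarrow>
    card (solutions_mod q B) = (if solutions B = {} then 0 else q ^ nat (aff_dim (solutions B)))"
  using assms
proof (induction B rule: finite_induct)
  case empty
  have "solutions {} = UNIV" "solutions_mod q {} = fbox q" for q
    by (auto simp: solutions_def solutions_mod_def)
  then show ?case by (intro exI [of _ 1]) (simp add: card_fbox)
next
  case (insert b B)
  obtain \<mu> k where b: "b = (\<mu>, k)" by fastforce
  have \<mu>: "\<mu> \<in> root_lattice" and B: "fst ` B \<subseteq> root_lattice"
    using insert.prems b by auto
  obtain N where "N > 0" and N: "\<And>q. q > 1 \<Longrightarrow> coprime q N \<Longrightarrow>
      card (solutions_mod q B) = (if solutions B = {} then 0 else q ^ nat (aff_dim (solutions B)))"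
    using insert.IH B by blast
  have sol: "solutions (insert b B) = solutions B \<inter> {x. \<mu> \<bullet> x = of_int k}"
    by (auto simp: solutions_def b hyperplane_def inner_commute)
  have sub: "solutions_mod q (insert b B) \<subseteq> solutions_mod q B" for q
    by (auto simp: solutions_mod_def)
  show ?case
  proof (cases "solutions B = {}")
    case True
    have "card (solutions_mod q (insert b B)) = 0" if "q > 1" "coprime q N" for q
      using N [OF that] True card_mono [OF finite_solutions_mod sub] by (metis le_zero_eq)
    then show ?thesis using \<open>N > 0\<close> True sol by (intro exI [of _ N]) auto
  next
    case False
    then obtain x0 where x0: "x0 \<in> solutions B" by blast
    consider (dep) d n where "d \<noteq> 0" "of_int d *\<^sub>R \<mu> = (\<Sum>b\<in>B. of_int (n b :: int) *\<^sub>R fst b)"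
      | (det) v where "v \<in> coweight_lattice S" "\<forall>b\<in>B. v \<bullet> fst b = 0" "v \<bullet> \<mu> \<noteq> 0"
      using dependent_or_detected [OF insert.hyps(1) B \<mu>] by auto
    then show ?thesis
    proof cases
      case dep
      \<comment> \<open>The dependency forces d * (x \<bullet> \<mu>) = K on all solutions of B, so
        the new equation is redundant if K = d * k and contradictory otherwise.\<close>
      define K where "K = (\<Sum>b\<in>B. n b * snd b)"
      have inner_d: "of_int d * (x \<bullet> \<mu>) = (\<Sum>b\<in>B. of_int (n b) * (x \<bullet> fst b))" for x
        using arg_cong [OF dep(2), of "\<lambda>y. x \<bullet> y"] by (simp add: inner_sum_right)
      have solK: "of_int d * (x \<bullet> \<mu>) = of_int K" if "x \<in> solutions B" for x
        unfolding inner_d K_def of_int_sum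
        using that by (intro sum.cong) (auto simp: solutions_def hyperplane_def)
      have modK: "\<exists>J. of_int d * (z \<bullet> \<mu>) = of_int (K + int q * J)" if "z \<in> solutions_mod q B" for z q
      proof -
        have "\<forall>b\<in>B. \<exists>j :: int. z \<bullet> fst b = of_int (snd b) + real q * of_int j"
          using that by (auto simp: solutions_mod_def)
        then obtain j where j: "\<And>b. b \<in> B \<Longrightarrow> z \<bullet> fst b = of_int (snd b) + real q * of_int (j b :: int)"
          by metis
        have "of_int d * (z \<bullet> \<mu>) = of_int (K + int q * (\<Sum>b\<in>B. n b * j b))"
          unfolding inner_d K_def
          by (simp add: j sum_distrib_left algebra_simps sum.distrib)
        then show ?thesis by blast
      qed
      show ?thesis
      proof (cases "K = d * k")
        case True
        have "solutions B \<subseteq> {x. \<mu> \<bullet> x = of_int k}"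
          using solK True dep(1) by (auto simp: inner_commute)
        then have sol_eq: "solutions (insert b B) = solutions B"
          using sol by auto
        have "solutions_mod q (insert b B) = solutions_mod q B" if "coprime q (N * nat \<bar>d\<bar>)" for q
        proof
          have "coprime (int q) d"
            using that by (metis coprime_abs_right_iff coprime_int_iff coprime_mult_right_iff nat_0_le abs_ge_zero)
          show "solutions_mod q B \<subseteq> solutions_mod q (insert b B)"
          proof
            fix z assume z: "z \<in> solutions_mod q B"
            obtain J where J: "of_int d * (z \<bullet> \<mu>) = of_int (K + int q * J)"
              using modK [OF z] by blast
            obtain l where l: "z \<bullet> \<mu> = of_int l"
              using coweight_root_inner_Ints [of z \<mu>] z \<mu> by (auto simp: solutions_mod_def fbox_def elim: Ints_cases)
            have "real_of_int (d * l) = of_int (K + int q * J)"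
              using J l by simp
            then have "d * l = d * k + int q * J"
              unfolding of_int_eq_iff True by simp
            then have "d * (l - k) = int q * J" by (simp add: algebra_simps)
            then have "int q dvd d * (l - k)" by simp
            then have "int q dvd l - k"
              using \<open>coprime (int q) d\<close> by (simp add: coprime_dvd_mult_right_iff)
            then obtain j where "l - k = int q * j" by blast
            then have "l = k + int q * j" by simp
            then have "z \<bullet> \<mu> = of_int k + real q * of_int j"
              using l by simp
            then show "z \<in> solutions_mod q (insert b B)"
              using z b by (auto simp: solutions_mod_def)
          qed
        qed (rule sub)
        then show ?thesis
          using N \<open>N > 0\<close> dep(1) unfolding sol_eq
          by (intro exI [of _ "N * nat \<bar>d\<bar>"]) auto
      next
        case False
        have empty: "solutions (insert b B) = {}"
        proof -
          have "of_int d * of_int k \<noteq> (of_int K :: real)"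
            using False by (metis of_int_eq_iff of_int_mult)
          then show ?thesis
            using solK unfolding sol by (force simp: inner_commute [of \<mu>])
        qed
        have "solutions_mod q (insert b B) = {}" if "q > 1" "coprime q (N * nat \<bar>K - d * k\<bar>)" for q
        proof (rule ccontr)
          assume "solutions_mod q (insert b B) \<noteq> {}"
          then obtain z where z: "z \<in> solutions_mod q (insert b B)" by blast
          obtain J where J: "of_int d * (z \<bullet> \<mu>) = of_int (K + int q * J)"
            using modK z sub by blast
          obtain j where j: "z \<bullet> \<mu> = of_int k + real q * of_int j"
            using z b by (auto simp: solutions_mod_def)
          have "real_of_int (d * (k + int q * j)) = of_int (K + int q * J)"
            using J j by simp
          then have "d * (k + int q * j) = K + int q * J"
            by (simp only: of_int_eq_iff)
          then have "K - d * k = int q * (d * j - J)"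
            by (simp add: algebra_simps)
          then have "int q dvd K - d * k" by simp
          moreover have "coprime (int q) (K - d * k)"
            using that by (metis coprime_abs_right_iff coprime_int_iff coprime_mult_right_iff nat_0_le abs_ge_zero)
          ultimately have "is_unit (int q)"
            by (metis coprime_common_divisor dvd_refl)
          then show False using that(1) by simp
        qed
        then show ?thesis
          using \<open>N > 0\<close> False empty by (intro exI [of _ "N * nat \<bar>K - d * k\<bar>"]) auto
      qed
    next
      case det
      obtain e where e: "v \<bullet> \<mu> = of_int e"
        using coweight_root_inner_Ints [OF det(1) \<mu>] by (auto elim: Ints_cases)
      then have "e \<noteq> 0" using det(3) by auto
      have line: "x0 + s *\<^sub>R v \<in> solutions B" for s
        using x0 det(2) by (force simp: solutions_def hyperplane_def inner_left_distrib)
      have "x0 + ((of_int k - x0 \<bullet> \<mu>) / of_int e) *\<^sub>R v \<in> solutions (insert b B)"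
        using line e \<open>e \<noteq> 0\<close> unfolding sol by (simp add: inner_commute [of \<mu>] inner_left_distrib)
      then have ne: "solutions (insert b B) \<noteq> {}" by blast
      \<comment> \<open>The extra 1 gives the value k + 1 at \<mu>, so \<open>solutions B\<close> is
        not contained in the hyperplane and the intersection loses exactly one dimension.\<close>
      have "x0 + ((of_int k - x0 \<bullet> \<mu> + 1) / of_int e) *\<^sub>R v \<notin> {x. \<mu> \<bullet> x = of_int k}"
        using e \<open>e \<noteq> 0\<close> by (simp add: inner_commute [of \<mu>] inner_left_distrib)
      then have "\<not> solutions B \<subseteq> {x. \<mu> \<bullet> x = of_int k}"
        using line by blast
      then have "aff_dim (solutions (insert b B)) = aff_dim (solutions B) - 1"
        using aff_dim_affine_Int_hyperplane [OF affine_solutions, of B \<mu> "of_int k"] ne sol by auto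
      moreover have "aff_dim (solutions (insert b B)) \<ge> 0"
        using ne by (metis aff_dim_negative_iff linorder_not_less)
      ultimately have dim: "nat (aff_dim (solutions B)) = Suc (nat (aff_dim (solutions (insert b B))))"
        by simp
      have "card (solutions_mod q (insert b B)) = q ^ nat (aff_dim (solutions (insert b B)))"
        if q: "q > 1" "coprime q (N * nat \<bar>e\<bar>)" for q
      proof -
        have "coprime (int q) e"
          using that by (metis coprime_abs_right_iff coprime_int_iff coprime_mult_right_iff nat_0_le abs_ge_zero)
        then have "q * card (solutions_mod q (insert b B)) = card (solutions_mod q B)"
          using card_solutions_mod_detected [OF B \<mu> det(1,2) e] q(1) b by simp
        also have "\<dots> = q * q ^ nat (aff_dim (solutions (insert b B)))"
          using N [OF q(1)] q(2) False dim by simp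
        finally show ?thesis using q(1) by simp
      qed
      then show ?thesis
        using \<open>N > 0\<close> \<open>e \<noteq> 0\<close> ne by (intro exI [of _ "N * nat \<bar>e\<bar>"]) auto
    qed
  qed
qed

end

section \<open>The affine Weyl group on affine roots\<close>

lemma reflection_coroot: "reflection \<alpha> x = x - (x \<bullet> \<alpha>) *\<^sub>R coroot \<alpha>"
  by (simp add: reflection_def coroot_def)

lemma reflection_isometry: "\<alpha> \<noteq> 0 \<Longrightarrow> reflection \<alpha> x \<bullet> reflection \<alpha> y = x \<bullet> y"
  by (simp add: reflection_def inner_diff_left inner_diff_right inner_commute field_simps)

lemma reflection_involution: "\<alpha> \<noteq> 0 \<Longrightarrow> reflection \<alpha> (reflection \<alpha> x) = x"
  by (simp add: reflection_def inner_diff_left scaleR_diff_left [symmetric] field_simps)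

lemma linear_reflection: "linear (reflection \<alpha>)"
  by (rule linearI) (simp_all add: reflection_def inner_left_distrib algebra_simps add_divide_distrib)

lemma coroot_reflection:
  assumes "\<gamma> \<noteq> 0" shows "coroot (reflection \<gamma> \<beta>) = reflection \<gamma> (coroot \<beta>)"
  using reflection_isometry [OF assms, of \<beta> \<beta>]
  by (simp add: coroot_def linear_scale [OF linear_reflection])

lemma coroot_uminus: "coroot (- \<alpha>) = - coroot \<alpha>"
  by (simp add: coroot_def)

lemma coroot_inner_self: "\<alpha> \<noteq> 0 \<Longrightarrow> coroot \<alpha> \<bullet> \<alpha> = 2"
  by (simp add: coroot_def)

locale root_system =
  fixes \<Delta> S :: "'a::euclidean_space set" and \<theta> :: 'a and c :: "'a \<Rightarrow> nat"
  assumes crystallographic: "crystallographic_root_system \<Delta>"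
    and reduced: "reduced_roots \<Delta>"
    and simple: "simple_roots \<Delta> S"
    and highest: "highest_root \<Delta> S \<theta>"
    and \<theta>_eq: "\<theta> = (\<Sum>\<alpha>\<in>S. real (c \<alpha>) *\<^sub>R \<alpha>)"
begin

lemma finite_\<Delta>: "finite \<Delta>" and zero_not_root: "0 \<notin> \<Delta>" and span_\<Delta>: "span \<Delta> = UNIV"
  using crystallographic by (auto simp: crystallographic_root_system_def)

lemma root_nonzero: "\<alpha> \<in> \<Delta> \<Longrightarrow> \<alpha> \<noteq> 0"
  using zero_not_root by auto

lemma reflection_root: "\<alpha> \<in> \<Delta> \<Longrightarrow> \<beta> \<in> \<Delta> \<Longrightarrow> reflection \<alpha> \<beta> \<in> \<Delta>"
  using crystallographic by (auto simp: crystallographic_root_system_def)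

lemma cartan_integer: "\<alpha> \<in> \<Delta> \<Longrightarrow> \<beta> \<in> \<Delta> \<Longrightarrow> 2 * (\<beta> \<bullet> \<alpha>) / (\<alpha> \<bullet> \<alpha>) \<in> \<int>"
  using crystallographic by (auto simp: crystallographic_root_system_def)

lemma uminus_root: "\<alpha> \<in> \<Delta> \<Longrightarrow> - \<alpha> \<in> \<Delta>"
proof -
  assume \<alpha>: "\<alpha> \<in> \<Delta>"
  have "reflection \<alpha> \<alpha> = - \<alpha>"
    using root_nonzero [OF \<alpha>] by (simp add: reflection_def scaleR_2)
  then show ?thesis using reflection_root [OF \<alpha> \<alpha>] by simp
qed

lemma S_subset: "S \<subseteq> \<Delta>"
  using simple by (simp add: simple_roots_def)

lemma multiple_root: "\<alpha> \<in> \<Delta> \<Longrightarrow> a *\<^sub>R \<alpha> \<in> \<Delta> \<Longrightarrow> a = 1 \<or> a = -1"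
  using reduced by (auto simp: reduced_roots_def)

sublocale lattice_basis S
proof
  show "independent S"
    using simple by (simp add: simple_roots_def)
  have comb: "nonneg_combinations S \<subseteq> span S"
    by (auto simp: nonneg_combinations_def intro!: span_sum intro: span_scale span_base)
  have "\<Delta> \<subseteq> span S"
  proof
    fix \<beta> assume "\<beta> \<in> \<Delta>"
    then have "\<beta> \<in> nonneg_combinations S \<or> - \<beta> \<in> nonneg_combinations S"
      using simple by (simp add: simple_roots_def)
    then show "\<beta> \<in> span S"
      using comb span_neg [of "- \<beta>" S] by auto
  qed
  then have "span \<Delta> \<subseteq> span S"
    by (rule span_minimal) (rule subspace_span)
  then show "span S = UNIV"
    using span_\<Delta> by auto
qed

lemma nonneg_combinations_iff: "x \<in> nonneg_combinations S \<longleftrightarrow> (\<forall>\<alpha>\<in>S. x \<bullet> cowt \<alpha> \<in> \<nat>)"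
proof
  assume "x \<in> nonneg_combinations S"
  then obtain n :: "'a \<Rightarrow> nat" where "x = (\<Sum>\<alpha>\<in>S. real (n \<alpha>) *\<^sub>R \<alpha>)"
    by (auto simp: nonneg_combinations_def)
  then show "\<forall>\<alpha>\<in>S. x \<bullet> cowt \<alpha> \<in> \<nat>"
    by (simp add: sum_inner_cowt)
next
  assume "\<forall>\<alpha>\<in>S. x \<bullet> cowt \<alpha> \<in> \<nat>"
  then have "\<forall>\<alpha>\<in>S. \<exists>n :: nat. x \<bullet> cowt \<alpha> = real n"
    by (auto elim: Nats_cases)
  then obtain n :: "'a \<Rightarrow> nat" where n: "\<forall>\<alpha>\<in>S. x \<bullet> cowt \<alpha> = real (n \<alpha>)"
    by metis
  have "x = (\<Sum>\<alpha>\<in>S. (x \<bullet> cowt \<alpha>) *\<^sub>R \<alpha>)"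
    by (simp add: basis_expansion)
  also have "\<dots> = (\<Sum>\<alpha>\<in>S. real (n \<alpha>) *\<^sub>R \<alpha>)"
    by (rule sum.cong) (simp_all add: n)
  finally show "x \<in> nonneg_combinations S"
    unfolding nonneg_combinations_def by blast
qed

lemma root_nonneg_or_nonpos:
  assumes "\<beta> \<in> \<Delta>"
  shows "\<beta> \<in> nonneg_combinations S \<or> - \<beta> \<in> nonneg_combinations S"
  using assms simple by (simp add: simple_roots_def)

lemma root_coordinate_Ints: "\<beta> \<in> \<Delta> \<Longrightarrow> \<alpha> \<in> S \<Longrightarrow> \<beta> \<bullet> cowt \<alpha> \<in> \<int>"
  using root_nonneg_or_nonpos [of \<beta>] Nats_subset_Ints by (auto simp: nonneg_combinations_iff)

lemma root_in_root_lattice: "\<beta> \<in> \<Delta> \<Longrightarrow> \<beta> \<in> root_lattice"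
  by (simp add: root_lattice_def root_coordinate_Ints)

lemma coweight_root_Ints: "z \<in> coweight_lattice S \<Longrightarrow> \<beta> \<in> \<Delta> \<Longrightarrow> z \<bullet> \<beta> \<in> \<int>"
  by (simp add: coweight_root_inner_Ints root_in_root_lattice)

lemma \<theta>_root: "\<theta> \<in> \<Delta>"
  using highest by (simp add: highest_root_def)

lemma \<theta>_coordinate: "\<alpha> \<in> S \<Longrightarrow> \<theta> \<bullet> cowt \<alpha> = real (c \<alpha>)"
  by (simp add: \<theta>_eq sum_inner_cowt)

lemma root_coordinate_le:
  assumes "\<beta> \<in> \<Delta>" "\<alpha> \<in> S"
  shows "\<beta> \<bullet> cowt \<alpha> \<le> real (c \<alpha>)"
proof -
  have "\<theta> - \<beta> \<in> nonneg_combinations S"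
    using highest assms by (simp add: highest_root_def)
  then have "(\<theta> - \<beta>) \<bullet> cowt \<alpha> \<ge> 0"
    using assms(2) by (auto simp: nonneg_combinations_iff elim!: Nats_cases)
  then show ?thesis using assms(2) by (simp add: inner_diff_left \<theta>_coordinate)
qed

lemma root_coordinate_ge:
  assumes "\<beta> \<in> \<Delta>" "\<alpha> \<in> S"
  shows "- real (c \<alpha>) \<le> \<beta> \<bullet> cowt \<alpha>"
  using root_coordinate_le [OF uminus_root [OF assms(1)] assms(2)] by simp

lemma c_pos: "\<alpha> \<in> S \<Longrightarrow> c \<alpha> > 0"
  using root_coordinate_le [of \<alpha> \<alpha>] S_subset by (auto simp: cowt_inner inner_commute [of \<alpha>])

text \<open>The pair \<open>(\<alpha>, k)\<close> stands for the affine function \<open>x \<mapsto> x \<bullet> \<alpha> + t k\<close>, and \<open>affine_simple\<close>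
  lists the walls of the dilated fundamental alcove.\<close>

definition affine_roots :: "('a \<times> real) set" where
  "affine_roots = \<Delta> \<times> \<int>"

definition affine_simple :: "('a \<times> real) set" where
  "affine_simple = insert (- \<theta>, 1) ((\<lambda>\<alpha>. (\<alpha>, 0)) ` S)"

text \<open>The coefficient of (\<alpha>, 0) when a is expanded in \<open>affine_simple\<close>; the
  coefficient of (- \<theta>, 1) is \<open>snd a\<close>. Thus \<open>affine_pos\<close> says that
  all coefficients are nonnegative.\<close>

definition affine_coordinate :: "'a \<Rightarrow> 'a \<times> real \<Rightarrow> real" where
  "affine_coordinate \<alpha> a = fst a \<bullet> cowt \<alpha> + snd a * real (c \<alpha>)"

definition affine_pos :: "'a \<times> real \<Rightarrow> bool" where
  "affine_pos a \<longleftrightarrow> snd a \<ge> 0 \<and> (\<forall>\<alpha>\<in>S. affine_coordinate \<alpha> a \<ge> 0)"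

text \<open>The linear action on affine functions: the form sees first components only, so constant
  functions are fixed.\<close>

definition affine_refl :: "'a \<times> real \<Rightarrow> 'a \<times> real \<Rightarrow> 'a \<times> real" where
  "affine_refl b a = a - (2 * (fst a \<bullet> fst b) / (fst b \<bullet> fst b)) *\<^sub>R b"

lemma affine_simple_roots: "affine_simple \<subseteq> affine_roots"
  using S_subset uminus_root [OF \<theta>_root] by (auto simp: affine_simple_def affine_roots_def)

lemma affine_pos_simple: "b \<in> affine_simple \<Longrightarrow> affine_pos b"
  by (auto simp: affine_simple_def affine_pos_def affine_coordinate_def \<theta>_coordinate
     cowt_inner inner_commute [of _ "cowt _"])
    (simp add: \<theta>_coordinate inner_commute [of "cowt _" \<theta>])

lemma uminus_affine_root: "a \<in> affine_roots \<Longrightarrow> - a \<in> affine_roots"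
  using uminus_root by (auto simp: affine_roots_def)

lemma fst_affine_root: "a \<in> affine_roots \<Longrightarrow> fst a \<in> \<Delta>"
  by (auto simp: affine_roots_def)

text \<open>At level k \<ge> 1 a coordinate is at least c \<alpha> plus a root coordinate, and the
  latter is at least - c \<alpha> because \<theta> is highest. Level 0 is the sign dichotomy of the
  finite system.\<close>

lemma affine_pos_or_neg:
  assumes "a \<in> affine_roots"
  shows "affine_pos a \<or> affine_pos (- a)"
proof -
  obtain \<alpha> k where a: "a = (\<alpha>, of_int k)" and \<alpha>: "\<alpha> \<in> \<Delta>"
    using assms by (auto simp: affine_roots_def elim!: Ints_cases)
  have pos: "affine_pos (\<beta>, of_int l)" if "l \<ge> 1" "\<beta> \<in> \<Delta>" for \<beta> l
    unfolding affine_pos_def affine_coordinate_def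
  proof (intro conjI ballI)
    fix \<gamma> assume \<gamma>: "\<gamma> \<in> S"
    have "1 * real (c \<gamma>) \<le> real_of_int l * real (c \<gamma>)"
      using that(1) by (intro mult_right_mono) auto
    then show "0 \<le> fst (\<beta>, real_of_int l) \<bullet> cowt \<gamma> + snd (\<beta>, real_of_int l) * real (c \<gamma>)"
      using root_coordinate_ge [OF that(2) \<gamma>] by simp
  qed (use that in simp)
  consider "k \<ge> 1" | "k = 0" | "- k \<ge> 1" by linarith
  then show ?thesis
  proof cases
    case 1 then show ?thesis using pos \<alpha> a by simp
  next
    case 2
    then show ?thesis
      using root_nonneg_or_nonpos [OF \<alpha>] a
      by (auto simp: affine_pos_def affine_coordinate_def nonneg_combinations_iff elim!: Nats_cases)
  next
    case 3 then show ?thesis using pos [of "- k" "- \<alpha>"] uminus_root [OF \<alpha>] a by simp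
  qed
qed

lemma affine_pos_neg_zero:
  assumes "affine_pos a" "affine_pos (- a)" shows "a = 0"
proof -
  have k: "snd a = 0" using assms by (simp add: affine_pos_def)
  have "fst a \<bullet> cowt \<alpha> = 0" if "\<alpha> \<in> S" for \<alpha>
    using assms that k by (force simp: affine_pos_def affine_coordinate_def)
  then have "fst a = 0" using eqI_cowt [of "fst a" 0] by simp
  with k show ?thesis by (simp add: prod_eq_iff)
qed

lemma affine_not_pos_neg: "a \<in> affine_roots \<Longrightarrow> affine_pos a \<Longrightarrow> \<not> affine_pos (- a)"
  using affine_pos_neg_zero [of a] fst_affine_root [of a] zero_not_root by auto

lemma fst_affine_refl: "fst (affine_refl b a) = reflection (fst b) (fst a)"
  by (simp add: affine_refl_def reflection_def)

lemma affine_refl_root: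
  assumes "b \<in> affine_roots" "a \<in> affine_roots"
  shows "affine_refl b a \<in> affine_roots"
proof -
  have "snd (affine_refl b a) = snd a - 2 * (fst a \<bullet> fst b) / (fst b \<bullet> fst b) * snd b"
    by (simp add: affine_refl_def)
  also have "\<dots> \<in> \<int>"
    using assms cartan_integer [of "fst b" "fst a"]
    by (intro Ints_diff Ints_mult) (auto simp: affine_roots_def)
  finally have "snd (affine_refl b a) \<in> \<int>" .
  moreover have "fst (affine_refl b a) \<in> \<Delta>"
    using assms by (simp add: fst_affine_refl reflection_root fst_affine_root)
  ultimately show ?thesis
    by (simp add: affine_roots_def mem_Times_iff)
qed

text \<open>A simple reflection changes only one coordinate, so it makes no positive root negative but the
  one it reflects in.\<close>

lemma affine_refl_pos:
  assumes b: "b \<in> affine_simple" and a: "a \<in> affine_roots" "affine_pos a" "a \<noteq> b"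
  shows "affine_pos (affine_refl b a)"
proof (rule ccontr)
  assume "\<not> affine_pos (affine_refl b a)"
  moreover have "affine_refl b a \<in> affine_roots"
    using b a affine_simple_roots by (intro affine_refl_root) auto
  ultimately have neg: "affine_pos (- affine_refl b a)"
    using affine_pos_or_neg by blast
  define \<kappa> where "\<kappa> = 2 * (fst a \<bullet> fst b) / (fst b \<bullet> fst b)"
  have r: "affine_refl b a = a - \<kappa> *\<^sub>R b"
    by (simp add: affine_refl_def \<kappa>_def)
  have root: "fst a \<in> \<Delta>" using a(1) by (rule fst_affine_root)
  have "a = b"
  proof (cases "b = (- \<theta>, 1)")
    case True
    \<comment> \<open>The coordinates along S vanish on (- \<theta>, 1), so the reflection does not
      change them. Being nonnegative for a and for its negated image, they are zero, and a is a
      multiple of b; reducedness leaves a = b.\<close>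
    have "fst a \<bullet> cowt \<alpha> = ((- snd a) *\<^sub>R \<theta>) \<bullet> cowt \<alpha>" if \<alpha>: "\<alpha> \<in> S" for \<alpha>
    proof -
      have "affine_coordinate \<alpha> (- affine_refl b a) = - affine_coordinate \<alpha> a"
        unfolding r using \<alpha>
        by (simp add: True affine_coordinate_def \<theta>_coordinate inner_left_distrib algebra_simps)
      then have "affine_coordinate \<alpha> a = 0"
        using neg a(2) \<alpha> by (fastforce simp: affine_pos_def)
      then show ?thesis using \<alpha> by (simp add: affine_coordinate_def \<theta>_coordinate)
    qed
    then have fst_a: "fst a = (- snd a) *\<^sub>R \<theta>" by (rule eqI_cowt)
    then have "- snd a = 1 \<or> - snd a = -1"
      using multiple_root [OF \<theta>_root, of "- snd a"] root by simp
    moreover have "snd a \<ge> 0" using a(2) by (simp add: affine_pos_def)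
    ultimately have "snd a = 1" by simp
    then show ?thesis using fst_a True by (simp add: prod_eq_iff)
  next
    case False
    then obtain \<gamma> where \<gamma>: "\<gamma> \<in> S" "b = (\<gamma>, 0)"
      using b by (auto simp: affine_simple_def)
    then have "snd (- affine_refl b a) = - snd a"
      unfolding r by simp
    then have k: "snd a = 0"
      using neg a(2) by (auto simp: affine_pos_def)
    have "fst a \<bullet> cowt \<alpha> = ((fst a \<bullet> cowt \<gamma>) *\<^sub>R \<gamma>) \<bullet> cowt \<alpha>" if \<alpha>: "\<alpha> \<in> S" for \<alpha>
    proof (cases "\<alpha> = \<gamma>")
      case True
      then show ?thesis using \<gamma> by (simp add: cowt_inner inner_commute [of \<gamma>])
    next
      case False
      then have "\<gamma> \<bullet> cowt \<alpha> = 0"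
        using \<alpha> \<gamma> by (simp add: cowt_inner inner_commute [of \<gamma>])
      then have "affine_coordinate \<alpha> (- affine_refl b a) = - affine_coordinate \<alpha> a"
        unfolding r by (simp add: \<gamma> affine_coordinate_def inner_diff_left)
      then have "affine_coordinate \<alpha> a = 0"
        using neg a(2) \<alpha> by (fastforce simp: affine_pos_def)
      then show ?thesis using \<open>\<gamma> \<bullet> cowt \<alpha> = 0\<close> k by (simp add: affine_coordinate_def)
    qed
    then have fst_a: "fst a = (fst a \<bullet> cowt \<gamma>) *\<^sub>R \<gamma>" by (rule eqI_cowt)
    then have "fst a \<bullet> cowt \<gamma> = 1 \<or> fst a \<bullet> cowt \<gamma> = -1"
      using multiple_root [of \<gamma> "fst a \<bullet> cowt \<gamma>"] root \<gamma>(1) S_subset by auto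
    moreover have "fst a \<bullet> cowt \<gamma> \<ge> 0"
      using a(2) \<gamma>(1) k by (force simp: affine_pos_def affine_coordinate_def)
    ultimately have "fst a \<bullet> cowt \<gamma> = 1" by linarith
    with fst_a have "fst a = \<gamma>" by simp
    then show ?thesis using k \<gamma> by (simp add: prod_eq_iff)
  qed
  with a(3) show False by simp
qed

section \<open>Height, words and the exchange condition\<close>

text \<open>The sum of all coefficients in \<open>affine_simple\<close>, the measure of the descents
  below: a simple reflection lowers it exactly when the pairing with that simple root is
  positive.\<close>

definition height :: "'a \<times> real \<Rightarrow> real" where
  "height a = snd a + (\<Sum>\<alpha>\<in>S. affine_coordinate \<alpha> a)"

lemma height_refl: "height (a - \<kappa> *\<^sub>R b) = height a - \<kappa> * height b"
  by (simp add: height_def affine_coordinate_def inner_diff_left sum_subtractf sum_distrib_left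
     algebra_simps sum.distrib)

lemma height_simple: "b \<in> affine_simple \<Longrightarrow> height b = 1"
proof -
  assume "b \<in> affine_simple"
  then consider "b = (- \<theta>, 1)" | \<gamma> where "\<gamma> \<in> S" "b = (\<gamma>, 0)"
    by (auto simp: affine_simple_def)
  then show ?thesis
  proof cases
    case 1
    then show ?thesis by (simp add: height_def affine_coordinate_def \<theta>_coordinate)
  next
    case 2
    have "(\<Sum>\<alpha>\<in>S. \<gamma> \<bullet> cowt \<alpha>) = (\<Sum>\<alpha>\<in>S. if \<alpha> = \<gamma> then 1 else 0)"
      using 2 by (intro sum.cong) (auto simp: cowt_inner inner_commute [of \<gamma>])
    then show ?thesis using 2 by (simp add: height_def affine_coordinate_def)
  qed
qed

lemma height_Nats: "a \<in> affine_roots \<Longrightarrow> affine_pos a \<Longrightarrow> height a \<in> \<nat>"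
proof -
  assume a: "a \<in> affine_roots" "affine_pos a"
  have "affine_coordinate \<alpha> a \<in> \<int>" if "\<alpha> \<in> S" for \<alpha>
    using a(1) that root_coordinate_Ints
    by (auto simp: affine_coordinate_def affine_roots_def intro!: Ints_add Ints_mult)
  then have "height a \<in> \<int>"
    using a(1) by (auto simp: height_def affine_roots_def intro!: Ints_add Ints_sum)
  moreover have "height a \<ge> 0"
    using a(2) by (auto simp: height_def affine_pos_def intro!: add_nonneg_nonneg sum_nonneg)
  ultimately show ?thesis by (simp add: Nats_altdef2)
qed

lemma fst_affine_expansion:
  "fst a = snd a *\<^sub>R (- \<theta>) + (\<Sum>\<alpha>\<in>S. affine_coordinate \<alpha> a *\<^sub>R \<alpha>)"
  by (rule eqI_cowt) (simp add: inner_left_distrib inner_diff_left sum_inner_cowt \<theta>_coordinate affine_coordinate_def)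

text \<open>A root pairs positively with itself and is here a nonnegative combination of simple
  ones, so one of them pairs positively with it. At level 0 the coefficient of (- \<theta>, 1) is
  zero, which keeps descents inside the finite system.\<close>

lemma ex_simple_acute:
  assumes "a \<in> affine_roots" "affine_pos a"
  shows "\<exists>b\<in>affine_simple. fst a \<bullet> fst b > 0 \<and> (snd a = 0 \<longrightarrow> snd b = 0)"
proof (rule ccontr)
  assume *: "\<not> ?thesis"
  have "fst a \<bullet> (snd a *\<^sub>R (- \<theta>)) \<le> 0"
  proof (cases "snd a = 0")
    case False
    then have "fst a \<bullet> (- \<theta>) \<le> 0" using * by (auto simp: affine_simple_def not_less)
    moreover have "snd a \<ge> 0" using assms(2) by (simp add: affine_pos_def)
    ultimately show ?thesis by (simp add: mult_nonneg_nonneg)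
  qed simp
  moreover have "affine_coordinate \<alpha> a * (fst a \<bullet> \<alpha>) \<le> 0" if "\<alpha> \<in> S" for \<alpha>
  proof -
    have "fst a \<bullet> \<alpha> \<le> 0" using * that by (auto simp: affine_simple_def not_less)
    then show ?thesis using assms(2) that by (simp add: affine_pos_def mult_nonneg_nonpos)
  qed
  ultimately have "fst a \<bullet> (snd a *\<^sub>R (- \<theta>) + (\<Sum>\<alpha>\<in>S. affine_coordinate \<alpha> a *\<^sub>R \<alpha>)) \<le> 0"
    unfolding inner_right_distrib inner_sum_right inner_scaleR_right
    by (intro add_nonpos_nonpos sum_nonpos) auto
  then have "fst a \<bullet> fst a \<le> 0"
    unfolding fst_affine_expansion [of a, symmetric] .
  then show False
    using root_nonzero [OF fst_affine_root [OF assms(1)]] inner_gt_zero_iff [of "fst a"] by linarith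
qed

primrec word :: "('a \<times> real) list \<Rightarrow> 'a \<times> real \<Rightarrow> 'a \<times> real" where
  "word [] a = a"
| "word (b # bs) a = affine_refl b (word bs a)"

lemma affine_refl_uminus: "affine_refl b (- a) = - affine_refl b a"
  by (simp add: affine_refl_def)

lemma affine_refl_diff_scale: "affine_refl b (x - \<kappa> *\<^sub>R y) = affine_refl b x - \<kappa> *\<^sub>R affine_refl b y"
  by (simp add: affine_refl_def prod_eq_iff inner_diff_left algebra_simps diff_divide_distrib)

lemma affine_refl_involution: "fst b \<noteq> 0 \<Longrightarrow> affine_refl b (affine_refl b a) = a"
  by (simp add: affine_refl_def prod_eq_iff inner_diff_left field_simps scaleR_diff_left [symmetric])

lemma affine_refl_isometry:
  "fst b \<noteq> 0 \<Longrightarrow> fst (affine_refl b x) \<bullet> fst (affine_refl b y) = fst x \<bullet> fst y"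
  by (simp add: fst_affine_refl reflection_isometry)

lemma simple_fst_nonzero: "b \<in> affine_simple \<Longrightarrow> fst b \<noteq> 0"
  using affine_simple_roots fst_affine_root root_nonzero by blast

lemma word_uminus: "word bs (- a) = - word bs a"
  by (induction bs) (simp_all add: affine_refl_uminus)

lemma word_diff_scale: "word bs (x - \<kappa> *\<^sub>R y) = word bs x - \<kappa> *\<^sub>R word bs y"
  by (induction bs) (simp_all add: affine_refl_diff_scale)

lemma word_append: "word (bs @ bs') a = word bs (word bs' a)"
  by (induction bs) simp_all

lemma word_isometry:
  "set bs \<subseteq> affine_simple \<Longrightarrow> fst (word bs x) \<bullet> fst (word bs y) = fst x \<bullet> fst y"
  by (induction bs) (simp_all add: affine_refl_isometry simple_fst_nonzero)

lemma word_rev: "set bs \<subseteq> affine_simple \<Longrightarrow> word bs (word (rev bs) a) = a"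
  by (induction bs arbitrary: a)
    (simp_all add: word_append affine_refl_involution simple_fst_nonzero)

lemma word_root: "set bs \<subseteq> affine_simple \<Longrightarrow> a \<in> affine_roots \<Longrightarrow> word bs a \<in> affine_roots"
  using affine_simple_roots by (induction bs) (auto intro!: affine_refl_root)

lemma word_refl:
  assumes "set bs \<subseteq> affine_simple"
  shows "word bs (affine_refl b a) = affine_refl (word bs b) (word bs a)"
  by (simp add: affine_refl_def word_diff_scale word_isometry [OF assms])

text \<open>The image of b turns from positive to negative at some letter d; as d makes only itself
  negative, the image just before is d. Conjugation turns the reflection in b into the one in d,
  which cancels that letter.\<close>

lemma exchange:
  assumes "set bs \<subseteq> affine_simple" "b \<in> affine_simple" "affine_pos (- word bs b)"
  shows "\<exists>bs'. set bs' \<subseteq> affine_simple \<and> length bs' < length bs \<and> (\<forall>a. word bs (affine_refl b a) = word bs' a)"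
  using assms
proof (induction bs)
  case Nil
  then have "affine_pos (- b)" by simp
  then show ?case
    using affine_not_pos_neg [of b] affine_pos_simple affine_simple_roots Nil by blast
next
  case (Cons d bs)
  have root: "word bs b \<in> affine_roots"
    using Cons.prems affine_simple_roots by (intro word_root) auto
  show ?case
  proof (cases "affine_pos (- word bs b)")
    case True
    then obtain bs' where bs': "set bs' \<subseteq> affine_simple" "length bs' < length bs"
      "\<forall>a. word bs (affine_refl b a) = word bs' a"
      using Cons.IH Cons.prems by auto
    then show ?thesis using Cons.prems by (intro exI [of _ "d # bs'"]) auto
  next
    case False
    then have pos: "affine_pos (word bs b)"
      using affine_pos_or_neg [OF root] by blast
    have "word bs b = d"
    proof (rule ccontr)
      assume "word bs b \<noteq> d"
      then have "affine_pos (word (d # bs) b)"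
        using affine_refl_pos [OF _ root pos] Cons.prems by simp
      moreover have "word (d # bs) b \<in> affine_roots"
        using Cons.prems affine_simple_roots by (intro word_root) auto
      ultimately show False
        using affine_not_pos_neg Cons.prems(3) by blast
    qed
    then have "word (d # bs) (affine_refl b a) = word bs a" for a
      using Cons.prems by (simp add: word_refl affine_refl_involution simple_fst_nonzero)
    then show ?thesis using Cons.prems by (intro exI [of _ bs]) auto
  qed
qed

text \<open>The last letter b acts first and sends b to - b, so the remaining word makes b negative
  and \<open>exchange\<close> yields a shorter word with the same action. The descent ends at the
  empty word.\<close>

lemma word_eq_id:
  assumes "set bs \<subseteq> affine_simple" and "\<And>b. b \<in> affine_simple \<Longrightarrow> affine_pos (word bs b)"
  shows "word bs a = a"
  using assms
proof (induction "length bs" arbitrary: bs rule: less_induct)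
  case less
  show ?case
  proof (cases bs rule: rev_cases)
    case (snoc bs' b)
    have b: "b \<in> affine_simple" and bs': "set bs' \<subseteq> affine_simple"
      using less.prems snoc by auto
    have "affine_refl b b = - b"
      using simple_fst_nonzero [OF b] by (simp add: affine_refl_def scaleR_2)
    then have "affine_pos (- word bs' b)"
      using less.prems(2) [OF b] snoc by (simp add: word_append word_uminus)
    then obtain bs'' where bs'': "set bs'' \<subseteq> affine_simple" "length bs'' < length bs'"
      "\<And>a. word bs' (affine_refl b a) = word bs'' a"
      using exchange [OF bs' b] by blast
    then have eq: "word bs = word bs''"
      using snoc by (auto simp: word_append fun_eq_iff)
    show ?thesis
      unfolding eq
    proof (rule less.hyps)
      show "length bs'' < length bs" using bs''(2) snoc by simp
    qed (use bs'' less.prems(2) eq in auto)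
  qed simp
qed

text \<open>As long as the root is not simple, reflecting in a simple root that pairs positively
  with it lowers the height and keeps it positive.\<close>

lemma affine_root_conjugate_simple:
  assumes "a \<in> affine_roots" "affine_pos a"
  shows "\<exists>bs b. set bs \<subseteq> affine_simple \<and> b \<in> affine_simple \<and> a = word bs b"
proof -
  obtain n where "height a = real n"
    using height_Nats [OF assms] by (auto elim: Nats_cases)
  then show ?thesis
    using assms
  proof (induction n arbitrary: a rule: less_induct)
    case (less n)
    show ?case
    proof (cases "a \<in> affine_simple")
      case True
      then show ?thesis by (intro exI [of _ "[]"] exI [of _ a]) auto
    next
      case False
      obtain b where b: "b \<in> affine_simple" "fst a \<bullet> fst b > 0"
        using ex_simple_acute [OF less.prems(2,3)] by blast
      let ?a = "affine_refl b a"
      have root: "?a \<in> affine_roots"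
        using b affine_simple_roots less.prems(2) by (intro affine_refl_root) auto
      have pos: "affine_pos ?a"
        using affine_refl_pos [OF b(1) less.prems(2,3)] False b(1) by blast
      obtain n' where n': "height ?a = real n'"
        using height_Nats [OF root pos] by (auto elim: Nats_cases)
      have "fst b \<bullet> fst b > 0"
        using simple_fst_nonzero [OF b(1)] by simp
      then have "height ?a < height a"
        using b(2) by (simp add: affine_refl_def height_refl height_simple [OF b(1)])
      then have "n' < n" using n' less.prems(1) by simp
      then obtain bs b' where bs: "set bs \<subseteq> affine_simple" "b' \<in> affine_simple" "?a = word bs b'"
        using less.IH [OF _ n' root pos] by blast
      then have "a = word (b # bs) b'"
        using affine_refl_involution [OF simple_fst_nonzero [OF b(1)], of a] by simp
      then show ?thesis
        using bs b(1) by (intro exI [of _ "b # bs"] exI [of _ b']) auto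
    qed
  qed
qed

section \<open>The coroot lattice and the finite Weyl group\<close>

text \<open>Since \<alpha> is (\<alpha> \<bullet> \<alpha>) / 2 times its coroot, these numbers are
  the coordinates of x in the simple coroots.\<close>

lemma coroot_lattice_iff:
  "x \<in> coroot_lattice S \<longleftrightarrow> (\<forall>\<alpha>\<in>S. (x \<bullet> cowt \<alpha>) * (\<alpha> \<bullet> \<alpha>) / 2 \<in> \<int>)"
proof
  assume "x \<in> coroot_lattice S"
  then obtain n :: "'a \<Rightarrow> int" where "x = (\<Sum>\<alpha>\<in>S. of_int (n \<alpha>) *\<^sub>R coroot \<alpha>)"
    by (auto simp: coroot_lattice_def)
  then have x: "x = (\<Sum>\<alpha>\<in>S. (of_int (n \<alpha>) * (2 / (\<alpha> \<bullet> \<alpha>))) *\<^sub>R \<alpha>)"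
    by (simp add: coroot_def)
  show "\<forall>\<alpha>\<in>S. (x \<bullet> cowt \<alpha>) * (\<alpha> \<bullet> \<alpha>) / 2 \<in> \<int>"
    unfolding x using root_nonzero S_subset by (auto simp: sum_inner_cowt)
next
  assume "\<forall>\<alpha>\<in>S. (x \<bullet> cowt \<alpha>) * (\<alpha> \<bullet> \<alpha>) / 2 \<in> \<int>"
  then have "\<forall>\<alpha>\<in>S. \<exists>n :: int. (x \<bullet> cowt \<alpha>) * (\<alpha> \<bullet> \<alpha>) / 2 = of_int n"
    by (metis Ints_cases)
  then obtain n :: "'a \<Rightarrow> int" where n: "\<forall>\<alpha>\<in>S. (x \<bullet> cowt \<alpha>) * (\<alpha> \<bullet> \<alpha>) / 2 = of_int (n \<alpha>)"
    by metis
  have "x = (\<Sum>\<alpha>\<in>S. (x \<bullet> cowt \<alpha>) *\<^sub>R \<alpha>)"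
    by (simp add: basis_expansion)
  also have "\<dots> = (\<Sum>\<alpha>\<in>S. of_int (n \<alpha>) *\<^sub>R coroot \<alpha>)"
  proof (rule sum.cong [OF refl])
    fix \<alpha> assume \<alpha>: "\<alpha> \<in> S"
    then have "\<alpha> \<noteq> 0" using S_subset root_nonzero by blast
    then show "(x \<bullet> cowt \<alpha>) *\<^sub>R \<alpha> = of_int (n \<alpha>) *\<^sub>R coroot \<alpha>"
      by (simp add: coroot_def flip: bspec [OF n \<alpha>])
  qed
  finally show "x \<in> coroot_lattice S"
    unfolding coroot_lattice_def by blast
qed

lemma coroot_lattice_add: "x \<in> coroot_lattice S \<Longrightarrow> y \<in> coroot_lattice S \<Longrightarrow> x + y \<in> coroot_lattice S"
  by (auto simp: coroot_lattice_iff inner_left_distrib distrib_right add_divide_distrib)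

lemma coroot_lattice_scale: "x \<in> coroot_lattice S \<Longrightarrow> k \<in> \<int> \<Longrightarrow> k *\<^sub>R x \<in> coroot_lattice S"
proof -
  assume x: "x \<in> coroot_lattice S" "k \<in> \<int>"
  have "((k *\<^sub>R x) \<bullet> cowt \<alpha>) * (\<alpha> \<bullet> \<alpha>) / 2 = k * ((x \<bullet> cowt \<alpha>) * (\<alpha> \<bullet> \<alpha>) / 2)" for \<alpha>
    by simp
  then show ?thesis
    using x unfolding coroot_lattice_iff by (metis Ints_mult)
qed

lemma coroot_lattice_uminus: "x \<in> coroot_lattice S \<Longrightarrow> - x \<in> coroot_lattice S"
  using coroot_lattice_scale [of x "-1"] by simp

lemma coroot_lattice_diff: "x \<in> coroot_lattice S \<Longrightarrow> y \<in> coroot_lattice S \<Longrightarrow> x - y \<in> coroot_lattice S"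
  using coroot_lattice_add [of x "- y"] coroot_lattice_uminus by simp

lemma coroot_root_Ints: "\<alpha> \<in> \<Delta> \<Longrightarrow> \<beta> \<in> \<Delta> \<Longrightarrow> coroot \<alpha> \<bullet> \<beta> \<in> \<int>"
  using cartan_integer [of \<alpha> \<beta>] by (simp add: coroot_def inner_commute)

lemma coroot_lattice_root_Ints: "q \<in> coroot_lattice S \<Longrightarrow> \<beta> \<in> \<Delta> \<Longrightarrow> q \<bullet> \<beta> \<in> \<int>"
  using S_subset
  by (auto simp: coroot_lattice_def inner_sum_left intro!: Ints_sum Ints_mult coroot_root_Ints)

lemma coroot_lattice_subset: "coroot_lattice S \<subseteq> coweight_lattice S"
  using coroot_lattice_root_Ints S_subset by (auto simp: coweight_lattice_def)

lemma coroot_simple: "\<alpha> \<in> S \<Longrightarrow> coroot \<alpha> \<in> coroot_lattice S"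
proof -
  assume \<alpha>: "\<alpha> \<in> S"
  then have "\<alpha> \<noteq> 0" using S_subset root_nonzero by blast
  have "coroot \<alpha> \<bullet> cowt \<beta> * (\<beta> \<bullet> \<beta>) / 2 = (if \<alpha> = \<beta> then 1 else 0)" if "\<beta> \<in> S" for \<beta>
    using \<alpha> that \<open>\<alpha> \<noteq> 0\<close> by (simp add: coroot_def cowt_inner inner_commute [of \<alpha> "cowt \<beta>"])
  then show ?thesis by (simp add: coroot_lattice_iff)
qed

text \<open>Descent in the height at level 0: a simple reflection changes a coroot by an integral
  multiple of a simple coroot. Negative roots follow by sign.\<close>

lemma coroot_in_coroot_lattice:
  assumes "\<beta> \<in> \<Delta>" shows "coroot \<beta> \<in> coroot_lattice S"
proof -
  have pos: "coroot \<beta> \<in> coroot_lattice S" if "\<beta> \<in> \<Delta>" "affine_pos (\<beta>, 0)" "height (\<beta>, 0) = real n" for \<beta> n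
    using that
  proof (induction n arbitrary: \<beta> rule: less_induct)
    case (less n)
    let ?a = "(\<beta>, 0 :: real)"
    have a: "?a \<in> affine_roots" using less.prems by (simp add: affine_roots_def)
    show ?case
    proof (cases "\<beta> \<in> S")
      case True then show ?thesis by (rule coroot_simple)
    next
      case False
      obtain b where b: "b \<in> affine_simple" "\<beta> \<bullet> fst b > 0" "snd b = 0"
        using ex_simple_acute [OF a less.prems(2)] by auto
      then obtain \<gamma> where \<gamma>: "\<gamma> \<in> S" "b = (\<gamma>, 0)"
        by (auto simp: affine_simple_def)
      then have "\<gamma> \<in> \<Delta>" "\<gamma> \<noteq> 0" using S_subset root_nonzero by auto
      have refl: "affine_refl b ?a = (reflection \<gamma> \<beta>, 0)"
        by (simp add: affine_refl_def \<gamma> reflection_def)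
      have pos: "affine_pos (reflection \<gamma> \<beta>, 0)"
        using affine_refl_pos [OF b(1) a less.prems(2)] \<gamma> False refl by auto
      have root: "reflection \<gamma> \<beta> \<in> \<Delta>"
        using \<open>\<gamma> \<in> \<Delta>\<close> less.prems by (simp add: reflection_root)
      obtain n' where n': "height (reflection \<gamma> \<beta>, 0) = real n'"
        using height_Nats [OF _ pos] root by (auto simp: affine_roots_def elim: Nats_cases)
      have "height (affine_refl b ?a) = height ?a - 2 * (\<beta> \<bullet> \<gamma>) / (\<gamma> \<bullet> \<gamma>)"
        unfolding affine_refl_def height_refl height_simple [OF b(1)] by (simp add: \<gamma>)
      then have "height (affine_refl b ?a) < height ?a"
        using b(2) \<gamma> \<open>\<gamma> \<noteq> 0\<close> by simp
      then have "n' < n" using n' less.prems(3) refl by simp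
      then have IH: "coroot (reflection \<gamma> \<beta>) \<in> coroot_lattice S"
        using less.IH [OF _ root pos n'] by blast
      have "coroot \<beta> = reflection \<gamma> (coroot (reflection \<gamma> \<beta>))"
        using coroot_reflection [OF \<open>\<gamma> \<noteq> 0\<close>, of "reflection \<gamma> \<beta>"] reflection_involution [OF \<open>\<gamma> \<noteq> 0\<close>]
        by simp
      also have "\<dots> \<in> coroot_lattice S"
        unfolding reflection_coroot [of \<gamma> "coroot _"]
        using IH coroot_simple [OF \<gamma>(1)] coroot_root_Ints [OF root \<open>\<gamma> \<in> \<Delta>\<close>]
        by (intro coroot_lattice_diff coroot_lattice_scale)
      finally show ?thesis .
    qed
  qed
  have a: "(\<beta>, 0) \<in> affine_roots" using assms by (simp add: affine_roots_def)
  show ?thesis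
  proof (cases "affine_pos (\<beta>, 0)")
    case True
    then obtain n where "height (\<beta>, 0) = real n"
      using height_Nats [OF a] by (auto elim: Nats_cases)
    then show ?thesis using pos assms True by blast
  next
    case False
    then have neg: "affine_pos (- \<beta>, 0)"
      using affine_pos_or_neg [OF a] by simp
    then obtain n where "height (- \<beta>, 0) = real n"
      using height_Nats [of "(- \<beta>, 0)"] uminus_affine_root [OF a] by (auto elim: Nats_cases)
    then have "- coroot \<beta> \<in> coroot_lattice S"
      using pos [of "- \<beta>"] uminus_root [OF assms] neg by (simp add: coroot_uminus)
    then show ?thesis using coroot_lattice_uminus [of "- coroot \<beta>"] by simp
  qed
qed

lemma weyl_compose: "w \<in> weyl_group \<Delta> \<Longrightarrow> w' \<in> weyl_group \<Delta> \<Longrightarrow> w \<circ> w' \<in> weyl_group \<Delta>"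
  by (induction rule: weyl_group.induct) (auto simp: comp_assoc intro: weyl_group.intros)

lemma weyl_reflection: "\<alpha> \<in> \<Delta> \<Longrightarrow> reflection \<alpha> \<in> weyl_group \<Delta>"
  using weyl_group.reflect [OF _ weyl_group.id] by simp

lemma weyl_inverse:
  "w \<in> weyl_group \<Delta> \<Longrightarrow> \<exists>w'\<in>weyl_group \<Delta>. w' \<circ> w = id \<and> w \<circ> w' = id"
proof (induction rule: weyl_group.induct)
  case id then show ?case using weyl_group.id by (intro bexI [of _ id]) auto
next
  case (reflect \<alpha> w)
  then obtain w' where w': "w' \<in> weyl_group \<Delta>" "w' \<circ> w = id" "w \<circ> w' = id" by blast
  have "w' \<circ> reflection \<alpha> \<in> weyl_group \<Delta>"
    using w' reflect by (intro weyl_compose weyl_reflection)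
  moreover have "(w' \<circ> reflection \<alpha>) \<circ> (reflection \<alpha> \<circ> w) = id"
    "(reflection \<alpha> \<circ> w) \<circ> (w' \<circ> reflection \<alpha>) = id"
    using w'(2,3) reflection_involution [OF root_nonzero [OF reflect(1)]] by (simp_all add: fun_eq_iff)
  ultimately show ?case by blast
qed

lemma weyl_linear: "w \<in> weyl_group \<Delta> \<Longrightarrow> linear w"
proof (induction rule: weyl_group.induct)
  case id show ?case by (rule linear_id)
next
  case (reflect \<alpha> w) then show ?case by (intro linear_compose linear_reflection)
qed

lemma weyl_isometry: "w \<in> weyl_group \<Delta> \<Longrightarrow> w x \<bullet> w y = x \<bullet> y"
  by (induction rule: weyl_group.induct) (auto simp: reflection_isometry root_nonzero)

lemma weyl_root: "w \<in> weyl_group \<Delta> \<Longrightarrow> \<beta> \<in> \<Delta> \<Longrightarrow> w \<beta> \<in> \<Delta>"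
  by (induction rule: weyl_group.induct) (auto simp: reflection_root)

lemma weyl_coroot_lattice: "w \<in> weyl_group \<Delta> \<Longrightarrow> q \<in> coroot_lattice S \<Longrightarrow> w q \<in> coroot_lattice S"
  by (induction rule: weyl_group.induct)
    (auto simp: reflection_coroot intro!: coroot_lattice_diff coroot_lattice_scale
      coroot_lattice_root_Ints coroot_in_coroot_lattice)

lemma weyl_coweight_lattice: "w \<in> weyl_group \<Delta> \<Longrightarrow> z \<in> coweight_lattice S \<Longrightarrow> w z \<in> coweight_lattice S"
  by (induction rule: weyl_group.induct)
    (auto simp: reflection_coroot intro!: coweight_lattice_diff coweight_lattice_scale_Ints
      coweight_root_Ints intro: coroot_in_coroot_lattice subsetD [OF coroot_lattice_subset])

text \<open>A linear map is determined by its restriction to the spanning set \<Delta>, which W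
  permutes.\<close>

lemma finite_weyl_group: "finite (weyl_group \<Delta>)"
proof (rule inj_on_finite)
  show "(\<lambda>w. restrict w \<Delta>) ` weyl_group \<Delta> \<subseteq> \<Delta> \<rightarrow>\<^sub>E \<Delta>"
    using weyl_root by auto
  show "inj_on (\<lambda>w. restrict w \<Delta>) (weyl_group \<Delta>)"
  proof (rule inj_onI)
    fix w w' assume w: "w \<in> weyl_group \<Delta>" "w' \<in> weyl_group \<Delta>" and eq: "restrict w \<Delta> = restrict w' \<Delta>"
    have "w \<beta> = w' \<beta>" if "\<beta> \<in> \<Delta>" for \<beta>
      using fun_cong [OF eq, of \<beta>] that by simp
    then have "w x = w' x" for x
      using linear_eq_on [OF weyl_linear [OF w(1)] weyl_linear [OF w(2)], of x \<Delta>] span_\<Delta> by simp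
    then show "w = w'" by auto
  qed
  show "finite (\<Delta> \<rightarrow>\<^sub>E \<Delta>)"
    using finite_\<Delta> by (simp add: finite_PiE)
qed

end

section \<open>The affine Weyl group on points\<close>

context root_system
begin

definition affine_value :: "real \<Rightarrow> 'a \<Rightarrow> 'a \<times> real \<Rightarrow> real" where
  "affine_value t x a = x \<bullet> fst a + t * snd a"

text \<open>The reflection in the hyperplane where the affine function b, at parameter t, vanishes;
  \<open>affine_refl\<close> is the matching action on functions
  (\<open>affine_value_refl\<close>).\<close>

definition point_refl :: "real \<Rightarrow> 'a \<times> real \<Rightarrow> 'a \<Rightarrow> 'a" where
  "point_refl t b x = x - affine_value t x b *\<^sub>R coroot (fst b)"

primrec point_word :: "real \<Rightarrow> ('a \<times> real) list \<Rightarrow> 'a \<Rightarrow> 'a" where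
  "point_word t [] x = x"
| "point_word t (b # bs) x = point_refl t b (point_word t bs x)"

definition open_alcove :: "real \<Rightarrow> 'a set" where
  "open_alcove t = {x. \<forall>b\<in>affine_simple. affine_value t x b > 0}"

text \<open>The affine Weyl group of the dilated alcove, generated by its walls; it is shown below
  to contain W and the translations by t Q^v.\<close>

definition point_group :: "real \<Rightarrow> ('a \<Rightarrow> 'a) set" where
  "point_group t = {point_word t bs | bs. set bs \<subseteq> affine_simple}"

lemma affine_value_uminus: "affine_value t x (- a) = - affine_value t x a"
  by (simp add: affine_value_def)

text \<open>With v the value of b at x, the corrections are - \<kappa> v, - \<kappa> v and 2
  \<kappa> v, since b pairs to 2 with its coroot; they cancel.\<close>

lemma affine_value_refl:
  assumes "fst b \<noteq> 0"
  shows "affine_value t (point_refl t b x) (affine_refl b a) = affine_value t x a"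
proof -
  let ?v = "affine_value t x b"
  define \<kappa> where "\<kappa> = 2 * (fst a \<bullet> fst b) / (fst b \<bullet> fst b)"
  have \<kappa>: "coroot (fst b) \<bullet> fst a = \<kappa>"
    by (simp add: coroot_def inner_commute \<kappa>_def)
  have "affine_value t (point_refl t b x) (affine_refl b a) =
      (x - ?v *\<^sub>R coroot (fst b)) \<bullet> (fst a - \<kappa> *\<^sub>R fst b) + t * (snd a - \<kappa> * snd b)"
    by (simp add: affine_value_def point_refl_def affine_refl_def \<kappa>_def)
  also have "\<dots> = affine_value t x a - \<kappa> * ?v - ?v * (coroot (fst b) \<bullet> fst a)
      + ?v * \<kappa> * (coroot (fst b) \<bullet> fst b)"
    by (simp add: affine_value_def inner_diff_left inner_diff_right algebra_simps)
  also have "\<dots> = affine_value t x a"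
    unfolding \<kappa> coroot_inner_self [OF assms] by simp
  finally show ?thesis .
qed

lemma affine_value_word:
  "set bs \<subseteq> affine_simple \<Longrightarrow> affine_value t (point_word t bs x) (word bs a) = affine_value t x a"
  by (induction bs) (simp_all add: affine_value_refl simple_fst_nonzero)

lemma affine_value_eqI: "(\<And>a. affine_value t x a = affine_value t y a) \<Longrightarrow> x = y"
proof (rule eqI_inner)
  fix \<alpha> assume "\<And>a. affine_value t x a = affine_value t y a"
  from this [of "(\<alpha>, 0)"] show "x \<bullet> \<alpha> = y \<bullet> \<alpha>"
    by (simp add: affine_value_def)
qed

lemma point_refl_involution: "fst b \<noteq> 0 \<Longrightarrow> point_refl t b (point_refl t b x) = x"
  by (simp add: point_refl_def affine_value_def inner_diff_left coroot_inner_self algebra_simps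
     flip: scaleR_add_left)

lemma point_refl_uminus: "point_refl t (- b) = point_refl t b"
  by (simp add: fun_eq_iff point_refl_def affine_value_uminus coroot_uminus)

lemma point_word_append: "point_word t (bs @ bs') x = point_word t bs (point_word t bs' x)"
  by (induction bs) simp_all

lemma point_word_rev:
  "set bs \<subseteq> affine_simple \<Longrightarrow> point_word t bs (point_word t (rev bs) x) = x"
  by (induction bs arbitrary: x)
    (simp_all add: point_word_append point_refl_involution simple_fst_nonzero)

lemma open_alcove_iff: "x \<in> open_alcove t \<longleftrightarrow> (\<forall>\<alpha>\<in>S. x \<bullet> \<alpha> > 0) \<and> x \<bullet> \<theta> < t"
  by (auto simp: open_alcove_def affine_simple_def affine_value_def)

text \<open>The value is a combination of the positive wall values with the nonnegative coefficients
  of a. It could only fail to be positive if all coefficients vanished, which is impossible for a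
  root.\<close>

lemma affine_value_pos:
  assumes x: "x \<in> open_alcove t" and a: "a \<in> affine_roots" "affine_pos a"
  shows "affine_value t x a > 0"
proof (rule ccontr)
  assume neg: "\<not> affine_value t x a > 0"
  have val: "affine_value t x a = snd a * (t - x \<bullet> \<theta>) + (\<Sum>\<alpha>\<in>S. affine_coordinate \<alpha> a * (x \<bullet> \<alpha>))"
    unfolding affine_value_def
    by (subst fst_affine_expansion [of a]) (simp add: inner_diff_right inner_sum_right algebra_simps)
  have t: "t - x \<bullet> \<theta> > 0" and S: "\<And>\<alpha>. \<alpha> \<in> S \<Longrightarrow> x \<bullet> \<alpha> > 0"
    using x by (auto simp: open_alcove_iff)
  have nonneg: "affine_coordinate \<alpha> a * (x \<bullet> \<alpha>) \<ge> 0" if "\<alpha> \<in> S" for \<alpha>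
    using a(2) S [OF that] that by (simp add: affine_pos_def)
  have k: "snd a * (t - x \<bullet> \<theta>) \<ge> 0"
    using a(2) t by (simp add: affine_pos_def)
  have sum: "(\<Sum>\<alpha>\<in>S. affine_coordinate \<alpha> a * (x \<bullet> \<alpha>)) \<ge> 0"
    using nonneg by (rule sum_nonneg)
  have "snd a * (t - x \<bullet> \<theta>) = 0" and "(\<Sum>\<alpha>\<in>S. affine_coordinate \<alpha> a * (x \<bullet> \<alpha>)) = 0"
    using neg k sum val by linarith+
  then have "snd a = 0" and "\<forall>\<alpha>\<in>S. affine_coordinate \<alpha> a * (x \<bullet> \<alpha>) = 0"
    using t nonneg by (simp_all add: sum_nonneg_eq_0_iff)
  then have "snd a = 0" and "\<forall>\<alpha>\<in>S. affine_coordinate \<alpha> a = 0"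
    using S by force+
  then have "affine_pos (- a)"
    by (simp add: affine_pos_def affine_coordinate_def)
  then show False using affine_not_pos_neg [OF a] by simp
qed

text \<open>Freeness. For each wall b, the affine root \<open>word bs b\<close> takes at the image
  point the value of b at x, which is positive. As the image point lies in the alcove too, the word
  keeps all simple affine roots positive, and \<open>word_eq_id\<close> applies.\<close>

lemma point_word_fixes:
  assumes bs: "set bs \<subseteq> affine_simple" and x: "x \<in> open_alcove t" "point_word t bs x \<in> open_alcove t"
  shows "point_word t bs y = y"
proof (rule affine_value_eqI)
  fix a
  have "affine_pos (word bs b)" if b: "b \<in> affine_simple" for b
  proof (rule ccontr)
    assume neg: "\<not> affine_pos (word bs b)"
    have root: "word bs b \<in> affine_roots"
      using bs b affine_simple_roots by (intro word_root) auto
    then have "affine_pos (- word bs b)"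
      using neg affine_pos_or_neg by blast
    then have "affine_value t (point_word t bs x) (- word bs b) > 0"
      using affine_value_pos [OF x(2)] uminus_affine_root [OF root] by blast
    then have "affine_value t x b < 0"
      by (simp add: affine_value_uminus affine_value_word [OF bs])
    then show False using x(1) b by (force simp: open_alcove_def)
  qed
  then have "word bs a = a"
    using bs by (intro word_eq_id)
  then show "affine_value t (point_word t bs y) a = affine_value t y a"
    using affine_value_word [OF bs, of t y a] by simp
qed

lemma point_group_compose: "g \<in> point_group t \<Longrightarrow> h \<in> point_group t \<Longrightarrow> g \<circ> h \<in> point_group t"
proof -
  assume "g \<in> point_group t" "h \<in> point_group t"
  then obtain bs bs' where "set bs \<subseteq> affine_simple" "set bs' \<subseteq> affine_simple"
    "g = point_word t bs" "h = point_word t bs'"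
    by (auto simp: point_group_def)
  moreover from this have "g \<circ> h = point_word t (bs @ bs')"
    by (simp add: fun_eq_iff point_word_append)
  ultimately show ?thesis
    unfolding point_group_def by (intro CollectI exI [of _ "bs @ bs'"]) simp
qed

lemma point_group_inverse: "g \<in> point_group t \<Longrightarrow> \<exists>h\<in>point_group t. h \<circ> g = id \<and> g \<circ> h = id"
proof -
  assume "g \<in> point_group t"
  then obtain bs where bs: "set bs \<subseteq> affine_simple" "g = point_word t bs"
    by (auto simp: point_group_def)
  moreover have "point_word t (rev bs) \<in> point_group t"
    using bs unfolding point_group_def by (intro CollectI exI [of _ "rev bs"]) simp
  ultimately show ?thesis
    using point_word_rev [of bs t] point_word_rev [of "rev bs" t]
    by (intro bexI [of _ "point_word t (rev bs)"]) (auto simp: fun_eq_iff)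
qed

lemma id_in_point_group: "id \<in> point_group t"
  unfolding point_group_def by (intro CollectI exI [of _ "[]"]) (simp add: fun_eq_iff)

text \<open>Conjugation of a wall reflection, checked by evaluating affine functions, which separate
  points.\<close>

lemma point_refl_word:
  assumes bs: "set bs \<subseteq> affine_simple" and b: "b \<in> affine_simple"
  shows "point_refl t (word bs b) (point_word t bs x) = point_word t bs (point_refl t b x)"
proof (rule affine_value_eqI)
  fix a
  define a' where "a' = affine_refl b (word (rev bs) a)"
  have "word bs b \<in> affine_roots"
    using bs b affine_simple_roots by (intro word_root) auto
  then have nz: "fst (word bs b) \<noteq> 0"
    using fst_affine_root root_nonzero by blast
  have a: "a = word bs (affine_refl b a')"
    by (simp add: a'_def affine_refl_involution simple_fst_nonzero b word_rev bs)
  have "affine_value t (point_refl t (word bs b) (point_word t bs x)) a = affine_value t x a'"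
    unfolding a word_refl [OF bs] by (simp add: affine_value_refl nz affine_value_word bs)
  also have "\<dots> = affine_value t (point_word t bs (point_refl t b x)) a"
    unfolding a by (simp add: affine_value_refl simple_fst_nonzero b affine_value_word bs)
  finally show "affine_value t (point_refl t (word bs b) (point_word t bs x)) a =
      affine_value t (point_word t bs (point_refl t b x)) a" .
qed

text \<open>Up to sign every affine root is the image of a wall, so its reflection is a conjugate of
  a wall reflection.\<close>

lemma point_refl_in_point_group:
  assumes "a \<in> affine_roots" shows "point_refl t a \<in> point_group t"
proof -
  have pos: "point_refl t a \<in> point_group t" if a: "a \<in> affine_roots" "affine_pos a" for a
  proof -
    obtain bs b where bs: "set bs \<subseteq> affine_simple" "b \<in> affine_simple" "a = word bs b"
      using affine_root_conjugate_simple [OF a] by blast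
    have "point_refl t a x = point_word t (bs @ [b] @ rev bs) x" for x
      using point_refl_word [OF bs(1,2), of t "point_word t (rev bs) x"] bs(3)
      by (simp add: point_word_append point_word_rev bs(1))
    then have "point_refl t a = point_word t (bs @ [b] @ rev bs)"
      by (rule ext)
    then show ?thesis
      using bs unfolding point_group_def by (intro CollectI exI [of _ "bs @ [b] @ rev bs"]) auto
  qed
  show ?thesis
  proof (cases "affine_pos a")
    case False
    then show ?thesis
      using affine_pos_or_neg [OF assms] pos [OF uminus_affine_root [OF assms]] point_refl_uminus by simp
  qed (simp add: pos assms)
qed

lemma weyl_in_point_group: "w \<in> weyl_group \<Delta> \<Longrightarrow> w \<in> point_group t"
proof (induction rule: weyl_group.induct)
  case id show ?case by (rule id_in_point_group)
next
  case (reflect \<alpha> w)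
  have "reflection \<alpha> = point_refl t (\<alpha>, 0)"
    by (simp add: fun_eq_iff reflection_coroot point_refl_def affine_value_def)
  then have "reflection \<alpha> \<in> point_group t"
    using reflect(1) by (simp add: point_refl_in_point_group affine_roots_def)
  then show ?case using reflect by (intro point_group_compose)
qed

text \<open>Reflections in the parallel hyperplanes x \<bullet> \<alpha> = 0 and then x \<bullet>
  \<alpha> = t compose to the translation by t times the coroot of \<alpha>; for simple \<alpha>
  these generate t Q^v.\<close>

lemma translation_in_point_group:
  assumes "q \<in> coroot_lattice S" shows "(\<lambda>x. x + t *\<^sub>R q) \<in> point_group t"
proof -
  define T where "T = {q. (\<lambda>x. x + t *\<^sub>R q) \<in> point_group t}"
  have zero: "0 \<in> T"
    using id_in_point_group by (simp add: T_def id_def)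
  have add: "p + q \<in> T" if "p \<in> T" "q \<in> T" for p q
    using point_group_compose [of "\<lambda>x. x + t *\<^sub>R p" t "\<lambda>x. x + t *\<^sub>R q"] that
    by (simp add: T_def o_def algebra_simps)
  have uminus: "- q \<in> T" if q: "q \<in> T" for q
  proof -
    obtain h where h: "h \<in> point_group t" "(\<lambda>x. x + t *\<^sub>R q) \<circ> h = id"
      using point_group_inverse [of "\<lambda>x. x + t *\<^sub>R q"] q by (auto simp: T_def)
    have "h x = x + t *\<^sub>R (- q)" for x
      using fun_cong [OF h(2), of x] by (simp add: algebra_simps)
    then have "h = (\<lambda>x. x + t *\<^sub>R (- q))" by (rule ext)
    then show ?thesis using h(1) by (simp add: T_def)
  qed
  have coroot: "coroot \<alpha> \<in> T" if \<alpha>: "\<alpha> \<in> S" for \<alpha>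
  proof -
    have "\<alpha> \<in> \<Delta>" using \<alpha> S_subset by blast
    then have "point_refl t (\<alpha>, -1) \<circ> point_refl t (\<alpha>, 0) \<in> point_group t"
      by (intro point_group_compose point_refl_in_point_group) (simp_all add: affine_roots_def)
    moreover have "point_refl t (\<alpha>, -1) \<circ> point_refl t (\<alpha>, 0) = (\<lambda>x. x + t *\<^sub>R coroot \<alpha>)"
      using root_nonzero [OF \<open>\<alpha> \<in> \<Delta>\<close>]
      by (simp add: fun_eq_iff point_refl_def affine_value_def inner_diff_left coroot_inner_self
         algebra_simps)
    ultimately show ?thesis by (simp add: T_def)
  qed
  have nat: "of_nat n *\<^sub>R q \<in> T" if "q \<in> T" for n q
    by (induction n) (use zero add [OF that] in \<open>simp_all add: scaleR_left_distrib\<close>)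
  have int: "of_int n *\<^sub>R q \<in> T" if "q \<in> T" for n q
    using nat [OF that] uminus [OF nat [OF that]] by (cases n rule: int_cases2) simp_all
  obtain n :: "'a \<Rightarrow> int" where n: "q = (\<Sum>\<alpha>\<in>S. of_int (n \<alpha>) *\<^sub>R coroot \<alpha>)"
    using assms by (auto simp: coroot_lattice_def)
  have "(\<Sum>\<alpha>\<in>A. of_int (n \<alpha>) *\<^sub>R coroot \<alpha>) \<in> T" if "A \<subseteq> S" for A
    using finite_subset [OF that finite_S] that
    by (induction A rule: finite_induct) (use zero add int coroot in auto)
  then have "q \<in> T" using n by simp
  then show ?thesis by (simp add: T_def)
qed

lemma affine_map_in_point_group:
  assumes "w \<in> weyl_group \<Delta>" "q \<in> coroot_lattice S"
  shows "(\<lambda>x. w x + t *\<^sub>R q) \<in> point_group t"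
  using point_group_compose [OF translation_in_point_group [OF assms(2)] weyl_in_point_group [OF assms(1)], of t]
  by (simp add: o_def)

text \<open>One map followed by the inverse of the other carries x to x' within the alcove, so it is
  the identity by freeness. Evaluation at 0 then separates the translations from the linear
  parts.\<close>

lemma affine_decomposition_unique:
  assumes w: "w \<in> weyl_group \<Delta>" "w' \<in> weyl_group \<Delta>" and q: "q \<in> coroot_lattice S" "q' \<in> coroot_lattice S"
    and x: "x \<in> open_alcove t" "x' \<in> open_alcove t" and eq: "w x + t *\<^sub>R q = w' x' + t *\<^sub>R q'"
    and t: "t \<noteq> 0"
  shows "w = w'" and "x = x'"
proof -
  let ?g = "\<lambda>x. w x + t *\<^sub>R q" and ?g' = "\<lambda>x. w' x + t *\<^sub>R q'"
  obtain h where h: "h \<in> point_group t" "h \<circ> ?g' = id" "?g' \<circ> h = id"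
    using point_group_inverse [OF affine_map_in_point_group [OF w(2) q(2)]] by blast
  have "h \<circ> ?g \<in> point_group t"
    using h(1) affine_map_in_point_group [OF w(1) q(1)] by (intro point_group_compose)
  then obtain bs where bs: "set bs \<subseteq> affine_simple" "h \<circ> ?g = point_word t bs"
    by (auto simp: point_group_def)
  have hx: "point_word t bs x = x'"
    using fun_cong [OF bs(2), of x] fun_cong [OF h(2), of x'] eq by simp
  then have fixed: "point_word t bs y = y" for y
    using point_word_fixes [OF bs(1) x(1)] x(2) by simp
  show "x = x'" using fixed [of x] hx by simp
  have gg': "?g y = ?g' y" for y
    using fun_cong [OF bs(2), of y] fun_cong [OF h(3), of "?g y"] fixed [of y] by simp
  have "q = q'"
    using gg' [of 0] t linear_0 [OF weyl_linear [OF w(1)]] linear_0 [OF weyl_linear [OF w(2)]] by simp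
  then show "w = w'" using gg' by (simp add: fun_eq_iff)
qed

section \<open>Reaching the alcove and counting orbits\<close>

text \<open>Secures a nearest orbit point; Cauchy-Schwarz bounds the integral coordinates.\<close>

lemma finite_coweight_ball: "finite {y \<in> coweight_lattice S. norm (y - a) \<le> r}"
proof -
  let ?A = "{y \<in> coweight_lattice S. norm (y - a) \<le> r}"
  define K where "K \<alpha> = \<lceil>(norm a + r) * norm \<alpha>\<rceil>" for \<alpha> :: 'a
  have "(\<lambda>z. \<lambda>\<alpha>\<in>S. \<lfloor>z \<bullet> \<alpha>\<rfloor>) ` ?A \<subseteq> (\<Pi>\<^sub>E \<alpha>\<in>S. {- K \<alpha>..K \<alpha>})"
  proof clarify
    fix y assume y: "y \<in> coweight_lattice S" "norm (y - a) \<le> r"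
    have "\<lfloor>y \<bullet> \<alpha>\<rfloor> \<in> {- K \<alpha>..K \<alpha>}" if \<alpha>: "\<alpha> \<in> S" for \<alpha>
    proof -
      have "norm y \<le> norm a + r"
        using norm_triangle_ineq2 [of y a] y(2) by linarith
      then have "norm y * norm \<alpha> \<le> (norm a + r) * norm \<alpha>"
        by (intro mult_right_mono) auto
      then have "\<bar>y \<bullet> \<alpha>\<bar> \<le> of_int (K \<alpha>)"
        using Cauchy_Schwarz_ineq2 [of y \<alpha>] unfolding K_def by linarith
      then have "\<bar>real_of_int \<lfloor>y \<bullet> \<alpha>\<rfloor>\<bar> \<le> of_int (K \<alpha>)"
        by (simp add: of_int_floor_inner [OF y(1) \<alpha>])
      then show ?thesis by simp linarith
    qed
    then show "(\<lambda>\<alpha>\<in>S. \<lfloor>y \<bullet> \<alpha>\<rfloor>) \<in> (\<Pi>\<^sub>E \<alpha>\<in>S. {- K \<alpha>..K \<alpha>})"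
      by auto
  qed
  moreover have "inj_on (\<lambda>z. \<lambda>\<alpha>\<in>S. \<lfloor>z \<bullet> \<alpha>\<rfloor>) ?A"
    using bij_betw_imp_inj_on [OF bij_betw_coordinates] by (rule inj_on_subset) auto
  ultimately show ?thesis
    using inj_on_finite finite_PiE [OF finite_S] by (metis (no_types, lifting) finite_atLeastAtMost_int)
qed

text \<open>The squared distance to a changes by 4 / (fst b \<bullet> fst b) times the product of
  the values of b at y and at a, which is negative when b separates them.\<close>

lemma point_refl_closer:
  assumes nz: "fst b \<noteq> 0" and y: "affine_value t y b < 0" and a: "affine_value t a b > 0"
  shows "norm (point_refl t b y - a) < norm (y - a)"
proof -
  let ?k = "affine_value t y b"
  have "(coroot (fst b)) \<bullet> (coroot (fst b)) = 4 / (fst b \<bullet> fst b)"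
    using nz by (simp add: coroot_def)
  moreover have "(y - a) \<bullet> coroot (fst b) = 2 / (fst b \<bullet> fst b) * (?k - affine_value t a b)"
    by (simp add: coroot_def affine_value_def inner_diff_left)
  moreover have "(point_refl t b y - a) \<bullet> (point_refl t b y - a) =
      (y - a) \<bullet> (y - a) - 2 * ?k * ((y - a) \<bullet> coroot (fst b)) + ?k * ?k * (coroot (fst b) \<bullet> coroot (fst b))"
    by (simp add: point_refl_def inner_diff_left inner_diff_right inner_commute algebra_simps)
  ultimately have "(point_refl t b y - a) \<bullet> (point_refl t b y - a) =
      (y - a) \<bullet> (y - a) - 2 * ?k * (2 / (fst b \<bullet> fst b) * (?k - affine_value t a b)) + ?k * ?k * (4 / (fst b \<bullet> fst b))"
    by (simp only:)
  also have "\<dots> = (y - a) \<bullet> (y - a) + 4 / (fst b \<bullet> fst b) * (?k * affine_value t a b)"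
    by (simp add: right_diff_distrib diff_divide_distrib)
  finally have "(point_refl t b y - a) \<bullet> (point_refl t b y - a) =
      (y - a) \<bullet> (y - a) + 4 / (fst b \<bullet> fst b) * (?k * affine_value t a b)" .
  moreover have "4 / (fst b \<bullet> fst b) * (?k * affine_value t a b) < 0"
    using nz y a by (intro mult_pos_neg mult_neg_pos) auto
  ultimately show ?thesis
    by (simp add: norm_lt)
qed

lemma ex_open_alcove_point: assumes "t > 0" shows "open_alcove t \<noteq> {}"
proof -
  \<comment> \<open>With h one more than the height of \<theta>, t / h times the sum of the
    fundamental coweights pairs with \<theta> to t (h - 1) / h.\<close>
  define h where "h = 1 + (\<Sum>\<alpha>\<in>S. real (c \<alpha>))"
  have "h > 0" by (simp add: h_def add_pos_nonneg sum_nonneg)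
  define a where "a = (\<Sum>\<alpha>\<in>S. (t / h) *\<^sub>R cowt \<alpha>)"
  have a: "a \<bullet> \<alpha> = t / h" if "\<alpha> \<in> S" for \<alpha>
    using that by (simp add: a_def sum_cowt_inner)
  have "a \<bullet> \<theta> = (\<Sum>\<alpha>\<in>S. real (c \<alpha>)) * (t / h)"
    unfolding inner_expansion [of a \<theta>] sum_distrib_right
    by (intro sum.cong) (simp_all add: a \<theta>_coordinate)
  also have "\<dots> < h * (t / h)"
    using \<open>h > 0\<close> assms by (intro mult_strict_right_mono) (simp_all add: h_def)
  finally have "a \<bullet> \<theta> < t" using \<open>h > 0\<close> by simp
  then have "a \<in> open_alcove t"
    using a assms \<open>h > 0\<close> by (simp add: open_alcove_iff)
  then show ?thesis by blast
qed

text \<open>An orbit point nearest to a fixed point of the alcove lies in the alcove, since a reflection in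
  a separating wall would decrease the distance.\<close>

lemma affine_decomposition_exists:
  fixes t :: nat
  assumes z: "z \<in> coweight_lattice S" and t: "t > 0"
    and regular: "\<And>\<alpha> k. \<alpha> \<in> \<Delta> \<Longrightarrow> z \<bullet> \<alpha> \<noteq> real t * of_int k"
  shows "\<exists>w\<in>weyl_group \<Delta>. \<exists>q\<in>coroot_lattice S. \<exists>x\<in>open_alcove t. z = w x + real t *\<^sub>R q"
proof -
  obtain a where a: "a \<in> open_alcove t"
    using ex_open_alcove_point [of t] t by auto
  \<comment> \<open>Members are described by how z is recovered from them, so the final point
    displays the required decomposition.\<close>
  define orb where "orb = {y. \<exists>w\<in>weyl_group \<Delta>. \<exists>q\<in>coroot_lattice S. z = w y + real t *\<^sub>R q}"
  have orb_lattice: "y \<in> coweight_lattice S" if "y \<in> orb" for y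
  proof -
    obtain w q where w: "w \<in> weyl_group \<Delta>" "q \<in> coroot_lattice S" "z = w y + real t *\<^sub>R q"
      using \<open>y \<in> orb\<close> by (auto simp: orb_def)
    obtain w' where w': "w' \<in> weyl_group \<Delta>" "w' \<circ> w = id"
      using weyl_inverse [OF w(1)] by blast
    have "y = w' (z - real t *\<^sub>R q)"
      using fun_cong [OF w'(2), of y] w(3) by simp
    also have "\<dots> \<in> coweight_lattice S"
      using w(2) coroot_lattice_subset z
      by (intro weyl_coweight_lattice [OF w'(1)] coweight_lattice_diff coweight_lattice_scale_Ints) auto
    finally show ?thesis .
  qed
  have "z = id z + real t *\<^sub>R 0" "(0 :: 'a) \<in> coroot_lattice S"
    by (simp_all add: coroot_lattice_iff)
  then have z_orb: "z \<in> orb"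
    unfolding orb_def using weyl_group.id by blast
  define N where "N = {y \<in> orb. norm (y - a) \<le> norm (z - a)}"
  have "finite N"
    using finite_subset [OF _ finite_coweight_ball [of a "norm (z - a)"], of N] orb_lattice
    by (auto simp: N_def)
  moreover have "z \<in> N" using z_orb by (simp add: N_def)
  ultimately obtain y where y: "y \<in> N" "\<And>y'. y' \<in> N \<Longrightarrow> norm (y - a) \<le> norm (y' - a)"
    using ex_min_if_finite [of "(\<lambda>y. norm (y - a)) ` N"] by (force simp: not_less)
  obtain w q where w: "w \<in> weyl_group \<Delta>" "q \<in> coroot_lattice S" "z = w y + real t *\<^sub>R q"
    using y(1) by (auto simp: N_def orb_def)
  have "affine_value t y b > 0" if b: "b \<in> affine_simple" for b
  proof (rule ccontr)
    assume neg: "\<not> affine_value t y b > 0"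
    have root: "fst b \<in> \<Delta>"
      using b affine_simple_roots fst_affine_root by blast
    obtain k :: int where k: "snd b = of_int k"
      using b affine_simple_roots by (auto simp: affine_roots_def elim!: Ints_cases)
    \<comment> \<open>A zero value would make z pair with the root w (fst b) to a multiple of t,
      which \<open>regular\<close> forbids.\<close>
    have "affine_value t y b \<noteq> 0"
    proof
      assume "affine_value t y b = 0"
      then have yb: "y \<bullet> fst b = - (real t * of_int k)"
        by (simp add: affine_value_def k)
      obtain l :: int where l: "q \<bullet> w (fst b) = of_int l"
        using coroot_lattice_root_Ints [OF w(2) weyl_root [OF w(1) root]] by (auto elim: Ints_cases)
      have "z \<bullet> w (fst b) = y \<bullet> fst b + real t * (q \<bullet> w (fst b))"
        by (simp add: w(3) inner_left_distrib weyl_isometry [OF w(1)])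
      also have "\<dots> = real t * of_int (l - k)"
        using yb l by (simp add: algebra_simps)
      finally show False
        using regular [OF weyl_root [OF w(1) root]] by blast
    qed
    then have neg: "affine_value t y b < 0" using neg by simp
    let ?y = "point_refl t b y"
    have closer: "norm (?y - a) < norm (y - a)"
      using a b neg by (intro point_refl_closer simple_fst_nonzero) (simp_all add: open_alcove_def)
    have "y = point_refl t b ?y"
      by (simp add: point_refl_involution simple_fst_nonzero b)
    also have "\<dots> = reflection (fst b) ?y - (real t * of_int k) *\<^sub>R coroot (fst b)"
      unfolding point_refl_def [of t b ?y]
      by (simp add: affine_value_def k reflection_coroot algebra_simps)
    finally have "z = w (reflection (fst b) ?y - (real t * of_int k) *\<^sub>R coroot (fst b)) + real t *\<^sub>R q"
      using w(3) by simp
    then have "z = (w \<circ> reflection (fst b)) ?y + real t *\<^sub>R (q - of_int k *\<^sub>R w (coroot (fst b)))"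
      by (simp add: linear_diff [OF weyl_linear [OF w(1)]] linear_scale [OF weyl_linear [OF w(1)]]
         algebra_simps)
    moreover have "w \<circ> reflection (fst b) \<in> weyl_group \<Delta>"
      using w(1) root by (intro weyl_compose weyl_reflection)
    moreover have "q - of_int k *\<^sub>R w (coroot (fst b)) \<in> coroot_lattice S"
      using w(2) weyl_coroot_lattice [OF w(1) coroot_in_coroot_lattice [OF root]]
      by (intro coroot_lattice_diff coroot_lattice_scale) auto
    ultimately have "?y \<in> orb" unfolding orb_def by blast
    moreover have "norm (y - a) \<le> norm (z - a)" using y(1) by (simp add: N_def)
    ultimately have "?y \<in> N" using closer by (simp add: N_def)
    then show False using y(2) closer by force
  qed
  then have "y \<in> open_alcove t" by (simp add: open_alcove_def)
  then show ?thesis using w by blast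
qed

lemma open_alcove_subset_fbox:
  assumes "x \<in> coweight_lattice S" "x \<in> open_alcove (real t)" shows "x \<in> fbox t"
proof -
  have "x \<bullet> \<alpha> < real t" if \<alpha>: "\<alpha> \<in> S" for \<alpha>
  proof -
    have pos: "\<And>\<beta>. \<beta> \<in> S \<Longrightarrow> x \<bullet> \<beta> > 0" using assms(2) by (simp add: open_alcove_iff)
    have "(x \<bullet> \<alpha>) * 1 \<le> (x \<bullet> \<alpha>) * (\<theta> \<bullet> cowt \<alpha>)"
      using pos [OF \<alpha>] c_pos [OF \<alpha>] \<alpha> by (intro mult_left_mono) (simp_all add: \<theta>_coordinate)
    also have "\<dots> \<le> x \<bullet> \<theta>"
      unfolding inner_expansion [of x \<theta>] using pos \<alpha>
      by (intro member_le_sum) (simp_all add: \<theta>_coordinate less_imp_le)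
    also have "\<dots> < t" using assms(2) by (simp add: open_alcove_iff)
    finally show ?thesis by simp
  qed
  then show ?thesis using assms by (auto simp: fbox_def open_alcove_iff less_imp_le)
qed

text \<open>Writing w x = r + t p with r in the box, the pair (w, x) is sent to r and the class of p
  modulo Q^v. These determine w x up to t Q^v, so uniqueness of the decomposition gives injectivity.
  Given z and the class of u, decomposing z + t u gives a preimage.\<close>

theorem orbit_count:
  fixes t :: nat
  assumes t: "t > 0" and lattice: "Z \<subseteq> coweight_lattice S"
    and regular: "\<And>z \<alpha> k. z \<in> Z \<Longrightarrow> \<alpha> \<in> \<Delta> \<Longrightarrow> z \<bullet> \<alpha> \<noteq> real t * of_int k"
    and weyl: "\<And>z w. z \<in> Z \<Longrightarrow> w \<in> weyl_group \<Delta> \<Longrightarrow> w z \<in> Z"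
    and trans: "\<And>z p. z \<in> Z \<Longrightarrow> p \<in> coweight_lattice S \<Longrightarrow> z + real t *\<^sub>R p \<in> Z"
  shows "card (weyl_group \<Delta>) * card (Z \<inter> open_alcove t) =
      card (Z \<inter> fbox t) * subgroup_index (coweight_lattice S) (coroot_lattice S)"
    and "Z \<inter> open_alcove t \<noteq> {} \<Longrightarrow> subgroup_index (coweight_lattice S) (coroot_lattice S) > 0"
proof -
  let ?P = "coweight_lattice S" and ?Q = "coroot_lattice S"
  define E where "E = {(x, y). x \<in> ?P \<and> y \<in> ?P \<and> x - y \<in> ?Q}"
  have zeroQ: "0 \<in> ?Q" by (simp add: coroot_lattice_iff)
  have equiv: "equiv ?P E"
  proof (rule equivI)
    show "refl_on ?P E" using zeroQ by (auto simp: refl_on_def E_def)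
    show "E \<subseteq> ?P \<times> ?P" by (auto simp: E_def)
    show "sym E"
    proof (rule symI)
      fix x y assume "(x, y) \<in> E"
      then show "(y, x) \<in> E"
        using coroot_lattice_uminus [of "x - y"] by (simp add: E_def)
    qed
    show "Relation.trans E"
    proof (rule transI)
      fix x y z assume "(x, y) \<in> E" "(y, z) \<in> E"
      then show "(x, z) \<in> E"
        using coroot_lattice_add [of "x - y" "y - z"] by (simp add: E_def)
    qed
  qed
  have "\<forall>z\<in>?P. \<exists>r. r \<in> fbox t \<and> (\<exists>p\<in>?P. z = r + real t *\<^sub>R p)"
    using ex_box_representative [OF _ t] by blast
  then obtain r where "\<forall>z\<in>?P. r z \<in> fbox t \<and> (\<exists>p\<in>?P. z = r z + real t *\<^sub>R p)"
    by (rule bchoice [THEN exE])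
  then obtain p where rp: "\<And>z. z \<in> ?P \<Longrightarrow> r z \<in> fbox t"
    "\<And>z. z \<in> ?P \<Longrightarrow> p z \<in> ?P" "\<And>z. z \<in> ?P \<Longrightarrow> z = r z + real t *\<^sub>R p z"
    by (metis (no_types, lifting))
  define \<phi> where "\<phi> = (\<lambda>(w :: 'a \<Rightarrow> 'a, x). (r (w x), E `` {p (w x)}))"
  have rZ: "r z \<in> Z" if "z \<in> Z" for z
  proof -
    have "z \<in> ?P" using that lattice by blast
    have eq: "r z = z + real t *\<^sub>R (- p z)"
      using rp(3) [OF \<open>z \<in> ?P\<close>, symmetric] by (simp add: eq_diff_eq)
    have "- p z \<in> ?P"
      using coweight_lattice_scale_Ints [OF rp(2) [OF \<open>z \<in> ?P\<close>], of "-1"] by simp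
    then show ?thesis unfolding eq by (rule trans [OF that])
  qed
  have bij: "bij_betw \<phi> (weyl_group \<Delta> \<times> (Z \<inter> open_alcove t)) ((Z \<inter> fbox t) \<times> (?P // E))"
    unfolding bij_betw_def
  proof
    show "inj_on \<phi> (weyl_group \<Delta> \<times> (Z \<inter> open_alcove t))"
    proof (rule inj_onI, clarify)
      fix w x w' x'
      assume w: "w \<in> weyl_group \<Delta>" "w' \<in> weyl_group \<Delta>" and x: "x \<in> Z" "x \<in> open_alcove t"
        "x' \<in> Z" "x' \<in> open_alcove t" and eq: "\<phi> (w, x) = \<phi> (w', x')"
      have P: "w x \<in> ?P" "w' x' \<in> ?P" using w x weyl lattice by auto
      have "p (w x) - p (w' x') \<in> ?Q"
        using eq eq_equiv_class_iff [OF equiv rp(2) [OF P(1)] rp(2) [OF P(2)]]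
        by (simp add: \<phi>_def E_def)
      moreover have "w x + real t *\<^sub>R 0 = w' x' + real t *\<^sub>R (p (w x) - p (w' x'))"
      proof -
        have "w x - w' x' = (r (w x) + real t *\<^sub>R p (w x)) - (r (w' x') + real t *\<^sub>R p (w' x'))"
          using arg_cong2 [where f = minus, OF rp(3) [OF P(1)] rp(3) [OF P(2)]] .
        then show ?thesis using eq by (simp add: \<phi>_def algebra_simps)
      qed
      ultimately show "w = w' \<and> x = x'"
        using affine_decomposition_unique [OF w zeroQ _ x(2,4)] t by simp
    qed
    show "\<phi> ` (weyl_group \<Delta> \<times> (Z \<inter> open_alcove t)) = (Z \<inter> fbox t) \<times> (?P // E)"
    proof
      show "\<phi> ` (weyl_group \<Delta> \<times> (Z \<inter> open_alcove t)) \<subseteq> (Z \<inter> fbox t) \<times> (?P // E)"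
      proof (rule image_subsetI)
        fix y assume "y \<in> weyl_group \<Delta> \<times> (Z \<inter> open_alcove t)"
        then obtain w x where y: "y = (w, x)" and w: "w \<in> weyl_group \<Delta>" and x: "x \<in> Z"
          by blast
        have Z: "w x \<in> Z" using x w by (rule weyl)
        then have P: "w x \<in> ?P" using lattice by blast
        then show "\<phi> y \<in> (Z \<inter> fbox t) \<times> (?P // E)"
          using rZ [OF Z] rp(1,2) [OF P] by (simp add: \<phi>_def quotientI y)
      qed
      show "(Z \<inter> fbox t) \<times> (?P // E) \<subseteq> \<phi> ` (weyl_group \<Delta> \<times> (Z \<inter> open_alcove t))"
      proof clarify
        fix z C assume z: "z \<in> Z" "z \<in> fbox t" and "C \<in> ?P // E"
        then obtain u where u: "u \<in> ?P" "C = E `` {u}"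
          by (auto elim: quotientE)
        have zu: "z + real t *\<^sub>R u \<in> Z" using z u by (intro trans)
        then obtain w q x where w: "w \<in> weyl_group \<Delta>" "q \<in> ?Q" "x \<in> open_alcove t"
          "z + real t *\<^sub>R u = w x + real t *\<^sub>R q"
          using affine_decomposition_exists [of "z + real t *\<^sub>R u" t] lattice regular t by blast
        have qP: "q \<in> ?P" using w(2) coroot_lattice_subset by blast
        have wx: "w x = z + real t *\<^sub>R (u - q)"
          using w(4) by (simp add: algebra_simps)
        have uq: "u - q \<in> ?P" using u(1) qP by (rule coweight_lattice_diff)
        have wxZ: "w x \<in> Z" unfolding wx using z(1) uq by (rule trans)
        have wxP: "w x \<in> ?P" using wxZ lattice by blast
        obtain w' where w': "w' \<in> weyl_group \<Delta>" "w' \<circ> w = id"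
          using weyl_inverse [OF w(1)] by blast
        have "x = w' (w x)" using fun_cong [OF w'(2), of x] by simp
        then have xZ: "x \<in> Z" using weyl [OF wxZ w'(1)] by simp
        have "r (w x) + real t *\<^sub>R p (w x) = w x"
          by (rule rp(3) [OF wxP, symmetric])
        also note wx
        finally have rz: "r (w x) = z + real t *\<^sub>R (u - q - p (w x))"
          by (simp add: algebra_simps)
        then have r: "r (w x) = z"
          using box_representative_unique [OF rp(1) [OF wxP] z(2)] coweight_lattice_diff [OF uq rp(2) [OF wxP]]
          by blast
        then have "p (w x) = u - q" using rz t by simp
        then have "(p (w x), u) \<in> E"
          using uq u(1) coroot_lattice_uminus [OF w(2)] by (simp add: E_def)
        then have "E `` {p (w x)} = C"
          using equiv_class_eq [OF equiv] u(2) by blast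
        then have "(z, C) = \<phi> (w, x)" using r by (simp add: \<phi>_def)
        then show "(z, C) \<in> \<phi> ` (weyl_group \<Delta> \<times> (Z \<inter> open_alcove t))"
          using w(1,3) xZ by (intro image_eqI) auto
      qed
    qed
  qed
  have index: "subgroup_index ?P ?Q = card (?P // E)"
    by (simp add: subgroup_index_def E_def)
  show "card (weyl_group \<Delta>) * card (Z \<inter> open_alcove t) = card (Z \<inter> fbox t) * subgroup_index ?P ?Q"
    using bij_betw_same_card [OF bij] by (simp add: index card_cartesian_product)
  \<comment> \<open>\<open>card\<close> is 0 on infinite sets, so positivity includes finiteness of
    P^v / Q^v. It is read off from the bijection, whose domain is finite and nonempty.\<close>
  show "subgroup_index ?P ?Q > 0" if ne: "Z \<inter> open_alcove t \<noteq> {}"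
  proof -
    have "finite (Z \<inter> open_alcove t)"
      using open_alcove_subset_fbox lattice by (intro finite_subset [OF _ finite_fbox [of t]]) auto
    then have fin: "finite ((Z \<inter> fbox t) \<times> (?P // E))"
      using bij_betw_finite [OF bij] finite_weyl_group by simp
    have "(Z \<inter> fbox t) \<times> (?P // E) \<noteq> {}"
      using bij_betw_imp_surj_on [OF bij] ne weyl_group.id by blast
    then show ?thesis
      using fin by (auto simp: index card_gt_0_iff finite_cartesian_product_iff)
  qed
qed

end

section \<open>The finite field method and two root lengths\<close>

context lattice_basis
begin

definition avoiding_mod :: "nat \<Rightarrow> ('a \<times> int) set \<Rightarrow> 'a set" where
  "avoiding_mod q I = {z \<in> fbox q. \<forall>(r, k)\<in>I. \<forall>j :: int. z \<bullet> r \<noteq> of_int k + real q * of_int j}"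

text \<open>Inclusion-exclusion: after exchanging the sums, z contributes the alternating sum over
  the sets of equations it satisfies, which is 1 if it satisfies none and 0 otherwise.\<close>

lemma card_avoiding_mod:
  assumes "finite I"
  shows "int (card (avoiding_mod q I)) = (\<Sum>J\<in>Pow I. (-1) ^ card J * int (card (solutions_mod q J)))"
proof -
  define I' where "I' z = {i\<in>I. \<exists>j :: int. z \<bullet> fst i = of_int (snd i) + real q * of_int j}" for z
  have mem: "z \<in> solutions_mod q J \<longleftrightarrow> z \<in> fbox q \<and> J \<subseteq> I' z" if "J \<subseteq> I" for z J
    using that by (auto simp: solutions_mod_def I'_def)
  have "(\<Sum>J\<in>Pow I. (-1) ^ card J * int (card (solutions_mod q J))) =
      (\<Sum>J\<in>Pow I. \<Sum>z\<in>fbox q. if J \<subseteq> I' z then (-1) ^ card J else 0)"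
  proof (rule sum.cong [OF refl])
    fix J assume "J \<in> Pow I"
    then have "solutions_mod q J = {z\<in>fbox q. J \<subseteq> I' z}"
      using mem by auto
    then show "(-1) ^ card J * int (card (solutions_mod q J)) =
        (\<Sum>z\<in>fbox q. if J \<subseteq> I' z then (-1) ^ card J else 0)"
      using finite_fbox by (simp add: sum.If_cases Int_def mult.commute)
  qed
  also have "\<dots> = (\<Sum>z\<in>fbox q. \<Sum>J\<in>Pow I. if J \<subseteq> I' z then (-1) ^ card J else 0)"
    by (rule sum.swap)
  also have "\<dots> = (\<Sum>z\<in>fbox q. if I' z = {} then 1 else 0)"
  proof (rule sum.cong [OF refl])
    fix z
    have "(\<Sum>J\<in>Pow I. if J \<subseteq> I' z then (-1) ^ card J else 0 :: int) = (\<Sum>J\<in>Pow (I' z). (-1) ^ card J)"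
      using assms by (intro sum.mono_neutral_cong_right) (auto simp: I'_def)
    also have "\<dots> = (if I' z = {} then 1 else 0)"
      using assms by (intro sum_neg_one_power_card_Pow) (simp add: I'_def)
    finally show "(\<Sum>J\<in>Pow I. if J \<subseteq> I' z then (-1) ^ card J else 0 :: int) = (if I' z = {} then 1 else 0)" .
  qed
  also have "\<dots> = int (card {z\<in>fbox q. I' z = {}})"
    using finite_fbox by (simp add: sum.If_cases Int_def)
  also have "{z\<in>fbox q. I' z = {}} = avoiding_mod q I"
    by (auto simp: avoiding_mod_def I'_def)
  finally show ?thesis ..
qed

text \<open>The modulus \<open>q\<close> need not be prime: coprimality to one constant \<open>N\<close> suffices, so
  Dirichlet's theorem is not needed to find suitable \<open>q\<close> in an arithmetic progression.\<close>

theorem finite_field_method: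
  assumes fin: "finite I" and lat: "fst ` I \<subseteq> root_lattice" and nz: "0 \<notin> fst ` I"
  shows "\<exists>N>0. \<forall>q>1. coprime q N \<longrightarrow>
    poly (characteristic_polynomial ((\<lambda>(r, k). hyperplane r (of_int k)) ` I)) (int q) =
      int (card (avoiding_mod q I))"
proof -
  have "\<forall>J\<in>Pow I. \<exists>N>0. \<forall>q>1. coprime q N \<longrightarrow>
    card (solutions_mod q J) = (if solutions J = {} then 0 else q ^ nat (aff_dim (solutions J)))"
  proof
    fix J assume "J \<in> Pow I"
    then have "finite J" "fst ` J \<subseteq> root_lattice"
      using fin lat finite_subset by auto
    then show "\<exists>N>0. \<forall>q>1. coprime q N \<longrightarrow>
      card (solutions_mod q J) = (if solutions J = {} then 0 else q ^ nat (aff_dim (solutions J)))"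
      by (rule card_solutions_mod)
  qed
  then obtain N where N: "\<forall>J\<in>Pow I. N J > 0 \<and> (\<forall>q>1. coprime q (N J) \<longrightarrow>
    card (solutions_mod q J) = (if solutions J = {} then 0 else q ^ nat (aff_dim (solutions J))))"
    by (rule bchoice [THEN exE])
  have proper: "(\<lambda>(r, k). hyperplane r (of_int k)) i \<noteq> UNIV" if "i \<in> I" for i
  proof
    assume "(\<lambda>(r, k). hyperplane r (of_int k)) i = UNIV"
    then have "\<And>x. x \<bullet> fst i = of_int (snd i)"
      by (auto simp: hyperplane_def split_beta)
    from this [of 0] this [of "fst i"] have "fst i = 0" by simp
    then show False using nz that by force
  qed
  show ?thesis
  \<comment> \<open>One constant for all subfamilies: coprime to the product means coprime to each
    \<open>N J\<close>.\<close>
  proof (intro exI [of _ "\<Prod>J\<in>Pow I. N J"] conjI allI impI)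
    show "(\<Prod>J\<in>Pow I. N J) > 0" using N by (intro prod_pos) auto
    fix q :: nat assume q: "q > 1" "coprime q (\<Prod>J\<in>Pow I. N J)"
    have "int (card (solutions_mod q J)) =
        (if solutions J = {} then 0 else int q ^ nat (aff_dim (solutions J)))" if J: "J \<in> Pow I" for J
    proof -
      have "N J dvd (\<Prod>J\<in>Pow I. N J)" using fin J by (intro dvd_prodI) auto
      then have "coprime q (N J)" using q(2) coprime_divisors [OF dvd_refl] by blast
      then show ?thesis using N q(1) J by simp
    qed
    note card_J = this
    have "poly (characteristic_polynomial ((\<lambda>(r, k). hyperplane r (of_int k)) ` I)) (int q) =
        (\<Sum>J\<in>Pow I. (-1) ^ card J *
          (if solutions J = {} then 0 else int q ^ nat (aff_dim (solutions J))))"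
      unfolding solutions_def
      using poly_characteristic_polynomial_image [where h = "\<lambda>(r, k). hyperplane r (of_int k)", OF fin proper] .
    also have "\<dots> = int (card (avoiding_mod q I))"
      unfolding card_avoiding_mod [OF fin] by (intro sum.cong refl) (simp only: card_J)
    finally show "poly (characteristic_polynomial ((\<lambda>(r, k). hyperplane r (of_int k)) ` I)) (int q) =
      int (card (avoiding_mod q I))" .
  qed
qed

end

text \<open>Take u = J (1 + N k), J being the product of the primes that divide N but not t. A prime
  of N not dividing t divides J, hence M u. A prime of N dividing t divides neither M nor J nor 1 +
  N k, hence not M u. Either way it does not divide t + M u.\<close>

lemma infinite_coprime_in_progression:
  fixes t M N :: nat
  assumes "coprime t M" "N > 0"
  shows "infinite {u. coprime (t + M * u) N}"
proof -
  define A where "A = {p. prime p \<and> p dvd N \<and> \<not> p dvd t}"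
  have A: "finite A"
    using finite_divisors_nat [OF assms(2)] by (rule finite_subset [rotated]) (auto simp: A_def)
  define J where "J = \<Prod>A"
  have "J > 0" unfolding J_def by (intro prod_pos) (auto simp: A_def prime_gt_0_nat)
  have "coprime (t + M * (J * (1 + N * k))) N" for k
  proof (rule ccontr)
    assume "\<not> coprime (t + M * (J * (1 + N * k))) N"
    then obtain r where r: "prime r" "r dvd t + M * (J * (1 + N * k))" "r dvd N"
    proof -
      assume "\<not> coprime (t + M * (J * (1 + N * k))) N"
      then have "gcd (t + M * (J * (1 + N * k))) N \<noteq> 1" using coprime_iff_gcd_eq_1 by blast
      then obtain r where "prime r" "r dvd gcd (t + M * (J * (1 + N * k))) N"
        using prime_factor_nat by blast
      then show ?thesis using that [of r] by (simp only: gcd_greatest_iff)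
    qed
    show False
    proof (cases "r dvd t")
      case True
      then have "r dvd M * (J * (1 + N * k))"
        using r(2) by (simp add: dvd_add_right_iff)
      moreover have "\<not> r dvd M"
        using coprime_common_divisor [OF assms(1) True] r(1) by auto
      moreover have "\<not> r dvd J"
      proof
        assume "r dvd J"
        then obtain p where "p \<in> A" "r dvd p"
          using prime_dvd_prod_iff [OF A, of r "\<lambda>p. p"] r(1) by (auto simp: J_def)
        then have "r = p" using r(1) by (auto simp: A_def primes_dvd_imp_eq)
        then show False using True \<open>p \<in> A\<close> by (simp add: A_def)
      qed
      moreover have "\<not> r dvd 1 + N * k"
        using r(1) dvd_add_left_iff [of r "N * k" 1] dvd_mult2 [OF r(3), of k] by auto
      ultimately show False using r(1) prime_dvd_mult_nat by blast
    next
      case False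
      then have "r \<in> A" using r by (simp add: A_def)
      then have "r dvd J"
        unfolding J_def by (rule dvd_prodI [OF A])
      then have "r dvd M * (J * (1 + N * k))" by simp
      then show False using False r(2) by (simp add: dvd_add_left_iff)
    qed
  qed
  then have "range (\<lambda>k. J * (1 + N * k)) \<subseteq> {u. coprime (t + M * u) N}" by auto
  moreover have "inj (\<lambda>k. J * (1 + N * k))"
    using \<open>J > 0\<close> assms(2) by (auto simp: inj_def)
  ultimately show ?thesis
    using finite_subset range_inj_infinite by blast
qed

lemma Ints_ge_Suc: "(x :: real) \<in> \<int> \<Longrightarrow> x > real m \<Longrightarrow> x \<ge> real m + 1"
  by (auto elim!: Ints_cases) (metis int_less_real_le of_int_of_nat_eq of_int_less_iff)

text \<open>k \<le> m < x forces j \<ge> 1, and then k + t j is at least t - m.\<close>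

lemma not_cong_small:
  assumes "real m < x" "x < real t - real m" "\<bar>k\<bar> \<le> int m"
  shows "x \<noteq> of_int k + real t * of_int j"
proof
  assume eq: "x = of_int k + real t * of_int j"
  have k: "of_int k \<le> real m" "- real m \<le> of_int k" using assms(3) by linarith+
  have "0 < real t * of_int j" using eq k assms by linarith
  then have "j \<ge> 1" by (simp add: zero_less_mult_iff)
  then have "real t * 1 \<le> real t * of_int j" by (intro mult_left_mono) auto
  then show False using eq k assms by linarith
qed

section \<open>Root lengths and the highest root\<close>

locale two_length_root_system = root_system +
  assumes two_lengths: "two_root_lengths \<Delta>"
begin

definition long_length :: real where "long_length = Max (norm ` \<Delta>)"

lemma root_lengths:
  shows short_or_long: "\<beta> \<in> \<Delta> \<Longrightarrow> \<beta> \<in> short_roots \<Delta> \<or> \<beta> \<in> long_roots \<Delta>"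
    and short_less: "\<beta> \<in> short_roots \<Delta> \<Longrightarrow> norm \<beta> < long_length"
    and long_nonempty: "long_roots \<Delta> \<noteq> {}"
proof -
  obtain a b where ab: "norm ` \<Delta> = {a, b}" "a < b"
    using two_lengths unfolding two_root_lengths_def card_2_iff
    by (metis insert_commute linorder_neq_iff)
  then have "Min (norm ` \<Delta>) = a" "Max (norm ` \<Delta>) = b" by auto
  moreover have "norm \<beta> = a \<or> norm \<beta> = b" if "\<beta> \<in> \<Delta>" for \<beta>
    using ab(1) that by blast
  moreover have "b \<in> norm ` \<Delta>" using ab(1) by simp
  then obtain \<nu> where "\<nu> \<in> \<Delta>" "norm \<nu> = b" by auto
  ultimately show "\<beta> \<in> \<Delta> \<Longrightarrow> \<beta> \<in> short_roots \<Delta> \<or> \<beta> \<in> long_roots \<Delta>"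
    and "\<beta> \<in> short_roots \<Delta> \<Longrightarrow> norm \<beta> < long_length"
    and "long_roots \<Delta> \<noteq> {}"
    using ab(2) by (auto simp: short_roots_def long_roots_def long_length_def)
qed

lemma norm_reflection: "\<alpha> \<in> \<Delta> \<Longrightarrow> norm (reflection \<alpha> \<beta>) = norm \<beta>"
  using reflection_isometry [OF root_nonzero] by (simp add: norm_eq_sqrt_inner)

lemma inner_nonneg_if_dominant:
  assumes "\<And>\<alpha>. \<alpha> \<in> S \<Longrightarrow> x \<bullet> \<alpha> \<ge> 0" and "y \<in> nonneg_combinations S"
  shows "x \<bullet> y \<ge> 0"
  unfolding inner_expansion [of x y]
  using assms by (intro sum_nonneg mult_nonneg_nonneg) (auto simp: nonneg_combinations_iff elim!: Nats_cases)

text \<open>Were the pairing negative, reflecting in \<alpha> would raise the \<alpha>-coordinate of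
  \<theta> above c \<alpha>.\<close>

lemma \<theta>_dominant: "\<alpha> \<in> S \<Longrightarrow> \<theta> \<bullet> \<alpha> \<ge> 0"
proof -
  assume \<alpha>: "\<alpha> \<in> S"
  then have "\<alpha> \<in> \<Delta>" using S_subset by blast
  have "reflection \<alpha> \<theta> \<bullet> cowt \<alpha> \<le> real (c \<alpha>)"
    using \<alpha> \<open>\<alpha> \<in> \<Delta>\<close> by (intro root_coordinate_le reflection_root \<theta>_root)
  then have "2 * (\<theta> \<bullet> \<alpha>) / (\<alpha> \<bullet> \<alpha>) \<ge> 0"
    using \<alpha> by (simp add: reflection_def inner_diff_left \<theta>_coordinate cowt_inner inner_commute [of \<alpha> "cowt \<alpha>"])
  then show ?thesis
    using inner_gt_zero_iff [of \<alpha>] root_nonzero [OF \<open>\<alpha> \<in> \<Delta>\<close>]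
      by (simp add: zero_le_divide_iff not_le [symmetric])
qed

text \<open>A long root \<nu> of maximal height is dominant, and \<theta> - \<nu> is a nonnegative
  combination of S. Pairing it with the dominant vectors \<nu> and \<theta> gives |\<theta>|^2 \<ge>
  \<theta> \<bullet> \<nu> \<ge> |\<nu>|^2.\<close>

lemma \<theta>_long: "\<theta> \<in> long_roots \<Delta>"
proof -
  have fin: "finite (long_roots \<Delta>)" using finite_\<Delta> by (simp add: long_roots_def)
  define ht where "ht x = (\<Sum>\<alpha>\<in>S. x \<bullet> cowt \<alpha>)" for x
  have "Max (ht ` long_roots \<Delta>) \<in> ht ` long_roots \<Delta>"
    using fin long_nonempty by (intro Max_in) auto
  then obtain \<nu> where \<nu>: "\<nu> \<in> long_roots \<Delta>" and "Max (ht ` long_roots \<Delta>) = ht \<nu>"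
    by blast
  then have max: "ht \<beta> \<le> ht \<nu>" if "\<beta> \<in> long_roots \<Delta>" for \<beta>
    using Max_ge [of "ht ` long_roots \<Delta>" "ht \<beta>"] fin that by simp
  have \<nu>\<Delta>: "\<nu> \<in> \<Delta>" using \<nu> by (simp add: long_roots_def)
  have dom: "\<nu> \<bullet> \<alpha> \<ge> 0" if \<alpha>: "\<alpha> \<in> S" for \<alpha>
  proof -
    have "\<alpha> \<in> \<Delta>" using \<alpha> S_subset by blast
    have "reflection \<alpha> \<nu> \<in> long_roots \<Delta>"
      using \<nu> \<open>\<alpha> \<in> \<Delta>\<close> by (simp add: long_roots_def reflection_root norm_reflection)
    then have "ht (reflection \<alpha> \<nu>) \<le> ht \<nu>" by (rule max)
    moreover have "ht \<alpha> = 1"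
    proof -
      have "ht \<alpha> = (\<Sum>\<beta>\<in>S. if \<beta> = \<alpha> then 1 else 0)"
        unfolding ht_def using \<alpha> by (intro sum.cong) (auto simp: cowt_inner inner_commute [of \<alpha>])
      then show ?thesis using \<alpha> by simp
    qed
    moreover have "ht (reflection \<alpha> \<nu>) = ht \<nu> - 2 * (\<nu> \<bullet> \<alpha>) / (\<alpha> \<bullet> \<alpha>) * ht \<alpha>"
      by (simp add: ht_def reflection_def inner_diff_left sum_subtractf sum_distrib_left)
    ultimately have "2 * (\<nu> \<bullet> \<alpha>) / (\<alpha> \<bullet> \<alpha>) \<ge> 0" by simp
    then show ?thesis
      using inner_gt_zero_iff [of \<alpha>] root_nonzero [OF \<open>\<alpha> \<in> \<Delta>\<close>]
      by (simp add: zero_le_divide_iff not_le [symmetric])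
  qed
  have comb: "\<theta> - \<nu> \<in> nonneg_combinations S"
    using highest \<nu>\<Delta> by (simp add: highest_root_def)
  have "\<nu> \<bullet> (\<theta> - \<nu>) \<ge> 0" "\<theta> \<bullet> (\<theta> - \<nu>) \<ge> 0"
    using inner_nonneg_if_dominant [OF dom comb] inner_nonneg_if_dominant [OF \<theta>_dominant comb] by simp_all
  then have "\<theta> \<bullet> \<theta> \<ge> \<nu> \<bullet> \<nu>"
    by (simp add: inner_diff_right inner_commute)
  then have "norm \<theta> \<ge> norm \<nu>" by (simp add: norm_le)
  moreover have "norm \<nu> = long_length" using \<nu> by (simp add: long_roots_def long_length_def)
  ultimately have "\<theta> \<notin> short_roots \<Delta>" using short_less [of \<theta>] by auto
  then show ?thesis using short_or_long [OF \<theta>_root] by blast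
qed

text \<open>An integral combination of long roots has squared length in \<open>L\<^sup>2 \<int>\<close>, where \<open>L\<close> is the long
  length, so it is not a short root.\<close>

definition long_integral :: "'a \<Rightarrow> bool" where
  "long_integral x \<longleftrightarrow> (x \<bullet> x) / long_length\<^sup>2 \<in> \<int> \<and>
     (\<forall>\<beta>\<in>long_roots \<Delta>. 2 * (x \<bullet> \<beta>) / long_length\<^sup>2 \<in> \<int>)"

lemma long_inner_self: "\<beta> \<in> long_roots \<Delta> \<Longrightarrow> \<beta> \<bullet> \<beta> = long_length\<^sup>2"
  by (simp add: long_roots_def long_length_def dot_square_norm)

lemma long_length_pos: "long_length > 0"
proof -
  obtain \<nu> where "\<nu> \<in> long_roots \<Delta>" using long_nonempty by blast
  then have "norm \<nu> = long_length" "\<nu> \<noteq> 0"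
    using root_nonzero by (auto simp: long_roots_def long_length_def)
  then show ?thesis using zero_less_norm_iff [of \<nu>] by simp
qed

text \<open>The cross term of the expanded square is integral by the second clause of
  \<open>long_integral\<close>, which is there to make the property stable under this step.\<close>

lemma long_integral_add:
  assumes x: "long_integral x" and \<beta>: "\<beta> \<in> long_roots \<Delta>"
  shows "long_integral (x + of_int n *\<^sub>R \<beta>)"
proof -
  have cartan: "2 * (\<beta> \<bullet> \<gamma>) / long_length\<^sup>2 \<in> \<int>" if "\<gamma> \<in> long_roots \<Delta>" for \<gamma>
    using cartan_integer [of \<gamma> \<beta>] that \<beta> long_inner_self [OF that] by (auto simp: long_roots_def)
  have "((x + of_int n *\<^sub>R \<beta>) \<bullet> (x + of_int n *\<^sub>R \<beta>)) / long_length\<^sup>2 =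
      (x \<bullet> x) / long_length\<^sup>2 + of_int n * (2 * (x \<bullet> \<beta>) / long_length\<^sup>2) + of_int n * of_int n * (\<beta> \<bullet> \<beta> / long_length\<^sup>2)"
    by (simp add: inner_left_distrib inner_right_distrib inner_commute add_divide_distrib algebra_simps)
  also have "\<dots> \<in> \<int>"
  proof -
    have "\<beta> \<bullet> \<beta> / long_length\<^sup>2 = 1" using long_inner_self [OF \<beta>] long_length_pos by simp
    moreover have "2 * (x \<bullet> \<beta>) / long_length\<^sup>2 \<in> \<int>" "(x \<bullet> x) / long_length\<^sup>2 \<in> \<int>"
      using x \<beta> by (auto simp: long_integral_def)
    ultimately show ?thesis by (intro Ints_add Ints_mult) simp_all
  qed
  finally have "((x + of_int n *\<^sub>R \<beta>) \<bullet> (x + of_int n *\<^sub>R \<beta>)) / long_length\<^sup>2 \<in> \<int>" .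
  moreover have "2 * ((x + of_int n *\<^sub>R \<beta>) \<bullet> \<gamma>) / long_length\<^sup>2 \<in> \<int>" if \<gamma>: "\<gamma> \<in> long_roots \<Delta>" for \<gamma>
  proof -
    have "2 * ((x + of_int n *\<^sub>R \<beta>) \<bullet> \<gamma>) / long_length\<^sup>2 =
        2 * (x \<bullet> \<gamma>) / long_length\<^sup>2 + of_int n * (2 * (\<beta> \<bullet> \<gamma>) / long_length\<^sup>2)"
      by (simp add: inner_left_distrib add_divide_distrib algebra_simps)
    also have "\<dots> \<in> \<int>"
      using x \<gamma> cartan [OF \<gamma>] by (intro Ints_add Ints_mult) (auto simp: long_integral_def)
    finally show ?thesis .
  qed
  ultimately show ?thesis by (simp add: long_integral_def)
qed

lemma long_integral_if_no_short_coordinate: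
  assumes x: "x \<in> root_lattice" and no_short: "\<And>\<alpha>. \<alpha> \<in> S \<inter> short_roots \<Delta> \<Longrightarrow> x \<bullet> cowt \<alpha> = 0"
  shows "long_integral x"
proof -
  have "long_integral (\<Sum>\<alpha>\<in>A. (x \<bullet> cowt \<alpha>) *\<^sub>R \<alpha>)" if "A \<subseteq> S" for A
    using finite_subset [OF that finite_S] that
  proof (induction A rule: finite_induct)
    case empty show ?case by (simp add: long_integral_def)
  next
    case (insert \<alpha> A)
    obtain n :: int where n: "x \<bullet> cowt \<alpha> = of_int n"
      using x insert.prems by (auto simp: root_lattice_def elim!: Ints_cases)
    show ?case
    proof (cases "\<alpha> \<in> short_roots \<Delta>")
      case True
      then show ?thesis using insert no_short [of \<alpha>] by simp
    next
      case False
      then have "\<alpha> \<in> long_roots \<Delta>"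
        using short_or_long [of \<alpha>] insert.prems S_subset by blast
      then show ?thesis
        using insert long_integral_add [of "\<Sum>\<alpha>\<in>A. (x \<bullet> cowt \<alpha>) *\<^sub>R \<alpha>" \<alpha> n] n
        by (simp add: add.commute)
    qed
  qed
  from this [of S] show ?thesis by (simp add: basis_expansion)
qed

text \<open>The quotient of the squared lengths lies strictly between 0 and 1.\<close>

lemma short_not_long_integral: "\<mu> \<in> short_roots \<Delta> \<Longrightarrow> \<not> long_integral \<mu>"
proof
  assume \<mu>: "\<mu> \<in> short_roots \<Delta>" "long_integral \<mu>"
  then have "\<mu> \<noteq> 0" using root_nonzero by (auto simp: short_roots_def)
  have "(norm \<mu>)\<^sup>2 < long_length\<^sup>2"
    using short_less [OF \<mu>(1)] by (intro power_strict_mono) auto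
  then have "(\<mu> \<bullet> \<mu>) / long_length\<^sup>2 < 1"
    using long_length_pos by (simp add: dot_square_norm)
  moreover have "(\<mu> \<bullet> \<mu>) / long_length\<^sup>2 > 0"
    using \<open>\<mu> \<noteq> 0\<close> long_length_pos by simp
  moreover obtain k :: int where "(\<mu> \<bullet> \<mu>) / long_length\<^sup>2 = of_int k"
    using \<mu>(2) by (auto simp: long_integral_def elim: Ints_cases)
  ultimately show False by simp
qed

text \<open>Otherwise \<mu> would be an integral combination of long simple roots. Through
  \<open>short_pairing_ge\<close> this bounds pairings with \<mu> from below; the next lemma bounds
  them from above.\<close>

lemma ex_short_coordinate:
  assumes "\<mu> \<in> short_roots \<Delta>"
  shows "\<exists>\<alpha>\<in>S \<inter> short_roots \<Delta>. \<mu> \<bullet> cowt \<alpha> \<noteq> 0"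
  using long_integral_if_no_short_coordinate [OF root_in_root_lattice, of \<mu>] short_not_long_integral assms
  by (auto simp: short_roots_def)

text \<open>Otherwise \<mu> - \<theta> would be \<open>long_integral\<close>, and so would \<mu>
  after adding the long root \<theta>.\<close>

lemma ex_short_coordinate_\<theta>:
  assumes \<mu>: "\<mu> \<in> short_roots \<Delta>"
  shows "\<exists>\<alpha>\<in>S \<inter> short_roots \<Delta>. (\<theta> - \<mu>) \<bullet> cowt \<alpha> \<noteq> 0"
proof (rule ccontr)
  assume *: "\<not> ?thesis"
  have "\<mu> - \<theta> \<in> root_lattice"
    using \<mu> root_in_root_lattice [of \<mu>] root_in_root_lattice [OF \<theta>_root]
    by (auto simp: root_lattice_def short_roots_def inner_diff_left)
  then have "long_integral (\<mu> - \<theta>)"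
    using * by (intro long_integral_if_no_short_coordinate) (auto simp: inner_diff_left)
  then have "long_integral \<mu>"
    using long_integral_add [OF _ \<theta>_long, of "\<mu> - \<theta>" 1] by simp
  then show False using short_not_long_integral [OF \<mu>] by simp
qed

text \<open>Pairs to 1 with short simple roots, to 0 with long ones and to g with \<theta>, so
  translation by its m-fold trades the dilation t for t - m g.\<close>

definition short_coweight_sum :: 'a where
  "short_coweight_sum = (\<Sum>\<alpha>\<in>S \<inter> short_roots \<Delta>. cowt \<alpha>)"

lemma short_coweight_sum_inner:
  assumes "\<alpha> \<in> S"
  shows "short_coweight_sum \<bullet> \<alpha> = (if \<alpha> \<in> short_roots \<Delta> then 1 else 0)"
proof -
  have "short_coweight_sum \<bullet> \<alpha> = (\<Sum>\<beta>\<in>S \<inter> short_roots \<Delta>. if \<beta> = \<alpha> then 1 else 0)"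
    unfolding short_coweight_sum_def inner_sum_left
    using assms by (intro sum.cong) (auto simp: cowt_inner)
  then show ?thesis using assms by simp
qed

lemma short_coweight_sum_lattice: "short_coweight_sum \<in> coweight_lattice S"
  by (simp add: coweight_lattice_def short_coweight_sum_inner)

lemma short_coweight_sum_\<theta>: "short_coweight_sum \<bullet> \<theta> = (\<Sum>\<alpha>\<in>S \<inter> short_roots \<Delta>. real (c \<alpha>))"
  unfolding short_coweight_sum_def inner_sum_left
  by (intro sum.cong) (simp_all add: inner_commute [of "cowt _"] \<theta>_coordinate)

section \<open>Good points modulo t and the comparison of counts\<close>

text \<open>Conditions for all roots instead of the positive ones make invariance under W immediate;
  signs change nothing because the range of k is symmetric.\<close>

definition semi_catalan_points :: "nat \<Rightarrow> nat \<Rightarrow> 'a set" where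
  "semi_catalan_points m t = {z \<in> coweight_lattice S.
     (\<forall>\<mu>\<in>short_roots \<Delta>. \<forall>k j :: int. \<bar>k\<bar> \<le> int m \<longrightarrow> z \<bullet> \<mu> \<noteq> of_int k + real t * of_int j) \<and>
     (\<forall>\<nu>\<in>long_roots \<Delta>. \<forall>j :: int. z \<bullet> \<nu> \<noteq> real t * of_int j)}"

lemma semi_catalan_points_weyl:
  assumes z: "z \<in> semi_catalan_points m t" and w: "w \<in> weyl_group \<Delta>"
  shows "w z \<in> semi_catalan_points m t"
proof -
  obtain w' where w': "w' \<in> weyl_group \<Delta>" "w \<circ> w' = id"
    using weyl_inverse [OF w] by blast
  have inner: "w z \<bullet> \<beta> = z \<bullet> w' \<beta>" for \<beta>
    using weyl_isometry [OF w, of z "w' \<beta>"] fun_cong [OF w'(2), of \<beta>] by simp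
  have norm: "norm (w' \<beta>) = norm \<beta>" for \<beta>
    using weyl_isometry [OF w'(1)] by (simp add: norm_eq_sqrt_inner)
  have "w' \<beta> \<in> short_roots \<Delta>" if "\<beta> \<in> short_roots \<Delta>" for \<beta>
    using that weyl_root [OF w'(1)] by (simp add: short_roots_def norm)
  moreover have "w' \<beta> \<in> long_roots \<Delta>" if "\<beta> \<in> long_roots \<Delta>" for \<beta>
    using that weyl_root [OF w'(1)] by (simp add: long_roots_def norm)
  ultimately show ?thesis
    using z weyl_coweight_lattice [OF w] by (auto simp: semi_catalan_points_def inner)
qed

lemma semi_catalan_points_translate:
  assumes z: "z \<in> semi_catalan_points m t" and p: "p \<in> coweight_lattice S"
  shows "z + real t *\<^sub>R p \<in> semi_catalan_points m t"
proof -
  have shift: "\<exists>j' :: int. z \<bullet> \<beta> = a + real t * of_int j'"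
    if "\<beta> \<in> \<Delta>" and eq: "(z + real t *\<^sub>R p) \<bullet> \<beta> = a + real t * of_int j" for \<beta> a and j :: int
  proof -
    obtain l :: int where "p \<bullet> \<beta> = of_int l"
      using coweight_root_Ints [OF p \<open>\<beta> \<in> \<Delta>\<close>] by (auto elim: Ints_cases)
    then have "z \<bullet> \<beta> = a + real t * of_int (j - l)"
      using eq by (simp add: inner_left_distrib algebra_simps)
    then show ?thesis by blast
  qed
  have "z + real t *\<^sub>R p \<in> coweight_lattice S"
    using z p by (intro coweight_lattice_add coweight_lattice_scale_Ints) (auto simp: semi_catalan_points_def)
  moreover have "(z + real t *\<^sub>R p) \<bullet> \<mu> \<noteq> of_int k + real t * of_int j"
    if "\<mu> \<in> short_roots \<Delta>" "\<bar>k\<bar> \<le> int m" for \<mu> and k j :: int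
    using shift [of \<mu> "of_int k" j] z that by (auto simp: semi_catalan_points_def short_roots_def)
  moreover have "(z + real t *\<^sub>R p) \<bullet> \<nu> \<noteq> real t * of_int j" if "\<nu> \<in> long_roots \<Delta>" for \<nu> and j :: int
    using shift [of \<nu> 0 j] z that by (auto simp: semi_catalan_points_def long_roots_def)
  ultimately show ?thesis by (simp add: semi_catalan_points_def)
qed

lemma semi_catalan_points_regular:
  assumes z: "z \<in> semi_catalan_points m t" and \<alpha>: "\<alpha> \<in> \<Delta>"
  shows "z \<bullet> \<alpha> \<noteq> real t * of_int k"
proof (cases "\<alpha> \<in> short_roots \<Delta>")
  case True
  moreover have "\<bar>0 :: int\<bar> \<le> int m" by simp
  ultimately have "z \<bullet> \<alpha> \<noteq> of_int 0 + real t * of_int k"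
    using z unfolding semi_catalan_points_def by blast
  then show ?thesis by simp
next
  case False
  then show ?thesis using short_or_long [OF \<alpha>] z by (auto simp: semi_catalan_points_def)
qed

text \<open>In the expansion of x \<bullet> y over S all terms are nonnegative, and the term at
  \<alpha> is already at least m + 1.\<close>

lemma short_pairing_ge:
  assumes x: "x \<in> open_alcove t" and short: "\<And>\<alpha>. \<alpha> \<in> S \<inter> short_roots \<Delta> \<Longrightarrow> x \<bullet> \<alpha> \<ge> real m + 1"
    and y: "y \<in> nonneg_combinations S" and \<alpha>: "\<alpha> \<in> S \<inter> short_roots \<Delta>" "y \<bullet> cowt \<alpha> \<noteq> 0"
  shows "x \<bullet> y \<ge> real m + 1"
proof -
  have pos: "\<And>\<beta>. \<beta> \<in> S \<Longrightarrow> x \<bullet> \<beta> > 0" using x by (simp add: open_alcove_iff)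
  have nn: "y \<bullet> cowt \<beta> \<ge> 0" if "\<beta> \<in> S" for \<beta>
    using y that by (auto simp: nonneg_combinations_iff elim!: Nats_cases)
  obtain n :: nat where n: "y \<bullet> cowt \<alpha> = real n"
    using y \<alpha>(1) by (auto simp: nonneg_combinations_iff elim!: Nats_cases)
  have "(real m + 1) * 1 \<le> (x \<bullet> \<alpha>) * (y \<bullet> cowt \<alpha>)"
    using short [OF \<alpha>(1)] n \<alpha>(2) by (intro mult_mono) auto
  also have "\<dots> \<le> x \<bullet> y"
    unfolding inner_expansion [of x y] using \<alpha>(1) pos nn
    by (intro member_le_sum) (auto simp: less_imp_le)
  finally show ?thesis by simp
qed

text \<open>At a good alcove point the short simple pairings are positive integers other than 1,
  ..., m, so subtracting m leaves them positive. Conversely, for a translated point x and short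
  positive \<mu>, m < x \<bullet> \<mu> < t - m excludes every forbidden congruence.\<close>

lemma card_semi_catalan_alcove:
  assumes g: "g = (\<Sum>\<alpha>\<in>S \<inter> short_roots \<Delta>. c \<alpha>)" and t: "t > m * g"
  shows "card (semi_catalan_points m t \<inter> open_alcove (real t)) =
    card (coweight_lattice S \<inter> open_alcove (real (t - m * g)))"
proof -
  let ?\<rho> = "real m *\<^sub>R short_coweight_sum"
  have \<rho>\<theta>: "?\<rho> \<bullet> \<theta> = real (m * g)"
    by (simp add: short_coweight_sum_\<theta> g)
  have \<rho>P: "?\<rho> \<in> coweight_lattice S"
    by (intro coweight_lattice_scale_Ints short_coweight_sum_lattice) simp
  have tmg: "real (t - m * g) = real t - real (m * g)"
    using t by simp
  have "bij_betw (\<lambda>y. y + ?\<rho>) (coweight_lattice S \<inter> open_alcove (real (t - m * g)))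
      (semi_catalan_points m t \<inter> open_alcove (real t))"
  proof (rule bij_betwI [where g = "\<lambda>x. x - ?\<rho>"])
    show "(\<lambda>x. x - ?\<rho>) \<in> semi_catalan_points m t \<inter> open_alcove (real t) \<rightarrow>
        coweight_lattice S \<inter> open_alcove (real (t - m * g))"
    proof
      fix x assume x: "x \<in> semi_catalan_points m t \<inter> open_alcove (real t)"
      then have xP: "x \<in> coweight_lattice S" by (simp add: semi_catalan_points_def)
      have pos: "\<And>\<beta>. \<beta> \<in> S \<Longrightarrow> x \<bullet> \<beta> > 0" "x \<bullet> \<theta> < real t" using x by (auto simp: open_alcove_iff)
      have "(x - ?\<rho>) \<bullet> \<alpha> > 0" if \<alpha>: "\<alpha> \<in> S" for \<alpha>
      proof (cases "\<alpha> \<in> short_roots \<Delta>")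
        case True
        obtain l :: int where l: "x \<bullet> \<alpha> = of_int l"
          using xP \<alpha> by (auto simp: coweight_lattice_def elim: Ints_cases)
        have "l > int m"
        proof (rule ccontr)
          assume "\<not> l > int m"
          then have "\<bar>l\<bar> \<le> int m" using pos(1) [OF \<alpha>] l by simp
          then have "x \<bullet> \<alpha> \<noteq> of_int l + real t * of_int 0"
            using x True unfolding semi_catalan_points_def by blast
          then show False using l by simp
        qed
        then show ?thesis using l True \<alpha> by (simp add: inner_diff_left short_coweight_sum_inner)
      next
        case False
        then show ?thesis using \<alpha> pos by (simp add: inner_diff_left short_coweight_sum_inner)
      qed
      moreover have "(x - ?\<rho>) \<bullet> \<theta> < real (t - m * g)"
        unfolding inner_diff_left \<rho>\<theta> tmg using pos(2) by simp
      ultimately show "x - ?\<rho> \<in> coweight_lattice S \<inter> open_alcove (real (t - m * g))"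
        using coweight_lattice_diff [OF xP \<rho>P] by (simp add: open_alcove_iff)
    qed
    show "(\<lambda>y. y + ?\<rho>) \<in> coweight_lattice S \<inter> open_alcove (real (t - m * g)) \<rightarrow>
        semi_catalan_points m t \<inter> open_alcove (real t)"
    proof
      fix y assume y: "y \<in> coweight_lattice S \<inter> open_alcove (real (t - m * g))"
      let ?x = "y + ?\<rho>"
      have pos: "\<And>\<beta>. \<beta> \<in> S \<Longrightarrow> y \<bullet> \<beta> > 0" "y \<bullet> \<theta> < real t - real (m * g)"
        using y tmg by (auto simp: open_alcove_iff)
      have xP: "?x \<in> coweight_lattice S" using y \<rho>P by (intro coweight_lattice_add) auto
      have "?x \<bullet> \<alpha> > 0" if "\<alpha> \<in> S" for \<alpha>
        using pos(1) [OF that] that by (simp add: inner_left_distrib short_coweight_sum_inner)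
      moreover have x\<theta>: "?x \<bullet> \<theta> < real t"
        unfolding inner_left_distrib \<rho>\<theta> using pos(2) by simp
      ultimately have alc: "?x \<in> open_alcove (real t)" by (simp add: open_alcove_iff)
      have short: "?x \<bullet> \<alpha> \<ge> real m + 1" if \<alpha>: "\<alpha> \<in> S \<inter> short_roots \<Delta>" for \<alpha>
      proof -
        have "y \<bullet> \<alpha> \<in> \<int>" using y \<alpha> by (simp add: coweight_lattice_def)
        then have "y \<bullet> \<alpha> \<ge> 1" using pos(1) [of \<alpha>] \<alpha> Ints_ge_Suc [of "y \<bullet> \<alpha>" 0] by simp
        then show ?thesis using \<alpha> by (simp add: inner_left_distrib short_coweight_sum_inner)
      qed
      \<comment> \<open>The lower bound for \<theta> - \<mu> together with x \<bullet> \<theta> < t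
        is the upper bound for \<mu>.\<close>
      have short_range: "real m < ?x \<bullet> \<mu> \<and> ?x \<bullet> \<mu> < real t - real m"
        if \<mu>: "\<mu> \<in> short_roots \<Delta>" "\<mu> \<in> nonneg_combinations S" for \<mu>
      proof -
        have \<mu>\<Delta>: "\<mu> \<in> \<Delta>" using \<mu> by (simp add: short_roots_def)
        have "?x \<bullet> \<mu> \<ge> real m + 1"
          using ex_short_coordinate [OF \<mu>(1)] short_pairing_ge [OF alc short \<mu>(2)] by blast
        moreover have "\<theta> - \<mu> \<in> nonneg_combinations S"
          using highest \<mu>\<Delta> by (simp add: highest_root_def)
        then have "?x \<bullet> (\<theta> - \<mu>) \<ge> real m + 1"
          using ex_short_coordinate_\<theta> [OF \<mu>(1)] short_pairing_ge [OF alc short] by blast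
        ultimately show ?thesis using x\<theta> by (simp add: inner_diff_right)
      qed
      have "?x \<bullet> \<mu> \<noteq> of_int k + real t * of_int j"
        if \<mu>: "\<mu> \<in> short_roots \<Delta>" and k: "\<bar>k\<bar> \<le> int m" for \<mu> and k j :: int
      proof (cases "\<mu> \<in> nonneg_combinations S")
        case True
        then show ?thesis using short_range [OF \<mu>] not_cong_small k by blast
      next
        case False
        have "\<mu> \<in> \<Delta>" using \<mu> by (simp add: short_roots_def)
        then have neg: "- \<mu> \<in> nonneg_combinations S" "- \<mu> \<in> short_roots \<Delta>"
          using False root_nonneg_or_nonpos uminus_root \<mu> by (auto simp: short_roots_def)
        have "?x \<bullet> (- \<mu>) \<noteq> of_int (- k) + real t * of_int (- j)"
          using short_range [OF neg(2,1)] not_cong_small [of m "?x \<bullet> (- \<mu>)" t "- k" "- j"] k by simp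
        then have "- (?x \<bullet> \<mu>) \<noteq> - (of_int k + real t * of_int j)" by simp
        then show ?thesis by (rule contrapos_nn) (rule arg_cong)
      qed
      \<comment> \<open>For long roots it is enough that no affine root vanishes inside the open
        alcove.\<close>
      moreover have "?x \<bullet> \<nu> \<noteq> real t * of_int j" if \<nu>: "\<nu> \<in> long_roots \<Delta>" for \<nu> and j :: int
      proof
        assume eq: "?x \<bullet> \<nu> = real t * of_int j"
        have root: "(\<nu>, - of_int j) \<in> affine_roots"
          using \<nu> by (simp add: affine_roots_def long_roots_def)
        have "affine_value t ?x (\<nu>, - of_int j) = 0"
          using eq by (simp add: affine_value_def)
        moreover have "affine_value t ?x (\<nu>, - of_int j) > 0 \<or> affine_value t ?x (- (\<nu>, - of_int j)) > 0"
          using affine_pos_or_neg [OF root] affine_value_pos [OF alc] root uminus_affine_root [OF root] by blast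
        ultimately show False unfolding affine_value_uminus by simp
      qed
      ultimately show "?x \<in> semi_catalan_points m t \<inter> open_alcove (real t)"
        using xP alc by (simp add: semi_catalan_points_def)
    qed
  qed auto
  then show ?thesis using bij_betw_same_card by metis
qed

lemma card_alcove_positive_solutions:
  "card (coweight_lattice S \<inter> open_alcove (real s)) = card (positive_solutions S c (int s))"
proof (rule bij_betw_same_card)
  show "bij_betw (\<lambda>z. \<lambda>\<alpha>\<in>S. \<lfloor>z \<bullet> \<alpha>\<rfloor>) (coweight_lattice S \<inter> open_alcove (real s)) (positive_solutions S c (int s))"
  proof (rule bij_betw_coordinates_subset)
    fix z assume z: "z \<in> coweight_lattice S"
    have "z \<bullet> \<theta> = (\<Sum>\<alpha>\<in>S. of_int \<lfloor>z \<bullet> \<alpha>\<rfloor> * real (c \<alpha>))"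
      unfolding inner_expansion [of z \<theta>]
      by (intro sum.cong) (simp_all add: \<theta>_coordinate of_int_floor_inner [OF z])
    also have "\<dots> = of_int (\<Sum>\<alpha>\<in>S. int (c \<alpha>) * (\<lambda>\<alpha>\<in>S. \<lfloor>z \<bullet> \<alpha>\<rfloor>) \<alpha>)"
      by (simp add: mult.commute)
    finally have "z \<bullet> \<theta> < real s \<longleftrightarrow> (\<Sum>\<alpha>\<in>S. int (c \<alpha>) * (\<lambda>\<alpha>\<in>S. \<lfloor>z \<bullet> \<alpha>\<rfloor>) \<alpha>) < int s"
      by (metis of_int_less_iff of_int_of_nat_eq)
    moreover have "z \<bullet> \<alpha> > 0 \<longleftrightarrow> \<lfloor>z \<bullet> \<alpha>\<rfloor> \<ge> 1" if "\<alpha> \<in> S" for \<alpha>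
      using of_int_floor_inner [OF z that] by linarith
    ultimately show "(\<lambda>\<alpha>\<in>S. \<lfloor>z \<bullet> \<alpha>\<rfloor>) \<in> positive_solutions S c (int s) \<longleftrightarrow>
        z \<in> coweight_lattice S \<inter> open_alcove (real s)"
      using z by (auto simp: positive_solutions_def open_alcove_iff PiE_iff)
  qed (auto simp: positive_solutions_def)
qed

text \<open>The hyperplanes listed as integral equations, the form that
  \<open>finite_field_method\<close> takes.\<close>

definition semi_catalan_index :: "nat \<Rightarrow> ('a \<times> int) set" where
  "semi_catalan_index m = (positive_roots \<Delta> S \<inter> short_roots \<Delta>) \<times> {- int m..int m} \<union>
     (positive_roots \<Delta> S \<inter> long_roots \<Delta>) \<times> {0}"

lemma semi_catalan_arrangement_image:
  "semi_catalan_arrangement m \<Delta> S = (\<lambda>(r, k). hyperplane r (of_int k)) ` semi_catalan_index m"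
  unfolding semi_catalan_arrangement_def semi_catalan_index_def image_Un
  by (intro arg_cong2 [where f = "(\<union>)"]) force+

lemma avoiding_mod_semi_catalan:
  "avoiding_mod q (semi_catalan_index m) = semi_catalan_points m q \<inter> fbox q"
proof
  show "semi_catalan_points m q \<inter> fbox q \<subseteq> avoiding_mod q (semi_catalan_index m)"
    by (auto simp: avoiding_mod_def semi_catalan_index_def semi_catalan_points_def)
  show "avoiding_mod q (semi_catalan_index m) \<subseteq> semi_catalan_points m q \<inter> fbox q"
  proof
    fix z assume z: "z \<in> avoiding_mod q (semi_catalan_index m)"
    then have avoid: "\<And>r k j. (r, k) \<in> semi_catalan_index m \<Longrightarrow> z \<bullet> r \<noteq> of_int k + real q * of_int j"
      and box: "z \<in> fbox q"
      by (auto simp: avoiding_mod_def)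
    \<comment> \<open>The congruence of \<beta> with k is that of - \<beta> with - k, so positive
      roots suffice.\<close>
    have pos: "z \<bullet> \<beta> \<noteq> of_int k + real q * of_int j"
      if "(\<beta>, k) \<in> semi_catalan_index m \<or> (- \<beta>, - k) \<in> semi_catalan_index m" for \<beta> k j
      using avoid [of \<beta> k j] avoid [of "- \<beta>" "- k" "- j"] that by auto
    have "z \<bullet> \<mu> \<noteq> of_int k + real q * of_int j"
      if \<mu>: "\<mu> \<in> short_roots \<Delta>" "\<bar>k\<bar> \<le> int m" for \<mu> and k j :: int
    proof (rule pos)
      have "\<mu> \<in> \<Delta>" using \<mu> by (simp add: short_roots_def)
      then show "(\<mu>, k) \<in> semi_catalan_index m \<or> (- \<mu>, - k) \<in> semi_catalan_index m"
        using root_nonneg_or_nonpos [of \<mu>] uminus_root [of \<mu>] \<mu>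
        by (auto simp: semi_catalan_index_def positive_roots_def short_roots_def)
    qed
    moreover have "z \<bullet> \<nu> \<noteq> real q * of_int j" if \<nu>: "\<nu> \<in> long_roots \<Delta>" for \<nu> and j :: int
    proof -
      have "\<nu> \<in> \<Delta>" using \<nu> by (simp add: long_roots_def)
      then have "(\<nu>, 0) \<in> semi_catalan_index m \<or> (- \<nu>, - 0) \<in> semi_catalan_index m"
        using root_nonneg_or_nonpos [of \<nu>] uminus_root [of \<nu>] \<nu>
        by (auto simp: semi_catalan_index_def positive_roots_def long_roots_def)
      then show ?thesis using pos [of \<nu> 0 j] by simp
    qed
    ultimately show "z \<in> semi_catalan_points m q \<inter> fbox q"
      using box by (auto simp: semi_catalan_points_def fbox_def)
  qed
qed

lemma scaled_fundamental_alcove: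
  assumes "s > 0"
  shows "(\<lambda>x. s *\<^sub>R x) ` fundamental_alcove S \<theta> = open_alcove s"
proof
  show "(\<lambda>x. s *\<^sub>R x) ` fundamental_alcove S \<theta> \<subseteq> open_alcove s"
    using assms by (auto simp: fundamental_alcove_def open_alcove_iff)
  show "open_alcove s \<subseteq> (\<lambda>x. s *\<^sub>R x) ` fundamental_alcove S \<theta>"
  proof
    fix x assume "x \<in> open_alcove s"
    then have "x /\<^sub>R s \<in> fundamental_alcove S \<theta>"
      using assms by (auto simp: fundamental_alcove_def open_alcove_iff divide_simps)
    then show "x \<in> (\<lambda>x. s *\<^sub>R x) ` fundamental_alcove S \<theta>"
      using assms by (intro image_eqI [of _ _ "x /\<^sub>R s"]) auto
  qed
qed

text \<open>Permits the final division by f. The orbit count for m = 0 is used at one more than the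
  height of \<theta>, a dilation whose alcove contains the sum of all fundamental coweights.\<close>

lemma index_pos: "subgroup_index (coweight_lattice S) (coroot_lattice S) > 0"
proof -
  define t where "t = 1 + (\<Sum>\<alpha>\<in>S. c \<alpha>)"
  let ?x = "\<Sum>\<alpha>\<in>S. 1 *\<^sub>R cowt \<alpha>"
  have x: "?x \<bullet> \<alpha> = 1" if "\<alpha> \<in> S" for \<alpha>
    using that by (rule sum_cowt_inner)
  then have "?x \<bullet> \<theta> = (\<Sum>\<alpha>\<in>S. real (c \<alpha>))"
    unfolding inner_expansion [of _ \<theta>] by (intro sum.cong) (simp_all add: \<theta>_coordinate)
  then have "?x \<in> coweight_lattice S \<inter> open_alcove (real t)"
    using x by (simp add: coweight_lattice_def open_alcove_iff t_def)
  moreover have "finite (coweight_lattice S \<inter> open_alcove (real t))"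
    using open_alcove_subset_fbox by (intro finite_subset [OF _ finite_fbox [of t]]) auto
  ultimately have "card (coweight_lattice S \<inter> open_alcove (real t)) \<noteq> 0"
    by auto
  then have ne: "semi_catalan_points 0 t \<inter> open_alcove (real t) \<noteq> {}"
    using card_semi_catalan_alcove [OF refl, of 0 t] by (auto simp: t_def)
  show ?thesis
  proof (rule orbit_count(2) [OF _ _ _ _ _ ne])
    show "semi_catalan_points 0 t \<subseteq> coweight_lattice S"
      by (auto simp: semi_catalan_points_def)
    show "t > 0" by (simp add: t_def)
  qed (rule semi_catalan_points_regular semi_catalan_points_weyl semi_catalan_points_translate; assumption)+
qed

text \<open>Joins the finite field method, the orbit count and the translation, free of division so
  that both sides can be compared as polynomials.\<close>

lemma semi_catalan_good_value:
  assumes g: "g = (\<Sum>\<alpha>\<in>S \<inter> short_roots \<Delta>. c \<alpha>)"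
  shows "\<exists>N>0. \<forall>q>1. coprime q N \<and> q > m * g \<longrightarrow>
    int (card (weyl_group \<Delta>) * card (positive_solutions S c (int (q - m * g)))) =
    poly (characteristic_polynomial (semi_catalan_arrangement m \<Delta> S)) (int q) *
      int (subgroup_index (coweight_lattice S) (coroot_lattice S))"
proof -
  have "finite (semi_catalan_index m)"
    using finite_\<Delta> by (auto simp: semi_catalan_index_def short_roots_def long_roots_def positive_roots_def)
  moreover have "fst ` semi_catalan_index m \<subseteq> \<Delta>"
    by (auto simp: semi_catalan_index_def positive_roots_def)
  then have "fst ` semi_catalan_index m \<subseteq> root_lattice" "0 \<notin> fst ` semi_catalan_index m"
    using root_in_root_lattice zero_not_root by auto
  ultimately obtain N where N: "N > 0" "\<And>q. q > 1 \<Longrightarrow> coprime q N \<Longrightarrow>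
      poly (characteristic_polynomial (semi_catalan_arrangement m \<Delta> S)) (int q) =
      int (card (semi_catalan_points m q \<inter> fbox q))"
    using finite_field_method [of "semi_catalan_index m"]
    unfolding semi_catalan_arrangement_image avoiding_mod_semi_catalan by blast
  have "card (weyl_group \<Delta>) * card (positive_solutions S c (int (q - m * g))) =
      card (semi_catalan_points m q \<inter> fbox q) * subgroup_index (coweight_lattice S) (coroot_lattice S)"
    if "q > m * g" for q
    unfolding card_alcove_positive_solutions [symmetric] card_semi_catalan_alcove [OF g that, symmetric]
  proof (rule orbit_count(1))
    show "q > 0" using that by simp
    show "semi_catalan_points m q \<subseteq> coweight_lattice S"
      by (auto simp: semi_catalan_points_def)
  qed (rule semi_catalan_points_regular semi_catalan_points_weyl semi_catalan_points_translate; assumption)+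
  then show ?thesis
    using N by (intro exI [of _ N]) (simp flip: of_nat_mult)
qed

end

lemma poly_eq_if_infinitely_often:
  fixes p q :: "real poly"
  assumes "infinite U" and "\<And>u :: nat. u \<in> U \<Longrightarrow> poly p (real u) = poly q (real u)"
  shows "p = q"
proof (rule ccontr)
  assume "p \<noteq> q"
  then have "finite {x. poly (p - q) x = 0}" by (intro poly_roots_finite) simp
  moreover have "real ` U \<subseteq> {x. poly (p - q) x = 0}" using assms(2) by auto
  ultimately have "finite (real ` U)" by (rule finite_subset [rotated])
  then show False using assms(1) by (simp add: finite_image_iff inj_on_def)
qed

theorem theorem6p4:
  fixes \<Delta> S :: "'a::euclidean_space set"
    and \<theta> :: 'a
    and c :: "'a \<Rightarrow> nat"
    and m t g :: nat
  assumes "crystallographic_root_system \<Delta>"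
    and "reduced_roots \<Delta>"
    and "irreducible_roots \<Delta>"
    and "two_root_lengths \<Delta>"
    and "simple_roots \<Delta> S"
    and "highest_root \<Delta> S \<theta>"
    and "\<theta> = (\<Sum>\<alpha>\<in>S. real (c \<alpha>) *\<^sub>R \<alpha>)"
    and "g = (\<Sum>\<alpha>\<in>S \<inter> short_roots \<Delta>. c \<alpha>)"
    and "t > m * g"
    and "\<And>\<alpha>. \<alpha> \<in> S \<Longrightarrow> coprime t (c \<alpha>)"
    and "\<And>\<alpha>. \<alpha> \<in> S \<Longrightarrow> coprime (t - m * g) (c \<alpha>)"
  shows "real_of_int (poly (characteristic_polynomial (semi_catalan_arrangement m \<Delta> S)) (int t)) =
      real (card (weyl_group \<Delta>)) / real (subgroup_index (coweight_lattice S) (coroot_lattice S)) *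
      real (card ((\<lambda>x. real (t - m * g) *\<^sub>R x) ` fundamental_alcove S \<theta> \<inter> coweight_lattice S))"
proof -
  interpret two_length_root_system \<Delta> S \<theta> c
    by unfold_locales (use assms in auto)
  let ?\<chi> = "characteristic_polynomial (semi_catalan_arrangement m \<Delta> S)"
  let ?f = "subgroup_index (coweight_lattice S) (coroot_lattice S)"
  let ?W = "card (weyl_group \<Delta>)"
  define s where "s = t - m * g"
  \<comment> \<open>A common multiple of the c \<alpha>, as the quasi-polynomial count demands, and
    still coprime to t because each c \<alpha> is.\<close>
  define M where "M = (\<Prod>\<alpha>\<in>S. c \<alpha>)"
  have "s > 0" using assms(9) by (simp add: s_def)
  have "M > 0" using c_pos by (auto simp: M_def intro!: prod_pos)
  have "coprime t M" using assms(10) by (auto simp: M_def intro!: prod_coprime_right)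
  obtain p where p: "\<And>n :: nat. real (card (positive_solutions S c (int s + int M * int n))) = poly p (real n)"
  proof -
    have "c \<alpha> dvd M" if "\<alpha> \<in> S" for \<alpha> unfolding M_def using that by (intro dvd_prodI) auto
    then have "\<exists>p :: real poly. \<forall>n :: nat. real (card (positive_solutions S c (int s + int M * int n))) = poly p (real n)"
      using c_pos \<open>s > 0\<close> by (intro positive_solutions_quasipolynomial) auto
    then show ?thesis using that by blast
  qed
  obtain N where "N > 0" and N: "\<And>q. q > 1 \<Longrightarrow> coprime q N \<Longrightarrow> q > m * g \<Longrightarrow>
    int (?W * card (positive_solutions S c (int (q - m * g)))) = poly ?\<chi> (int q) * int ?f"
    using semi_catalan_good_value [OF assms(8), of m] by blast
  \<comment> \<open>Leaving out 0 and 1 ensures t + M * u > 1.\<close>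
  define U where "U = {u. coprime (t + M * u) N} - {0, 1}"
  have "infinite U"
    unfolding U_def using infinite_coprime_in_progression [OF \<open>coprime t M\<close> \<open>N > 0\<close>] by simp
  have U: "int (?W * card (positive_solutions S c (int s + int M * int u))) = poly ?\<chi> (int (t + M * u)) * int ?f"
    if "u \<in> U" for u
  proof -
    have "u \<ge> 2" using that by (cases u; cases "u - 1") (auto simp: U_def)
    then have "1 * 2 \<le> M * u" using \<open>M > 0\<close> by (intro mult_le_mono) auto
    then show ?thesis
      using N [of "t + M * u"] that assms(9) by (auto simp: U_def s_def of_nat_diff algebra_simps)
  qed
  \<comment> \<open>The characteristic polynomial composed with t + M u, over the reals and in the
    variable u.\<close>
  define \<chi>' where "\<chi>' = (\<Sum>i\<le>degree ?\<chi>. smult (of_int (coeff ?\<chi> i)) ([:real t, real M:] ^ i))"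
  have \<chi>': "poly \<chi>' (real u) = of_int (poly ?\<chi> (int (t + M * u)))" for u
    by (simp add: \<chi>'_def poly_sum poly_altdef [of ?\<chi>] mult.commute)
  have "smult (real ?W) p = smult (real ?f) \<chi>'"
  proof (rule poly_eq_if_infinitely_often [OF \<open>infinite U\<close>])
    fix u assume "u \<in> U"
    then show "poly (smult (real ?W) p) (real u) = poly (smult (real ?f) \<chi>') (real u)"
      using arg_cong [OF U, of u real_of_int] p [of u] \<chi>' [of u] by (simp add: mult.commute)
  qed
  \<comment> \<open>The polynomials agree at infinitely many u, hence at u = 0, although t itself
    need not be coprime to N.\<close>
  then have "real ?W * poly p 0 = real ?f * poly \<chi>' 0"
    by (metis poly_smult)
  then have main: "real ?W * real (card (positive_solutions S c (int s))) = real ?f * of_int (poly ?\<chi> (int t))"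
    using p [of 0] \<chi>' [of 0] by simp
  have "card ((\<lambda>x. real (t - m * g) *\<^sub>R x) ` fundamental_alcove S \<theta> \<inter> coweight_lattice S) =
      card (positive_solutions S c (int s))"
    using \<open>s > 0\<close> by (simp add: scaled_fundamental_alcove card_alcove_positive_solutions Int_commute flip: s_def)
  then show ?thesis
    using main index_pos by (simp add: field_simps)
qed

end
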